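(* Let $M\in\mathbb{Z}_+$ be fixed. GDF and GPF restricted to instances $(G,\mathbf k,\mathbf u)$ with $u(v)\leq M$ for all vertices $v$ are polynomial-time solvable on graphs of bounded clique-width (i.e. on graphs of clique-width at most $c$, for any fixed constant $c$). As a consequence, for a given $\ell\in\mathbb{Z}_+$, Free $\ell$-$\mathcal L$DF, Free $\ell$-$\mathcal L$PF and $\ell$-$\mathcal L$DF are polynomial-time solvable on graphs of bounded clique-width.
   Context: Graphs are finite, simple, undirected; $N[v]$ is the closed neighborhood; $f(U)=\sum_{x\in U}f(x)$; $[0,\ell]=\{0,\dots,\ell\}$; $F$ is a symbol meaning "free". The clique-width of a graph $G$ is the minimum number of labels needed to construct $G$ using: creation of a new vertex with label $i$; disjoint union of two labelled graphs; joining by an edge every vertex labelled $i$ to every vertex labelled $j$ ($i\neq j$); renaming label $i$ to label $j$. GDF (resp. GPF): given $G=(V,E)$ and $\mathbf k,\mathbf u\in\mathbb{Z}_+^V$, compute the minimum (resp. maximum) of $f(V)$ over $f:V\to\mathbb{Z}_+$ with $f(v)\leq u(v)$ and $f(N[v])\geq k(v)$ (resp. $f(N[v])\leq k(v)$) for all $v$. For fixed $\ell$: $\ell$-$\mathcal L$DF (resp. $\ell$-$\mathcal L$PF): given $G$, $\mathbf k\in\mathbb{Z}_+^V$, $\mathbf t\in\{0,F\}^V$, compute the minimum (resp. maximum) of $f(V)$ over $f:V\to[0,\ell]$ with $f(N[v])\geq k(v)$ (resp. $f(N[v])\leq k(v)$) for all $v$ and $f(v)=0$ whenever $t(v)=0$.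 The Free versions restrict to instances with $t(v)=F$ for all $v$. *)

theory Defs
  imports
    "HOL-Computational_Algebra.Polynomial"
    "Graph_Theory.Pair_Digraph"
begin

section \<open>Clique-width\<close>

text \<open>
  A finite simple undirected graph is a \<^locale>\<open>pair_graph\<close>: each edge is represented by the two
  arcs joining its ends. The predicate \<open>cw_constructible c G lab\<close> says that \<open>G\<close>, with the vertex
  labelling \<open>lab\<close>, can be built from the label set \<open>{..<c}\<close>. Values of \<open>lab\<close> outside
  \<open>pverts G\<close> are irrelevant.
\<close>

inductive cw_constructible :: "nat \<Rightarrow> 'a pair_pre_digraph \<Rightarrow> ('a \<Rightarrow> nat) \<Rightarrow> bool"
  for c :: nat where
  create: "i < c \<Longrightarrow> lab v = i \<Longrightarrow> cw_constructible c \<lparr>pverts = {v}, parcs = {}\<rparr> lab"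
| disjoint_union:
    "cw_constructible c G lab \<Longrightarrow> cw_constructible c H lab' \<Longrightarrow> pverts G \<inter> pverts H = {} \<Longrightarrow>
     cw_constructible c \<lparr>pverts = pverts G \<union> pverts H, parcs = parcs G \<union> parcs H\<rparr>
       (\<lambda>v. if v \<in> pverts G then lab v else lab' v)"
| join:
    "cw_constructible c G lab \<Longrightarrow> i < c \<Longrightarrow> j < c \<Longrightarrow> i \<noteq> j \<Longrightarrow>
     cw_constructible c
       \<lparr>pverts = pverts G,
        parcs = parcs G \<union> {(v, w). v \<in> pverts G \<and> w \<in> pverts G \<and>
                                  (lab v = i \<and> lab w = j \<or> lab v = j \<and> lab w = i)}\<rparr> lab"
| rename:
    "cw_constructible c G lab \<Longrightarrow> i < c \<Longrightarrow> j < c \<Longrightarrow>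
     cw_constructible c G (\<lambda>v. if lab v = i then j else lab v)"

text \<open>The graph without vertices, which no expression constructs, gets clique-width 0.\<close>

definition clique_width :: "'a pair_pre_digraph \<Rightarrow> nat" where
  "clique_width G =
     (if pverts G = {} then 0 else (LEAST c. \<exists>lab. cw_constructible c G lab))"


section \<open>Domination and packing problems\<close>

definition closed_nbhd :: "'a pair_pre_digraph \<Rightarrow> 'a \<Rightarrow> 'a set" where
  "closed_nbhd G v = insert v {w. (v, w) \<in> parcs G}"

text \<open>The optimum is \<^const>\<open>None\<close> if there is no feasible solution.\<close>

definition min_value :: "nat set \<Rightarrow> nat option" where
  "min_value S = (if S = {} then None else Some (Min S))"

definition max_value :: "nat set \<Rightarrow> nat option" where
  "max_value S = (if S = {} then None else Some (Max S))"

datatype mark = Zero | Free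

type_synonym graph = "nat pair_pre_digraph"
type_synonym bounded_inst = "graph \<times> (nat \<Rightarrow> nat) \<times> (nat \<Rightarrow> nat)"
type_synonym marked_inst = "graph \<times> (nat \<Rightarrow> nat) \<times> (nat \<Rightarrow> mark)"

fun GDF :: "bounded_inst \<Rightarrow> nat option" where
  "GDF (G, k, u) = min_value {\<Sum>v\<in>pverts G. f v | f :: nat \<Rightarrow> nat.
     \<forall>v\<in>pverts G. f v \<le> u v \<and> (\<Sum>w\<in>closed_nbhd G v. f w) \<ge> k v}"

fun GPF :: "bounded_inst \<Rightarrow> nat option" where
  "GPF (G, k, u) = max_value {\<Sum>v\<in>pverts G. f v | f :: nat \<Rightarrow> nat.
     \<forall>v\<in>pverts G. f v \<le> u v \<and> (\<Sum>w\<in>closed_nbhd G v. f w) \<le> k v}"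

fun LDF :: "nat \<Rightarrow> marked_inst \<Rightarrow> nat option" where
  "LDF l (G, k, t) = min_value {\<Sum>v\<in>pverts G. f v | f :: nat \<Rightarrow> nat.
     \<forall>v\<in>pverts G. f v \<in> {0..l} \<and> (\<Sum>w\<in>closed_nbhd G v. f w) \<ge> k v \<and> (t v = Zero \<longrightarrow> f v = 0)}"

fun LPF :: "nat \<Rightarrow> marked_inst \<Rightarrow> nat option" where
  "LPF l (G, k, t) = max_value {\<Sum>v\<in>pverts G. f v | f :: nat \<Rightarrow> nat.
     \<forall>v\<in>pverts G. f v \<in> {0..l} \<and> (\<Sum>w\<in>closed_nbhd G v. f w) \<le> k v \<and> (t v = Zero \<longrightarrow> f v = 0)}"


section \<open>Polynomial-time computation\<close>

text \<open>
  The machine model is the language WHILE of N. D. Jones (Computability and Complexity: From a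
  Programming Perspective, 1997): imperative programs whose variables hold binary trees. An
  assignment is charged the size of the tree that it stores (and not one unit, as in the book), so
  no data is produced without being paid for. Hence a program and a multitape Turing machine
  simulate each other with polynomial overhead.
\<close>

datatype data = Leaf | Node data data

fun left :: "data \<Rightarrow> data" where
  "left Leaf = Leaf"
| "left (Node a b) = a"

fun right :: "data \<Rightarrow> data" where
  "right Leaf = Leaf"
| "right (Node a b) = b"

text \<open>
  On the type \<^typ>\<open>data\<close> the function \<^const>\<open>size\<close> counts the occurrences of \<^const>\<open>Node\<close>.
\<close>

datatype expr = Var nat | Nil_expr | Cons_expr expr expr | Hd_expr expr | Tl_expr expr

type_synonym store = "nat \<Rightarrow> data"

fun eval_expr :: "expr \<Rightarrow> store \<Rightarrow> data" where
  "eval_expr (Var x) s = s x"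
| "eval_expr Nil_expr s = Leaf"
| "eval_expr (Cons_expr d e) s = Node (eval_expr d s) (eval_expr e s)"
| "eval_expr (Hd_expr e) s = left (eval_expr e s)"
| "eval_expr (Tl_expr e) s = right (eval_expr e s)"

datatype com = Skip | Assign nat expr | Seq com com | Cond expr com com | While expr com

text \<open>\<open>exec p s n s'\<close>: the program \<open>p\<close>, started in \<open>s\<close>, terminates in \<open>s'\<close> after time \<open>n\<close>.\<close>

inductive exec :: "com \<Rightarrow> store \<Rightarrow> nat \<Rightarrow> store \<Rightarrow> bool" where
  Skip: "exec Skip s 1 s"
| Assign: "exec (Assign x e) s (1 + size (eval_expr e s)) (s(x := eval_expr e s))"
| Seq: "exec p s m s' \<Longrightarrow> exec q s' n s'' \<Longrightarrow> exec (Seq p q) s (m + n) s''"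
| CondTrue: "eval_expr e s \<noteq> Leaf \<Longrightarrow> exec p s n s' \<Longrightarrow> exec (Cond e p q) s (1 + n) s'"
| CondFalse: "eval_expr e s = Leaf \<Longrightarrow> exec q s n s' \<Longrightarrow> exec (Cond e p q) s (1 + n) s'"
| WhileFalse: "eval_expr e s = Leaf \<Longrightarrow> exec (While e p) s 1 s"
| WhileTrue: "eval_expr e s \<noteq> Leaf \<Longrightarrow> exec p s m s' \<Longrightarrow> exec (While e p) s' n s'' \<Longrightarrow>
    exec (While e p) s (1 + m + n) s''"

text \<open>Input and output are passed in variable 0; all other variables are initially \<^const>\<open>Leaf\<close>.\<close>

definition computes_in_time :: "com \<Rightarrow> data \<Rightarrow> nat \<Rightarrow> data \<Rightarrow> bool" where
  "computes_in_time p d n r \<longleftrightarrow> (\<exists>s. exec p ((\<lambda>_. Leaf)(0 := d)) n s \<and> s 0 = r)"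

fun enc_bool :: "bool \<Rightarrow> data" where
  "enc_bool False = Leaf"
| "enc_bool True = Node Leaf Leaf"

fun enc_mark :: "mark \<Rightarrow> data" where
  "enc_mark Zero = Leaf"
| "enc_mark Free = Node Leaf Leaf"

text \<open>Numbers are in binary, as lists of bits with the least significant bit first.\<close>

fun enc_nat :: "nat \<Rightarrow> data" where
  "enc_nat n = (if n = 0 then Leaf else Node (enc_bool (odd n)) (enc_nat (n div 2)))"

declare enc_nat.simps [simp del]

fun enc_option :: "nat option \<Rightarrow> data" where
  "enc_option None = Leaf"
| "enc_option (Some n) = Node Leaf (enc_nat n)"

definition enc_list :: "data list \<Rightarrow> data" where
  "enc_list ds = foldr Node ds Leaf"

text \<open>Input graphs have vertex set \<open>{..<n}\<close> for some \<open>n\<close> and are given by their adjacency matrix.\<close>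

definition input_graph :: "graph \<Rightarrow> bool" where
  "input_graph G \<longleftrightarrow> pair_graph G \<and> (\<exists>n. pverts G = {..<n})"

definition enc_vector :: "('b \<Rightarrow> data) \<Rightarrow> graph \<Rightarrow> (nat \<Rightarrow> 'b) \<Rightarrow> data" where
  "enc_vector enc G x = enc_list (map (\<lambda>v. enc (x v)) [0..<card (pverts G)])"

definition enc_graph :: "graph \<Rightarrow> data" where
  "enc_graph G = enc_vector (enc_vector enc_bool G) G (\<lambda>v w. (v, w) \<in> parcs G)"

fun enc_bounded_inst :: "bounded_inst \<Rightarrow> data" where
  "enc_bounded_inst (G, k, u) =
     Node (enc_graph G) (Node (enc_vector enc_nat G k) (enc_vector enc_nat G u))"

fun enc_marked_inst :: "marked_inst \<Rightarrow> data" where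
  "enc_marked_inst (G, k, t) =
     Node (enc_graph G) (Node (enc_vector enc_nat G k) (enc_vector enc_mark G t))"

text \<open>
  \<open>poly_time_solvable enc I P\<close>: the problem \<open>P\<close> restricted to the instances in \<open>I\<close> is solved by a
  polynomial-time algorithm; nothing is required of the algorithm on other inputs.
\<close>

definition poly_time_solvable :: "('i \<Rightarrow> data) \<Rightarrow> 'i set \<Rightarrow> ('i \<Rightarrow> nat option) \<Rightarrow> bool" where
  "poly_time_solvable enc I P \<longleftrightarrow>
     (\<exists>p. \<exists>q :: nat poly. \<forall>x\<in>I. \<exists>n \<le> poly q (size (enc x)).
        computes_in_time p (enc x) n (enc_option (P x)))"

end

theory Submission
  imports Defs
begin

text \<open>
  A graph of clique-width at most \<open>c\<close> has, for every vertex set \<open>W\<close>, a cut of rank at most \<open>c\<close>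
  over GF(2) that splits \<open>W\<close> in a balanced way: follow the construction towards the heavier
  part. Cut-rank is submodular, so such a cut splits any vertex set \<open>Z\<close> of cut-rank at most
  \<open>6 * c\<close> into two nonempty parts of cut-rank at most \<open>6 * c\<close> again, where \<open>W\<close> is a row basis
  of the cut matrix of \<open>Z\<close>. Such a split is found in polynomial time: once a row basis and
  separating columns are guessed for both parts, membership in the first part spreads from any of
  its vertices by implications between pairs of vertices, and the closure under these implications
  is again a split.

  Iterating splits gives a decomposition tree. The state of a partial solution on a cell assigns to
  each vertex the weight of its neighbours across the cut; for solutions it is constant on
  boundedly many classes of vertices, so there are polynomially many states.
\<close>

section \<open>Polynomial-time functions\<close>

text \<open>The construction that witnesses the clique-width is not part of the input, and none is
  computed. It only proves that good cuts exist; the search itself looks for vertex sets of low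
  cut-rank, a property that can be tested directly. The resulting tree may be badly unbalanced,
  which is harmless: the cost depends on the number of vertex classes at each cut, not on the depth.
  Rank is handled by counting. Vectors over GF(2) are finite sets, dimensions become cardinalities
  that are powers of 2, and each inequality of linear algebra becomes an estimate for fibres of a
  map. The bound \<open>M\<close> enters through the states. It keeps every weight at most
  \<open>M\<close> times the number of vertices, so each class has linearly many possible values,
  and boundedly many classes give polynomially many states, with an exponent depending on
  \<open>c\<close>. For the same reason all computation can use unary numbers, once the binary
  demands have been cut off above every attainable weight.\<close>

class coded = fixes encode :: "'a \<Rightarrow> data"

abbreviation sz :: "'a::coded \<Rightarrow> nat" where
  "sz x \<equiv> size (encode x)"

instantiation bool :: coded begin
definition encode_bool :: "bool \<Rightarrow> data" where "encode_bool = enc_bool"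
instance ..
end

instantiation unit :: coded begin
definition encode_unit :: "unit \<Rightarrow> data" where "encode_unit x = Leaf"
instance ..
end

text \<open>Numbers inside the algorithm are unary, so a number is its own size and polynomial
  bounds may be stated in terms of values. The binary numbers of the instances are treated as lists
  of bits.\<close>

instantiation nat :: coded begin
definition encode_nat :: "nat \<Rightarrow> data" where "encode_nat n = enc_list (replicate n Leaf)"
instance ..
end

instantiation list :: (coded) coded begin
definition encode_list :: "'a list \<Rightarrow> data" where "encode_list xs = enc_list (map encode xs)"
instance ..
end

instantiation prod :: (coded, coded) coded begin
definition encode_prod :: "'a \<times> 'b \<Rightarrow> data" where
  "encode_prod p = Node (encode (fst p)) (encode (snd p))"
instance ..
end

lemma encode_bool_simps [simp]: "encode True = Node Leaf Leaf" "encode False = Leaf"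
  by (simp_all add: encode_bool_def)

lemma encode_nat_simps [simp]: "encode (0::nat) = Leaf" "encode (Suc n) = Node Leaf (encode n)"
  by (simp_all add: encode_nat_def enc_list_def)

lemma encode_list_simps [simp]:
  "encode [] = Leaf" "encode (x # xs) = Node (encode x) (encode xs)"
  by (simp_all add: encode_list_def enc_list_def)

lemma encode_pair [simp]: "encode (a, b) = Node (encode a) (encode b)"
  by (simp add: encode_prod_def)

lemma sz_nat [simp]: "sz (n::nat) = n"
  by (induction n) auto

lemma sz_bool: "sz (b::bool) \<le> 1"
  by (cases b) auto

lemma sz_prod: "sz p = Suc (sz (fst p) + sz (snd p))"
  by (simp add: encode_prod_def)

lemma length_le_sz: "length xs \<le> sz xs"
  by (induction xs) auto

lemma sz_mem: "x \<in> set xs \<Longrightarrow> sz x \<le> sz xs"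
  by (induction xs) auto

lemma sz_append [simp]: "sz (xs @ ys) = sz xs + sz ys"
  by (induction xs) auto

lemma sz_rev [simp]: "sz (rev xs) = sz xs"
  by (induction xs) auto

lemma sz_take: "sz (take i xs) \<le> sz xs"
  by (induction xs arbitrary: i) (auto simp: take_Cons split: nat.split)

lemma sz_list_bound:
  assumes "\<And>x. x \<in> set xs \<Longrightarrow> sz x \<le> b"
  shows "sz xs \<le> length xs * (b + 1)"
  using assms
proof (induction xs)
  case (Cons a xs)
  then have "sz xs \<le> length xs * (b + 1)" "sz a \<le> b" by auto
  then show ?case by simp
qed simp

subsection \<open>Polynomially bounded functions\<close>

text \<open>The base is at least 2 even for the smallest input, so that a power of it exceeds any
  given constant and sums are absorbed into products.\<close>

definition pbounded :: "('a::coded \<Rightarrow> nat) \<Rightarrow> bool" where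
  "pbounded f \<longleftrightarrow> (\<exists>k. \<forall>x. f x \<le> (sz x + 2) ^ k)"

named_theorems pbounded_intros

lemma pbounded_mono: "pbounded g \<Longrightarrow> (\<And>x. f x \<le> g x) \<Longrightarrow> pbounded f"
  unfolding pbounded_def by (meson le_trans)

lemma pbounded_const [pbounded_intros]: "pbounded (\<lambda>x. c)"
proof -
  have "c \<le> (sz x + 2) ^ c" for x :: 'a
    using power_mono[of 2 "sz x + 2" c] less_exp[of c] by simp
  then show ?thesis unfolding pbounded_def by blast
qed

lemma pbounded_sz [pbounded_intros]: "pbounded (\<lambda>x. sz x)"
  unfolding pbounded_def by (rule exI[of _ 1]) auto

lemma pbounded_mult [pbounded_intros]: "pbounded f \<Longrightarrow> pbounded g \<Longrightarrow> pbounded (\<lambda>x. f x * g x)"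
proof -
  assume "pbounded f" "pbounded g"
  then obtain k l where k: "\<And>x. f x \<le> (sz x + 2) ^ k" and l: "\<And>x. g x \<le> (sz x + 2) ^ l"
    unfolding pbounded_def by blast
  have "f x * g x \<le> (sz x + 2) ^ (k + l)" for x
    unfolding power_add by (intro mult_le_mono k l)
  then show ?thesis unfolding pbounded_def by blast
qed

lemma pbounded_add [pbounded_intros]:
  assumes "pbounded f" "pbounded g"
  shows "pbounded (\<lambda>x. f x + g x)"
proof (rule pbounded_mono)
  show "pbounded (\<lambda>x. (f x + 1) * (g x + 1))"
  proof (rule pbounded_mult)
    have suc: "pbounded (\<lambda>x. h x + 1)" if "pbounded h" for h :: "'a \<Rightarrow> nat"
    proof -
      obtain k where k: "\<And>x. h x \<le> (sz x + 2) ^ k" using \<open>pbounded h\<close> unfolding pbounded_def by blast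
      have "h x + 1 \<le> (sz x + 2) ^ (k + 1)" for x
      proof -
        have "1 \<le> (sz x + 2) ^ k" by simp
        moreover have "(sz x + 2) ^ k * 2 \<le> (sz x + 2) ^ k * (sz x + 2)" by (intro mult_le_mono) auto
        ultimately have "h x + 1 \<le> (sz x + 2) ^ k * (sz x + 2)" using k[of x] by linarith
        then show ?thesis by (simp add: mult.commute)
      qed
      then show ?thesis unfolding pbounded_def by blast
    qed
    show "pbounded (\<lambda>x. f x + 1)" "pbounded (\<lambda>x. g x + 1)" using assms suc by auto
  qed
qed (auto simp: algebra_simps)

lemma pbounded_Suc [pbounded_intros]: "pbounded f \<Longrightarrow> pbounded (\<lambda>x. Suc (f x))"
  using pbounded_add[of f "\<lambda>_. 1", OF _ pbounded_const] by simp

lemma pbounded_power [pbounded_intros]: "pbounded f \<Longrightarrow> pbounded (\<lambda>x. f x ^ k)"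
proof (induction k)
  case 0
  then show ?case using pbounded_const[of 1] by simp
next
  case (Suc k)
  then show ?case unfolding power_Suc by (intro pbounded_mult)
qed

lemma pbounded_comp:
  assumes "pbounded f" "pbounded (\<lambda>x. sz (g x))"
  shows "pbounded (\<lambda>x. f (g x))"
proof -
  obtain k where "\<And>y. f y \<le> (sz y + 2) ^ k" using assms(1) unfolding pbounded_def by blast
  then show ?thesis
    by (intro pbounded_mono[of "\<lambda>x. (sz (g x) + 2) ^ k" "\<lambda>x. f (g x)"] pbounded_intros assms)
qed

subsection \<open>Programs\<close>

text \<open>Only upper bounds on the running time are tracked; this lets the bounds be rounded up at
  every composition.\<close>

definition runs :: "com \<Rightarrow> store \<Rightarrow> nat \<Rightarrow> store \<Rightarrow> bool" where
  "runs p s t s' \<longleftrightarrow> (\<exists>n\<le>t. exec p s n s')"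

lemma runs_assign: "v = eval_expr e s \<Longrightarrow> runs (Assign x e) s (1 + size v) (s(x := v))"
  unfolding runs_def using exec.Assign by blast

lemma runs_seq: "runs p s m s' \<Longrightarrow> runs q s' n s'' \<Longrightarrow> runs (Seq p q) s (m + n) s''"
  unfolding runs_def by (meson add_mono exec.Seq)

lemma runs_condT: "eval_expr e s \<noteq> Leaf \<Longrightarrow> runs p s n s' \<Longrightarrow> runs (Cond e p q) s (1 + n) s'"
  unfolding runs_def by (meson add_left_mono exec.CondTrue)

lemma runs_condF: "eval_expr e s = Leaf \<Longrightarrow> runs q s n s' \<Longrightarrow> runs (Cond e p q) s (1 + n) s'"
  unfolding runs_def by (meson add_left_mono exec.CondFalse)

lemma runs_whileF: "eval_expr e s = Leaf \<Longrightarrow> runs (While e p) s 1 s"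
  unfolding runs_def by (meson exec.WhileFalse order_refl)

lemma runs_whileT: "eval_expr e s \<noteq> Leaf \<Longrightarrow> runs p s m s' \<Longrightarrow> runs (While e p) s' n s'' \<Longrightarrow>
    runs (While e p) s (1 + m + n) s''"
  unfolding runs_def by (meson add_mono exec.WhileTrue order_refl)

lemma runs_mono: "runs p s m s' \<Longrightarrow> m \<le> n \<Longrightarrow> runs p s n s'"
  unfolding runs_def by (meson le_trans)

lemma exec_size_growth: "exec p s n s' \<Longrightarrow> size (s' v) \<le> size (s v) + n"
proof (induction arbitrary: v rule: exec.induct)
  case (Seq p s m s' q n s'')
  have "size (s'' v) \<le> size (s' v) + n" "size (s' v) \<le> size (s v) + m" by fact+
  then show ?case by simp
next
  case (WhileTrue e s p m s' n s'')
  have "size (s'' v) \<le> size (s' v) + n" "size (s' v) \<le> size (s v) + m" by fact+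
  then show ?case by simp
qed (auto simp: le_SucI)

lemma runs_size_growth: "runs p s n s' \<Longrightarrow> size (s' v) \<le> size (s v) + n"
  unfolding runs_def using exec_size_growth by (meson add_left_mono le_trans)

text \<open>The bound \<open>B\<close> on the registers touched by the program makes programs composable: a caller
  keeps its own data in the registers from \<open>B\<close> on.\<close>

definition ptime_prog :: "com \<Rightarrow> nat \<Rightarrow> ('a::coded \<Rightarrow> nat) \<Rightarrow> ('a \<Rightarrow> 'b::coded) \<Rightarrow> bool" where
  "ptime_prog p B T f \<longleftrightarrow> (\<forall>x s. s 0 = encode x \<longrightarrow>
     (\<exists>s'. runs p s (T x) s' \<and> s' 0 = encode (f x) \<and> (\<forall>v\<ge>B. s' v = s v)))"

definition ptime :: "('a::coded \<Rightarrow> 'b::coded) \<Rightarrow> bool" where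
  "ptime f \<longleftrightarrow> (\<exists>p B T. pbounded T \<and> ptime_prog p B T f)"

lemma ptime_progD:
  "ptime_prog p B T f \<Longrightarrow> s 0 = encode x \<Longrightarrow>
   \<exists>s'. runs p s (T x) s' \<and> s' 0 = encode (f x) \<and> (\<forall>v\<ge>B. s' v = s v)"
  unfolding ptime_prog_def by blast

lemma ptime_prog_mono: "ptime_prog p B T f \<Longrightarrow> B \<le> B' \<Longrightarrow> ptime_prog p B' T f"
  unfolding ptime_prog_def by (meson order_trans)

lemma ptime_imp_prog: "ptime f \<Longrightarrow> \<exists>p B T. pbounded T \<and> (\<forall>B'\<ge>B. ptime_prog p B' T f)"
  unfolding ptime_def by (blast intro: ptime_prog_mono)

lemma ptimeI: "pbounded T \<Longrightarrow> ptime_prog p B T f \<Longrightarrow> ptime f"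
  unfolding ptime_def by blast

named_theorems ptime_intros

text \<open>Storing a tree costs its size, so within time \<open>T x\<close> register 0 can grow by
  at most \<open>T x\<close>.\<close>

lemma pbounded_pt: "ptime f \<Longrightarrow> pbounded (\<lambda>x. sz (f x))"
proof -
  assume "ptime f"
  then obtain p B T where T: "pbounded T" and p: "ptime_prog p B T f" unfolding ptime_def by blast
  have "sz (f x) \<le> sz x + T x" for x
    using ptime_progD[OF p, of "\<lambda>_. encode x" x] by (auto dest: runs_size_growth[of _ _ _ _ 0])
  then show ?thesis by (rule pbounded_mono[rotated]) (intro pbounded_intros T)
qed

lemma ptime_expr:
  assumes "\<And>x s. s 0 = encode x \<Longrightarrow> eval_expr e s = encode (f x)" "pbounded (\<lambda>x. sz (f x))"
  shows "ptime f"
proof (rule ptimeI)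
  show "pbounded (\<lambda>x. 1 + sz (f x))" by (intro pbounded_intros assms)
  show "ptime_prog (Assign 0 e) 1 (\<lambda>x. 1 + sz (f x)) f"
    unfolding ptime_prog_def
  proof (intro allI impI)
    fix x :: 'a and s :: store assume "s 0 = encode x"
    then have "runs (Assign 0 e) s (1 + sz (f x)) (s(0 := encode (f x)))"
      by (intro runs_assign) (simp add: assms(1))
    then show "\<exists>s'. runs (Assign 0 e) s (1 + sz (f x)) s' \<and> s' 0 = encode (f x) \<and> (\<forall>v\<ge>1. s' v = s v)"
      by (intro exI[of _ "s(0 := encode (f x))"]) auto
  qed
qed

text \<open>This provides conversions between types whose codes coincide, such as a pair and a
  nonempty list, or a list of units and a number.\<close>

lemma ptime_same_code: "(\<And>x. encode (f x) = encode x) \<Longrightarrow> ptime f"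
  by (rule ptime_expr[of "Var 0"]) (auto intro: pbounded_intros)

lemma ptime_id [ptime_intros]: "ptime (\<lambda>x. x)"
  by (rule ptime_same_code) simp

lemma ptime_comp:
  assumes "ptime f" "ptime g"
  shows "ptime (\<lambda>x. f (g x))"
proof -
  obtain p B T where T: "pbounded T" and p: "\<forall>B'\<ge>B. ptime_prog p B' T f" using ptime_imp_prog[OF assms(1)] by blast
  obtain p' C T' where T': "pbounded T'" and p': "\<forall>B'\<ge>C. ptime_prog p' B' T' g"
    using ptime_imp_prog[OF assms(2)] by blast
  show ?thesis
  proof (rule ptimeI)
    show "pbounded (\<lambda>x. T' x + T (g x))" by (intro pbounded_intros T T' pbounded_comp[OF T] pbounded_pt assms)
    show "ptime_prog (Seq p' p) (max B C) (\<lambda>x. T' x + T (g x)) (\<lambda>x. f (g x))"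
      unfolding ptime_prog_def
    proof (intro allI impI)
      fix x :: 'c and s :: store assume s: "s 0 = encode x"
      obtain s1 where 1: "runs p' s (T' x) s1" "s1 0 = encode (g x)" "\<And>v. max B C \<le> v \<Longrightarrow> s1 v = s v"
        using ptime_progD[OF p'[rule_format, of "max B C"], of s x] s by auto
      obtain s2 where 2: "runs p s1 (T (g x)) s2" "s2 0 = encode (f (g x))"
        "\<And>v. max B C \<le> v \<Longrightarrow> s2 v = s1 v"
        using ptime_progD[OF p[rule_format, of "max B C"], of s1 "g x"] 1(2) by auto
      show "\<exists>s'. runs (Seq p' p) s (T' x + T (g x)) s' \<and> s' 0 = encode (f (g x)) \<and> (\<forall>v\<ge>max B C. s' v = s v)"
        using runs_seq[OF 1(1) 2(1)] 1 2 by auto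
    qed
  qed
qed

lemma ptime_Pair [ptime_intros]:
  assumes "ptime f" "ptime g"
  shows "ptime (\<lambda>x. (f x, g x))"
proof -
  obtain p B T where T: "pbounded T" and p: "\<forall>B'\<ge>B. ptime_prog p B' T f" using ptime_imp_prog[OF assms(1)] by blast
  obtain q C U where U: "pbounded U" and q: "\<forall>B'\<ge>C. ptime_prog q B' U g"
    using ptime_imp_prog[OF assms(2)] by blast
  define D where "D = Suc (max B C)"
  have p': "ptime_prog p D T f" and q': "ptime_prog q D U g" using p q unfolding D_def by auto
  have [simp]: "0 < D" "D \<noteq> 0" by (simp_all add: D_def)
  \<comment> \<open>Register \<open>D\<close> saves the input from \<open>p\<close>, and
    \<open>Suc D\<close> saves the first result from \<open>q\<close>; neither program touches
    registers from \<open>D\<close> on.\<close>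
  define r where "r = Seq (Assign D (Var 0)) (Seq p (Seq (Assign (Suc D) (Var 0))
    (Seq (Assign 0 (Var D)) (Seq q (Assign 0 (Cons_expr (Var (Suc D)) (Var 0)))))))"
  define W where "W x = (1 + sz x) + (T x + ((1 + sz (f x)) + ((1 + sz x) + (U x + (1 + sz (f x, g x))))))" for x
  show ?thesis
  proof (rule ptimeI)
    show "pbounded W" unfolding W_def by (simp, intro pbounded_intros T U pbounded_pt assms)
    show "ptime_prog r (D + 2) W (\<lambda>x. (f x, g x))"
      unfolding ptime_prog_def
    proof (intro allI impI)
      fix x :: 'a and s :: store assume s: "s 0 = encode x"
      define s1 where "s1 = s(D := encode x)"
      have s1: "s1 0 = encode x" using s by (simp add: s1_def)
      obtain s2 where 2: "runs p s1 (T x) s2" "s2 0 = encode (f x)" "\<And>v. D \<le> v \<Longrightarrow> s2 v = s1 v"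
        using ptime_progD[OF p', of s1 x] s1 by auto
      define s3 where "s3 = s2(Suc D := encode (f x))"
      define s4 where "s4 = s3(0 := encode x)"
      have s4: "s4 0 = encode x" by (simp add: s4_def)
      obtain s5 where 5: "runs q s4 (U x) s5" "s5 0 = encode (g x)" "\<And>v. D \<le> v \<Longrightarrow> s5 v = s4 v"
        using ptime_progD[OF q', of s4 x] s4 by auto
      define s6 where "s6 = s5(0 := encode (f x, g x))"
      have "runs r s (W x) s6"
        unfolding r_def W_def
        by (intro runs_seq[OF runs_assign[of "encode x" _ s D, folded s1_def]]
              runs_seq[OF 2(1)] runs_seq[OF runs_assign[of "encode (f x)" _ s2 "Suc D", folded s3_def]]
              runs_seq[OF runs_assign[of "encode x" _ s3 0, folded s4_def]] runs_seq[OF 5(1)]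
              runs_assign[of "encode (f x, g x)" _ s5 0, folded s6_def])
          (auto simp: s 2 s3_def s1_def 5 s4_def)
      moreover have "s6 0 = encode (f x, g x)" by (simp add: s6_def)
      moreover have "s6 v = s v" if "D + 2 \<le> v" for v
        using that 2 5 by (simp add: s6_def s4_def s3_def s1_def)
      ultimately show "\<exists>s'. runs r s (W x) s' \<and> s' 0 = encode (f x, g x) \<and> (\<forall>v\<ge>D + 2. s' v = s v)"
        by blast
    qed
  qed
qed

lemma ptime_fst_snd: "ptime (fst :: 'a \<times> 'b \<Rightarrow> 'a::coded)" "ptime (snd :: 'a \<times> 'b \<Rightarrow> 'b::coded)"
proof -
  have "pbounded (\<lambda>p::'a \<times> 'b. sz (fst p))" "pbounded (\<lambda>p::'a \<times> 'b. sz (snd p))"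
    by (rule pbounded_mono[OF pbounded_sz], simp add: sz_prod)+
  then show "ptime (fst :: 'a \<times> 'b \<Rightarrow> 'a)" "ptime (snd :: 'a \<times> 'b \<Rightarrow> 'b)"
    by (auto intro: ptime_expr[of "Hd_expr (Var 0)" fst] ptime_expr[of "Tl_expr (Var 0)" snd] simp: encode_prod_def)
qed

lemmas [ptime_intros] = ptime_fst_snd[THEN ptime_comp]

lemma ptime_comp2: "ptime (\<lambda>p. F (fst p) (snd p)) \<Longrightarrow> ptime f \<Longrightarrow> ptime g \<Longrightarrow> ptime (\<lambda>x. F (f x) (g x))"
  using ptime_comp[of "\<lambda>p. F (fst p) (snd p)" "\<lambda>x. (f x, g x)"] ptime_Pair[of f g] by simp

lemma ptime_comp3: "ptime (\<lambda>p. F (fst p) (fst (snd p)) (snd (snd p))) \<Longrightarrow> ptime f \<Longrightarrow> ptime g \<Longrightarrow> ptime h \<Longrightarrow>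
    ptime (\<lambda>x. F (f x) (g x) (h x))"
  using ptime_comp[of "\<lambda>p. F (fst p) (fst (snd p)) (snd (snd p))" "\<lambda>x. (f x, g x, h x)"]
    ptime_Pair[of f "\<lambda>x. (g x, h x)"] ptime_Pair[of g h] by simp

lemma ptime_comp4: "ptime (\<lambda>p. F (fst p) (fst (snd p)) (fst (snd (snd p))) (snd (snd (snd p)))) \<Longrightarrow>
    ptime f \<Longrightarrow> ptime g \<Longrightarrow> ptime h \<Longrightarrow> ptime i \<Longrightarrow> ptime (\<lambda>x. F (f x) (g x) (h x) (i x))"
  by (rule ptime_comp3[of "\<lambda>a b p. F a b (fst p) (snd p)" f g "\<lambda>x. (h x, i x)", simplified])
    (auto intro: ptime_Pair)

primrec data_expr :: "data \<Rightarrow> expr" where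
  "data_expr Leaf = Nil_expr"
| "data_expr (Node a b) = Cons_expr (data_expr a) (data_expr b)"

lemma eval_data_expr [simp]: "eval_expr (data_expr d) s = d"
  by (induction d) auto

lemma ptime_const [ptime_intros]: "ptime (\<lambda>x. c)"
  by (rule ptime_expr[of "data_expr (encode c)"]) (auto intro: pbounded_intros)

lemma ptime_Cons [ptime_intros]: "ptime f \<Longrightarrow> ptime g \<Longrightarrow> ptime (\<lambda>x. f x # g x)"
proof (rule ptime_comp2[of "(#)"])
  show "ptime (\<lambda>p. fst p # snd p :: 'b list)"
    by (rule ptime_same_code) (simp add: encode_prod_def)
qed

lemma ptime_tl [ptime_intros]: "ptime f \<Longrightarrow> ptime (\<lambda>x. tl (f x))"
proof (rule ptime_comp[of tl])
  have "sz (tl xs) \<le> sz xs" for xs :: "'b list" by (cases xs) auto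
  then have "pbounded (\<lambda>xs :: 'b list. sz (tl xs))" by (rule pbounded_mono[OF pbounded_sz])
  moreover have "right (encode xs) = encode (tl xs)" for xs :: "'b list" by (cases xs) auto
  ultimately show "ptime (tl :: 'b list \<Rightarrow> _)" by (auto intro!: ptime_expr[of "Tl_expr (Var 0)"])
qed

lemma ptime_Suc [ptime_intros]: "ptime f \<Longrightarrow> ptime (\<lambda>x. Suc (f x))"
proof (rule ptime_comp[of Suc])
  have "pbounded (\<lambda>n::nat. Suc (sz n))" by (intro pbounded_Suc pbounded_sz)
  then show "ptime Suc" by (intro ptime_expr[of "Cons_expr Nil_expr (Var 0)"]) auto
qed

lemma ptime_pred [ptime_intros]: "ptime f \<Longrightarrow> ptime (\<lambda>x. f x - 1 :: nat)"
proof (rule ptime_comp[of "\<lambda>n::nat. n - 1"])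
  have "right (encode n) = encode (n - 1)" for n :: nat by (cases n) auto
  moreover have "pbounded (\<lambda>n::nat. sz (n - 1))" by (rule pbounded_mono[OF pbounded_sz]) simp
  ultimately show "ptime (\<lambda>n::nat. n - 1)" by (auto intro!: ptime_expr[of "Tl_expr (Var 0)"])
qed

text \<open>The branch is decided by whether the code of \<open>b x\<close> is \<^const>\<open>Leaf\<close>, so lists and numbers
  can be tested for emptiness without first being converted to truth values.\<close>

lemma ptime_if_code:
  assumes "ptime b" "ptime f" "ptime g" and P: "\<And>x. P x \<longleftrightarrow> encode (b x) \<noteq> Leaf"
  shows "ptime (\<lambda>x. if P x then f x else g x)"
proof -
  obtain pr A S where S: "pbounded S" and pr0: "\<forall>B'\<ge>A. ptime_prog pr B' S b" using ptime_imp_prog[OF assms(1)] by blast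
  obtain p B T where T: "pbounded T" and p: "\<forall>B'\<ge>B. ptime_prog p B' T f" using ptime_imp_prog[OF assms(2)] by blast
  obtain q C U where U: "pbounded U" and q: "\<forall>B'\<ge>C. ptime_prog q B' U g"
    using ptime_imp_prog[OF assms(3)] by blast
  define D where "D = Suc (max A (max B C))"
  have pr: "ptime_prog pr D S b" and p': "ptime_prog p D T f" and q': "ptime_prog q D U g"
    using pr0 p q unfolding D_def by auto
  have [simp]: "0 < D" "D \<noteq> 0" by (simp_all add: D_def)
  let ?r = "Seq (Assign D (Var 0)) (Seq pr (Cond (Var 0) (Seq (Assign 0 (Var D)) p) (Seq (Assign 0 (Var D)) q)))"
  let ?W = "\<lambda>x. (1 + sz x) + (S x + (1 + ((1 + sz x) + (T x + U x))))"
  show ?thesis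
  proof (rule ptimeI)
    show "pbounded ?W" by (intro pbounded_intros S T U pbounded_pt assms)
    show "ptime_prog ?r (D + 1) ?W (\<lambda>x. if P x then f x else g x)"
      unfolding ptime_prog_def
    proof (intro allI impI)
      fix x :: 'a and s :: store assume s: "s 0 = encode x"
      define s1 where "s1 = s(D := encode x)"
      have s1: "s1 0 = encode x" using s by (simp add: s1_def)
      obtain s2 where 2: "runs pr s1 (S x) s2" "s2 0 = encode (b x)" "\<And>v. D \<le> v \<Longrightarrow> s2 v = s1 v"
        using ptime_progD[OF pr, of s1 x] s1 by auto
      define s3 where "s3 = s2(0 := encode x)"
      have a3: "runs (Assign 0 (Var D)) s2 (1 + sz x) s3"
        unfolding s3_def by (rule runs_assign) (simp add: 2 s1_def)
      have s3: "s3 0 = encode x" by (simp add: s3_def)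
      obtain s4 where 4: "runs p s3 (T x) s4" "s4 0 = encode (f x)" "\<And>v. D \<le> v \<Longrightarrow> s4 v = s3 v"
        using ptime_progD[OF p', of s3 x] s3 by auto
      obtain s5 where 5: "runs q s3 (U x) s5" "s5 0 = encode (g x)" "\<And>v. D \<le> v \<Longrightarrow> s5 v = s3 v"
        using ptime_progD[OF q', of s3 x] s3 by auto
      define s6 where "s6 = (if P x then s4 else s5)"
      have "runs (Cond (Var 0) (Seq (Assign 0 (Var D)) p) (Seq (Assign 0 (Var D)) q)) s2
              (1 + ((1 + sz x) + (T x + U x))) s6"
      proof (cases "P x")
        case True
        then show ?thesis
          by (intro runs_condT) (auto simp: 2 P[symmetric] s6_def intro!: runs_mono[OF runs_seq[OF a3 4(1)]])
      next
        case False
        then show ?thesis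
          by (intro runs_condF) (use P[of x] in \<open>auto simp: 2 s6_def intro!: runs_mono[OF runs_seq[OF a3 5(1)]]\<close>)
      qed
      then have "runs ?r s (?W x) s6"
        by (intro runs_seq[OF runs_assign[of "encode x" _ s D, folded s1_def]] runs_seq[OF 2(1)]) (simp_all add: s)
      moreover have "s6 0 = encode (if P x then f x else g x)" by (simp add: s6_def 4 5)
      moreover have "s6 v = s v" if "D + 1 \<le> v" for v
        using that 2 4 5 by (simp add: s6_def s3_def s1_def)
      ultimately show "\<exists>s'. runs ?r s (?W x) s' \<and> s' 0 = encode (if P x then f x else g x) \<and> (\<forall>v\<ge>D + 1. s' v = s v)"
        by blast
    qed
  qed
qed

lemma ptime_if [ptime_intros]: "ptime b \<Longrightarrow> ptime f \<Longrightarrow> ptime g \<Longrightarrow> ptime (\<lambda>x. if b x then f x else g x)"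
proof (rule ptime_if_code[of b])
  show "b x \<longleftrightarrow> encode (b x) \<noteq> Leaf" for x by (cases "b x") auto
qed

lemma ptime_conj [ptime_intros]: "ptime P \<Longrightarrow> ptime Q \<Longrightarrow> ptime (\<lambda>x. P x \<and> Q x)"
  using ptime_if[of P Q "\<lambda>_. False", OF _ _ ptime_const] by (rule back_subst[of ptime]) auto

lemma ptime_not [ptime_intros]: "ptime P \<Longrightarrow> ptime (\<lambda>x. \<not> P x)"
  using ptime_if[of P "\<lambda>_. False" "\<lambda>_. True", OF _ ptime_const ptime_const] by (rule back_subst[of ptime]) auto

lemma ptime_disj [ptime_intros]: "ptime P \<Longrightarrow> ptime Q \<Longrightarrow> ptime (\<lambda>x. P x \<or> Q x)"
  using ptime_if[of P "\<lambda>_. True" Q, OF _ ptime_const] by (rule back_subst[of ptime]) auto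

lemma ptime_imp [ptime_intros]: "ptime P \<Longrightarrow> ptime Q \<Longrightarrow> ptime (\<lambda>x. P x \<longrightarrow> Q x)"
  using ptime_if[of P Q "\<lambda>_. True", OF _ _ ptime_const] by (rule back_subst[of ptime]) auto

lemma ptime_iff [ptime_intros]:
  assumes "ptime P" "ptime Q"
  shows "ptime (\<lambda>x. P x \<longleftrightarrow> Q x)"
  using ptime_if[OF assms(1,2) ptime_not[OF assms(2)]] by (rule back_subst[of ptime]) auto

subsection \<open>Loops\<close>

text \<open>A polynomial-time step alone is not enough, since repeated doubling would give
  exponential growth. The size of the accumulator has to be bounded after every prefix of the
  list.\<close>

lemma ptime_fold:
  assumes step: "ptime (\<lambda>p. step (fst p) (fst (snd p)) (snd (snd p)))"
    and L: "ptime L" and init: "ptime init"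
    and bound: "pbounded bound" "\<And>e i. i \<le> length (L e) \<Longrightarrow> sz (fold (step e) (take i (L e)) (init e)) \<le> bound e"
  shows "ptime (\<lambda>e. fold (step e) (L e) (init e))"
proof -
  obtain p B T where T: "pbounded T" and
    p0: "\<forall>B'\<ge>B. ptime_prog p B' T (\<lambda>p. step (fst p) (fst (snd p)) (snd (snd p)))"
    using ptime_imp_prog[OF step] by blast
  obtain k where k: "\<And>x. T x \<le> (sz x + 2) ^ k" using T unfolding pbounded_def by blast
  obtain q C U where U: "pbounded U" and q0: "\<forall>B'\<ge>C. ptime_prog q B' U (\<lambda>e. (e, L e, init e))"
    using ptime_imp_prog[OF ptime_Pair[OF ptime_id ptime_Pair[OF L init]]] by blast
  define D where "D = Suc (max B C)"
  have p: "ptime_prog p D T (\<lambda>p. step (fst p) (fst (snd p)) (snd (snd p)))"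
    and q: "ptime_prog q D U (\<lambda>e. (e, L e, init e))"
    using p0 q0 unfolding D_def by auto
  have [simp]: "0 < D" "D \<noteq> 0" by (simp_all add: D_def)
  define body where "body = Seq (Assign 0 (Cons_expr (Var D) (Cons_expr (Hd_expr (Var (Suc D))) (Var 0))))
     (Seq p (Assign (Suc D) (Tl_expr (Var (Suc D)))))"
  let ?loop = "While (Var (Suc D)) body"
  \<comment> \<open>This bounds one pass of the loop when the environment has size \<open>m\<close>,
    the remaining list at most \<open>l\<close> and the accumulator at most \<open>b\<close>. The
    argument \<open>(e, x, a)\<close> of the step adds two nodes of its own, and the base of
    \<open>pbounded\<close> adds 2, hence the 4 under the power.\<close>
  define iter where "iter m l b = 4 + m + l + l + b + (m + l + b + 4) ^ k" for m l b :: nat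
  have loop: "\<exists>s'. runs ?loop s (1 + length xs * iter (sz e) l b) s' \<and>
        s' 0 = encode (fold (step e) xs a) \<and> (\<forall>v\<ge>D + 2. s' v = s v)"
    if "s 0 = encode a" "s D = encode e" "s (Suc D) = encode xs" "sz xs \<le> l"
      "\<And>i. i \<le> length xs \<Longrightarrow> sz (fold (step e) (take i xs) a) \<le> b" for s e xs a l b
    using that
  proof (induction xs arbitrary: s a)
    case Nil
    then show ?case using runs_whileF[of "Var (Suc D)" s body] by (intro exI[of _ s]) auto
  next
    case (Cons x xs)
    have sza: "sz a \<le> b" using Cons.prems(5)[of 0] by simp
    define s1 where "s1 = s(0 := encode (e, x, a))"
    have r1: "runs (Assign 0 (Cons_expr (Var D) (Cons_expr (Hd_expr (Var (Suc D))) (Var 0)))) s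
        (1 + sz (e, x, a)) s1"
      unfolding s1_def by (rule runs_assign) (simp add: Cons.prems)
    obtain s2 where 2: "runs p s1 (T (e, x, a)) s2" "s2 0 = encode (step e x a)" "\<And>v. D \<le> v \<Longrightarrow> s2 v = s1 v"
      using ptime_progD[OF p, of s1 "(e, x, a)"] by (auto simp: s1_def)
    define s3 where "s3 = s2(Suc D := encode xs)"
    have r3: "runs (Assign (Suc D) (Tl_expr (Var (Suc D)))) s2 (1 + sz xs) s3"
      unfolding s3_def by (rule runs_assign) (simp add: Cons.prems 2 s1_def)
    have "sz (fold (step e) (take i xs) (step e x a)) \<le> b" if "i \<le> length xs" for i
      using Cons.prems(5)[of "Suc i"] that by simp
    then obtain s4 where 4: "runs ?loop s3 (1 + length xs * iter (sz e) l b) s4"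
      "s4 0 = encode (fold (step e) xs (step e x a))" "\<forall>v\<ge>D + 2. s4 v = s3 v"
      using Cons.IH[of s3 "step e x a"] Cons.prems(2-4) by (auto simp: s3_def s1_def 2 simp del: fun_upd_apply intro: that) (auto simp: s3_def s1_def 2)
    have "T (e, x, a) \<le> (sz (e, x, a) + 2) ^ k" by (rule k)
    also have "\<dots> \<le> (sz e + l + b + 4) ^ k"
      using sza Cons.prems(4) by (intro power_mono) auto
    finally have "1 + ((1 + sz (e, x, a)) + (T (e, x, a) + (1 + sz xs))) \<le> iter (sz e) l b"
      using sza Cons.prems(4) unfolding iter_def by simp
    then have "runs ?loop s (1 + length (x # xs) * iter (sz e) l b) s4"
      by (intro runs_mono[OF runs_whileT[OF _ runs_seq[OF r1 runs_seq[OF 2(1) r3], folded body_def] 4(1)]])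
        (auto simp: Cons.prems)
    moreover have "\<forall>v\<ge>D + 2. s4 v = s v" using 4 2 by (simp add: s3_def s1_def)
    ultimately show ?case using 4(2) by (intro exI[of _ s4]) simp
  qed
  define r where "r = Seq q (Seq (Assign D (Hd_expr (Var 0))) (Seq (Assign (Suc D) (Hd_expr (Tl_expr (Var 0))))
     (Seq (Assign 0 (Tl_expr (Tl_expr (Var 0)))) ?loop)))"
  define W where "W e = U e + ((1 + sz e) + ((1 + sz (L e)) + ((1 + sz (init e)) +
     (1 + sz (L e) * iter (sz e) (sz (L e)) (bound e)))))" for e
  show ?thesis
  proof (rule ptimeI)
    show "pbounded W" unfolding W_def iter_def by (intro pbounded_intros U pbounded_pt L init bound)
    show "ptime_prog r (D + 2) W (\<lambda>e. fold (step e) (L e) (init e))"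
      unfolding ptime_prog_def
    proof (intro allI impI)
      fix e :: 'a and s :: store assume s: "s 0 = encode e"
      obtain s1 where 1: "runs q s (U e) s1" "s1 0 = encode (e, L e, init e)" "\<And>v. D \<le> v \<Longrightarrow> s1 v = s v"
        using ptime_progD[OF q, of s e] s by auto
      define s2 where "s2 = s1(D := encode e)"
      define s3 where "s3 = s2(Suc D := encode (L e))"
      define s4 where "s4 = s3(0 := encode (init e))"
      have "s4 0 = encode (init e)" "s4 D = encode e" "s4 (Suc D) = encode (L e)"
        by (simp_all add: s4_def s3_def s2_def)
      from loop[OF this order_refl bound(2)] obtain s5 where
        5: "runs ?loop s4 (1 + length (L e) * iter (sz e) (sz (L e)) (bound e)) s5"
        "s5 0 = encode (fold (step e) (L e) (init e))" "\<forall>v\<ge>D + 2. s5 v = s4 v" by blast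
      have run5: "runs ?loop s4 (1 + sz (L e) * iter (sz e) (sz (L e)) (bound e)) s5"
        by (rule runs_mono[OF 5(1)]) (simp add: length_le_sz)
      have "runs r s (W e) s5"
        unfolding r_def W_def
        by (intro runs_seq[OF 1(1)] runs_seq[OF runs_assign[of "encode e" _ s1 D, folded s2_def]]
              runs_seq[OF runs_assign[of "encode (L e)" _ s2 "Suc D", folded s3_def]]
              runs_seq[OF runs_assign[of "encode (init e)" _ s3 0, folded s4_def]] run5)
          (auto simp: 1 s2_def s3_def)
      moreover have "s5 v = s v" if "D + 2 \<le> v" for v
        using that 1 5 by (simp add: s4_def s3_def s2_def)
      ultimately show "\<exists>s'. runs r s (W e) s' \<and> s' 0 = encode (fold (step e) (L e) (init e)) \<and> (\<forall>v\<ge>D + 2. s' v = s v)"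
        using 5(2) by blast
    qed
  qed
qed

lemma ptime_rev [ptime_intros]: "ptime f \<Longrightarrow> ptime (\<lambda>x. rev (f x))"
proof (rule ptime_comp[of rev])
  have "fold (#) xs [] = rev xs" for xs :: "'b list" by (simp add: fold_Cons_rev)
  moreover have "ptime (\<lambda>xs :: 'b list. fold (#) xs [])"
    by (rule ptime_fold[OF _ _ _ pbounded_sz]) (auto simp: fold_Cons_rev sz_take intro!: ptime_intros)
  ultimately show "ptime (rev :: 'b list \<Rightarrow> _)" by simp
qed

lemma ptime_append [ptime_intros]: "ptime f \<Longrightarrow> ptime g \<Longrightarrow> ptime (\<lambda>x. f x @ g x)"
proof (rule ptime_comp2[of "(@)"])
  have b: "sz (take i (rev xs)) \<le> sz xs" for i and xs :: "'b list"
    using sz_take[of i "rev xs"] by simp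
  have "ptime (\<lambda>p :: 'b list \<times> 'b list. fold (#) (rev (fst p)) (snd p))"
    by (rule ptime_fold[OF _ _ _ pbounded_sz]) (auto simp: fold_Cons_rev sz_prod b le_SucI intro!: ptime_intros)
  then show "ptime (\<lambda>p :: 'b list \<times> 'b list. fst p @ snd p)" by (simp add: fold_Cons_rev)
qed

lemma ptime_map [ptime_intros]:
  assumes h: "ptime (\<lambda>p. h (fst p) (snd p))" and L: "ptime L"
  shows "ptime (\<lambda>e. map (h e) (L e))"
proof -
  have eq: "fold (\<lambda>x acc. f x # acc) xs acc = rev (map f xs) @ acc" for f :: "'b \<Rightarrow> 'c" and xs acc
    by (induction xs arbitrary: acc) auto
  obtain k where k: "\<And>p. sz (h (fst p) (snd p)) \<le> (sz p + 2) ^ k"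
    using pbounded_pt[OF h] unfolding pbounded_def by blast
  define bound where "bound e = sz (L e) * ((sz e + sz (L e) + 3) ^ k + 1)" for e
  have "sz (map (h e) (take i (L e))) \<le> bound e" for e i
  proof -
    have "sz y \<le> (sz e + sz (L e) + 3) ^ k" if y: "y \<in> set (map (h e) (take i (L e)))" for y
    proof -
      obtain x where x: "x \<in> set (L e)" "y = h e x" using y by (auto dest: in_set_takeD)
      have "sz y \<le> (sz (e, x) + 2) ^ k" using k[of "(e, x)"] x by simp
      also have "\<dots> \<le> (sz e + sz (L e) + 3) ^ k" using sz_mem[OF x(1)] by (intro power_mono) auto
      finally show ?thesis .
    qed
    then have "sz (map (h e) (take i (L e))) \<le>
        length (map (h e) (take i (L e))) * ((sz e + sz (L e) + 3) ^ k + 1)" by (rule sz_list_bound)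
    also have "\<dots> \<le> bound e"
      unfolding bound_def using length_le_sz[of "L e"] by (intro mult_le_mono1) simp
    finally show ?thesis .
  qed
  moreover have "pbounded bound" unfolding bound_def by (intro pbounded_intros pbounded_pt L)
  ultimately have "ptime (\<lambda>e. fold (\<lambda>x acc. h e x # acc) (L e) [])"
    by (intro ptime_fold[of "\<lambda>e x acc. h e x # acc" L "\<lambda>_. []" bound] ptime_intros L ptime_comp2[OF h]) (auto simp: eq)
  from ptime_rev[OF this] show ?thesis by (simp add: eq)
qed

lemma ptime_filter [ptime_intros]:
  assumes P: "ptime (\<lambda>p. P (fst p) (snd p))" and L: "ptime L"
  shows "ptime (\<lambda>e. filter (P e) (L e))"
proof -
  have eq: "fold (\<lambda>x acc. if Q x then x # acc else acc) xs acc = rev (filter Q xs) @ acc"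
    for Q :: "'b \<Rightarrow> bool" and xs acc
    by (induction xs arbitrary: acc) auto
  have b1: "sz (filter Q xs) \<le> sz xs" for Q :: "'b \<Rightarrow> bool" and xs by (induction xs) auto
  have b: "sz (filter (P e) (take i (L e))) \<le> sz (L e)" for e i
    using b1 sz_take le_trans by blast
  have "ptime (\<lambda>e. fold (\<lambda>x acc. if P e x then x # acc else acc) (L e) [])"
    by (intro ptime_fold[of "\<lambda>e x acc. if P e x then x # acc else acc" L "\<lambda>_. []" "\<lambda>e. sz (L e)"]
        ptime_intros L ptime_comp2[OF P] pbounded_pt) (auto simp: eq b)
  from ptime_rev[OF this] show ?thesis by (simp add: eq)
qed

lemma ptime_concat [ptime_intros]: "ptime f \<Longrightarrow> ptime (\<lambda>x. concat (f x))"
proof (rule ptime_comp[of concat])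
  have eq: "fold (\<lambda>x acc. acc @ x) xs acc = acc @ concat xs" for xs :: "'b list list" and acc
    by (induction xs arbitrary: acc) auto
  have b1: "sz (concat xs) \<le> sz xs" for xs :: "'b list list" by (induction xs) auto
  have b: "sz (concat (take i xs)) \<le> sz xs" for i and xs :: "'b list list"
    using b1 sz_take le_trans by blast
  have "ptime (\<lambda>xs :: 'b list list. fold (\<lambda>x acc. acc @ x) xs [])"
    by (rule ptime_fold[of "\<lambda>_ x acc. acc @ x" "\<lambda>xs. xs" "\<lambda>_. []" sz]; (intro ptime_intros pbounded_intros)?) (auto simp: eq b)
  then show "ptime (concat :: 'b list list \<Rightarrow> _)" by (simp add: eq)
qed

lemma ptime_Bex [ptime_intros]:
  assumes P: "ptime (\<lambda>p. P (fst p) (snd p))" and L: "ptime L"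
  shows "ptime (\<lambda>e. \<exists>x\<in>set (L e). P e x)"
proof -
  have eq: "fold (\<lambda>x b. b \<or> Q x) xs b \<longleftrightarrow> b \<or> (\<exists>x\<in>set xs. Q x)" for Q :: "'b \<Rightarrow> bool" and xs b
    by (induction xs arbitrary: b) auto
  have "ptime (\<lambda>e. fold (\<lambda>x b. b \<or> P e x) (L e) False)"
    by (intro ptime_fold[of "\<lambda>e x b. b \<or> P e x" L "\<lambda>_. False" "\<lambda>_. 1"] ptime_intros L ptime_comp2[OF P] pbounded_intros sz_bool)
  then show ?thesis by (simp add: eq)
qed

lemma ptime_Ball [ptime_intros]:
  assumes "ptime (\<lambda>p. P (fst p) (snd p))" and "ptime L"
  shows "ptime (\<lambda>e. \<forall>x\<in>set (L e). P e x)"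
  using ptime_not[OF ptime_Bex[of "\<lambda>e x. \<not> P e x", OF ptime_not, OF assms]] by simp

lemma ptime_null [ptime_intros]: "ptime f \<Longrightarrow> ptime (\<lambda>x. f x = [])"
proof (rule ptime_comp[of "\<lambda>xs. xs = []"])
  have "ptime (\<lambda>xs :: 'b list. if xs \<noteq> [] then False else True)"
  proof (rule ptime_if_code[of "\<lambda>xs. xs"])
    show "xs \<noteq> [] \<longleftrightarrow> encode xs \<noteq> Leaf" for xs :: "'b list" by (cases xs) auto
  qed (intro ptime_intros)+
  then show "ptime (\<lambda>xs :: 'b list. xs = [])" by (rule back_subst[of ptime]) auto
qed

lemma encode_replicate_unit: "encode (replicate n ()) = encode n"
  by (induction n) (auto simp: encode_unit_def)

lemma ptime_replicate_unit [ptime_intros]: "ptime f \<Longrightarrow> ptime (\<lambda>x. replicate (f x) ())"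
  by (rule ptime_comp[of "\<lambda>n. replicate n ()"], rule ptime_same_code) (simp add: encode_replicate_unit)

text \<open>Replacing every element by \<open>()\<close> leaves a list whose code is exactly the
  unary code of its length.\<close>

lemma ptime_length [ptime_intros]: "ptime f \<Longrightarrow> ptime (\<lambda>x. length (f x))"
proof (rule ptime_comp[of length])
  have "ptime (length :: unit list \<Rightarrow> nat)"
  proof (rule ptime_same_code)
    show "encode (length xs) = encode xs" for xs :: "unit list"
      using encode_replicate_unit[of "length xs"] by (simp add: replicate_length_same)
  qed
  from ptime_comp[OF this ptime_map[of "\<lambda>_ _. ()" "\<lambda>xs. xs"]] show "ptime (length :: 'b list \<Rightarrow> nat)"
    by (simp add: ptime_intros)
qed

lemma fold_replicate: "fold f (replicate n x) a = (f x ^^ n) a"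
  by (induction n arbitrary: a) (auto simp: funpow_swap1)

lemma ptime_funpow:
  fixes step :: "'a::coded \<Rightarrow> 'b::coded \<Rightarrow> 'b"
  assumes step: "ptime (\<lambda>p. step (fst p) (snd p))" and "ptime N" "ptime init"
    and "pbounded bound" "\<And>e i. i \<le> N e \<Longrightarrow> sz ((step e ^^ i) (init e)) \<le> bound e"
  shows "ptime (\<lambda>e. (step e ^^ N e) (init e))"
proof -
  have "ptime (\<lambda>e. fold (\<lambda>_. step e) (replicate (N e) ()) (init e))"
    by (rule ptime_fold[of "\<lambda>e _. step e", OF _ _ _ assms(4)]; (intro ptime_intros assms(2,3) ptime_comp2[OF step])?)
      (auto simp: fold_replicate min_def assms(5))
  then show ?thesis by (simp add: fold_replicate)
qed

lemma ptime_plus [ptime_intros]: "ptime f \<Longrightarrow> ptime g \<Longrightarrow> ptime (\<lambda>x. f x + g x :: nat)"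
proof (rule ptime_comp2[of "(+)"])
  have eq: "(Suc ^^ m) n = m + n" for m n by (induction m) auto
  have "ptime (\<lambda>p :: nat \<times> nat. (Suc ^^ fst p) (snd p))"
    by (rule ptime_funpow[of "\<lambda>_. Suc" fst snd sz]; (intro ptime_intros pbounded_intros)?) (auto simp: eq sz_prod)
  then show "ptime (\<lambda>p :: nat \<times> nat. fst p + snd p)" by (simp add: eq)
qed

lemma ptime_minus [ptime_intros]: "ptime f \<Longrightarrow> ptime g \<Longrightarrow> ptime (\<lambda>x. f x - g x :: nat)"
proof (rule ptime_comp2[of "(-)"])
  have eq: "((\<lambda>n. n - 1) ^^ m) n = n - m" for m n :: nat by (induction m) auto
  have "ptime (\<lambda>p :: nat \<times> nat. ((\<lambda>n. n - 1) ^^ snd p) (fst p))"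
    by (rule ptime_funpow[of "\<lambda>_ n. n - 1" snd fst sz]; (intro ptime_intros pbounded_intros)?) (auto simp: eq[simplified] sz_prod)
  then show "ptime (\<lambda>p :: nat \<times> nat. fst p - snd p)" by (simp only: eq)
qed

lemma ptime_mult [ptime_intros]: "ptime f \<Longrightarrow> ptime g \<Longrightarrow> ptime (\<lambda>x. f x * g x :: nat)"
proof (rule ptime_comp2[of "(*)"])
  have eq: "(((+) k) ^^ m) 0 = m * k" for m k :: nat by (induction m) auto
  have "ptime (\<lambda>p :: nat \<times> nat. (((+) (snd p)) ^^ fst p) 0)"
    by (rule ptime_funpow[of "\<lambda>p n. snd p + n" fst "\<lambda>_. 0" "\<lambda>p. sz (fst p) * sz (snd p)"];
        (intro ptime_intros pbounded_intros pbounded_pt)?) (auto simp: eq)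
  then show "ptime (\<lambda>p :: nat \<times> nat. fst p * snd p)" by (simp add: eq)
qed

lemma ptime_le [ptime_intros]: "ptime f \<Longrightarrow> ptime g \<Longrightarrow> ptime (\<lambda>x. f x \<le> (g x :: nat))"
proof (rule ptime_comp2[of "(\<le>)"])
  have "ptime (\<lambda>p :: nat \<times> nat. if \<not> fst p \<le> snd p then False else True)"
  proof (rule ptime_if_code[of "\<lambda>p. fst p - snd p"])
    have "n \<noteq> 0 \<longleftrightarrow> encode n \<noteq> Leaf" for n :: nat by (cases n) auto
    then show "\<not> fst p \<le> snd p \<longleftrightarrow> encode (fst p - snd p) \<noteq> Leaf" for p :: "nat \<times> nat"
      by (metis diff_is_0_eq)
  qed (intro ptime_intros)+
  then show "ptime (\<lambda>p :: nat \<times> nat. fst p \<le> snd p)" by (rule back_subst[of ptime]) auto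
qed

lemma ptime_less [ptime_intros]: "ptime f \<Longrightarrow> ptime g \<Longrightarrow> ptime (\<lambda>x. f x < (g x :: nat))"
  unfolding less_eq_Suc_le by (intro ptime_intros)

lemma ptime_eq_nat [ptime_intros]: "ptime f \<Longrightarrow> ptime g \<Longrightarrow> ptime (\<lambda>x. f x = (g x :: nat))"
  unfolding order_eq_iff by (intro ptime_intros)

lemma ptime_upt [ptime_intros]: "ptime f \<Longrightarrow> ptime (\<lambda>x. [0..<f x])"
proof (rule ptime_comp[of "\<lambda>n. [0..<n]"])
  have eq: "((\<lambda>acc. length acc # acc) ^^ n) [] = rev [0..<n]" for n by (induction n) auto
  have b: "sz [0..<i] \<le> n * (n + 1)" if "i \<le> n" for i n
  proof -
    have "sz [0..<i] \<le> length [0..<i] * (n + 1)" using that by (intro sz_list_bound) auto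
    also have "\<dots> \<le> n * (n + 1)" using that by (intro mult_le_mono1) auto
    finally show ?thesis .
  qed
  have "ptime (\<lambda>n. ((\<lambda>acc. length acc # acc) ^^ n) [])"
    by (rule ptime_funpow[of "\<lambda>_ acc. length acc # acc" "\<lambda>n. n" "\<lambda>_. []" "\<lambda>n. sz n * (sz n + 1)"];
        (intro ptime_intros pbounded_intros)?) (use b in \<open>auto simp: eq\<close>)
  from ptime_rev[OF this] show "ptime (\<lambda>n. [0..<n])" by (simp add: eq)
qed

lemma ptime_Ex_less [ptime_intros]:
  "ptime (\<lambda>p. P (fst p) (snd p)) \<Longrightarrow> ptime N \<Longrightarrow> ptime (\<lambda>e. \<exists>v<N e :: nat. P e v)"
  using ptime_Bex[of P "\<lambda>e. [0..<N e]"] ptime_upt[of N] by (simp add: Bex_def)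

lemma ptime_All_less [ptime_intros]:
  "ptime (\<lambda>p. P (fst p) (snd p)) \<Longrightarrow> ptime N \<Longrightarrow> ptime (\<lambda>e. \<forall>v<N e :: nat. P e v)"
  using ptime_Ball[of P "\<lambda>e. [0..<N e]"] ptime_upt[of N] by (simp add: Ball_def)

text \<open>The default value must be coded by \<^const>\<open>Leaf\<close>, the head of an empty list.\<close>

definition lookup :: "'a \<Rightarrow> 'a list \<Rightarrow> nat \<Rightarrow> 'a" where
  "lookup d xs i = (if i < length xs then xs ! i else d)"

lemma lookup_0 [simp]: "lookup d [] i = d" "lookup d (x # xs) 0 = x"
  by (simp_all add: lookup_def)

lemma lookup_0_mem: "xs \<noteq> [] \<Longrightarrow> lookup d xs 0 \<in> set xs"
  by (cases xs) simp_all

lemma ptime_lookup: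
  assumes "encode d = Leaf" "ptime f" "ptime g"
  shows "ptime (\<lambda>x. lookup d (f x) (g x))"
proof (rule ptime_comp2[OF _ assms(2,3)])
  have eq: "(tl ^^ n) xs = drop n xs" for n and xs :: "'a list" by (induction n) (auto simp: drop_Suc tl_drop)
  have b: "sz (drop i xs) \<le> sz xs" for i and xs :: "'a list"
    by (metis append_take_drop_id le_add2 sz_append)
  have "ptime (\<lambda>p :: 'a list \<times> nat. (tl ^^ snd p) (fst p))"
    by (rule ptime_funpow[of "\<lambda>_. tl" snd fst sz]; (intro ptime_intros pbounded_intros)?)
      (auto simp: eq sz_prod b le_SucI trans_le_add1)
  then have 1: "ptime (\<lambda>p :: 'a list \<times> nat. drop (snd p) (fst p))" by (simp only: eq)
  have "sz (lookup d xs 0) \<le> sz xs" for xs :: "'a list" using assms(1) by (cases xs) auto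
  then have "pbounded (\<lambda>xs. sz (lookup d xs 0))" by (rule pbounded_mono[OF pbounded_sz])
  moreover have "left (encode xs) = encode (lookup d xs 0)" for xs using assms(1) by (cases xs) auto
  ultimately have "ptime (\<lambda>xs. lookup d xs 0)" by (intro ptime_expr[of "Hd_expr (Var 0)"]) auto
  from ptime_comp[OF this 1] show "ptime (\<lambda>p. lookup d (fst p) (snd p))" by (simp add: lookup_def cong: if_cong)
qed

lemmas [ptime_intros] =
  ptime_lookup[of False, OF encode_bool_simps(2)] ptime_lookup[of "0::nat", OF encode_nat_simps(1)]
  ptime_lookup[of "[]", OF encode_list_simps(1)]

section \<open>Cut-rank\<close>

lemma card_le_fibres:
  assumes "finite S" "\<And>y. y \<in> f ` S \<Longrightarrow> card {x \<in> S. f x = y} \<le> m"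
  shows "card S \<le> card (f ` S) * m"
proof -
  have "card S = card (\<Union>y\<in>f ` S. {x \<in> S. f x = y})" by (rule arg_cong[of _ _ card]) auto
  also have "\<dots> \<le> (\<Sum>y\<in>f ` S. card {x \<in> S. f x = y})" using assms(1) by (intro card_UN_le) auto
  also have "\<dots> \<le> card (f ` S) * m" using assms(2) sum_bounded_above[of "f ` S" _ m] by simp
  finally show ?thesis .
qed

text \<open>Addition of vectors over GF(2), each represented by its support.\<close>

definition sdiff :: "'a set \<Rightarrow> 'a set \<Rightarrow> 'a set" (infixl "\<ominus>" 65) where
  "A \<ominus> B = (A - B) \<union> (B - A)"

lemma sdiff_cancel [simp]: "A \<ominus> B = A \<ominus> C \<longleftrightarrow> B = C" "B \<ominus> A = C \<ominus> A \<longleftrightarrow> B = C"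
  unfolding sdiff_def by blast+

lemma sdiff_exchange: "A \<ominus> B = C \<ominus> D \<Longrightarrow> A \<ominus> C = B \<ominus> D"
  unfolding sdiff_def by blast

lemma sdiff_subset: "A \<subseteq> X \<Longrightarrow> B \<subseteq> X \<Longrightarrow> A \<ominus> B \<subseteq> X"
  unfolding sdiff_def by blast

lemma sdiff_empty_iff [simp]: "A \<ominus> B = {} \<longleftrightarrow> A = B"
  unfolding sdiff_def by blast

text \<open>Entry \<open>w\<close> of the sum over GF(2) of the rows indexed by \<open>A\<close> of the adjacency matrix.\<close>

definition row_sum :: "('a \<Rightarrow> 'a \<Rightarrow> bool) \<Rightarrow> 'a set \<Rightarrow> 'a \<Rightarrow> bool" where
  "row_sum E A w \<longleftrightarrow> odd (card {a \<in> A. E a w})"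

text \<open>The linear dependencies among the rows \<open>X\<close> of the submatrix with columns
  \<open>C\<close>, that is, its left null space. Its cardinality stands in for the nullity.\<close>

definition row_kernel :: "('a \<Rightarrow> 'a \<Rightarrow> bool) \<Rightarrow> 'a set \<Rightarrow> 'a set \<Rightarrow> 'a set set" where
  "row_kernel E X C = {A. A \<subseteq> X \<and> (\<forall>w\<in>C. \<not> row_sum E A w)}"

definition row_space :: "('a \<Rightarrow> 'a \<Rightarrow> bool) \<Rightarrow> 'a set \<Rightarrow> 'a set \<Rightarrow> 'a set set" where
  "row_space E X C = (\<lambda>A. {w \<in> C. row_sum E A w}) ` Pow X"

lemma odd_card_sdiff:
  assumes "finite A" "finite B"
  shows "odd (card (A \<ominus> B)) \<longleftrightarrow> odd (card A) \<noteq> odd (card B)"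
proof -
  have "card (A \<ominus> B) = card (A - B) + card (B - A)"
    unfolding sdiff_def using assms by (intro card_Un_disjoint) auto
  moreover have "card A = card (A - B) + card (A \<inter> B)"
    using card_Int_Diff[OF assms(1), of B] by simp
  moreover have "card B = card (B - A) + card (A \<inter> B)"
    using card_Int_Diff[OF assms(2), of A] by (simp add: Int_commute)
  ultimately show ?thesis by auto
qed

lemma row_sum_sdiff:
  assumes "finite A" "finite B"
  shows "row_sum E (A \<ominus> B) w \<longleftrightarrow> row_sum E A w \<noteq> row_sum E B w"
proof -
  have "{a \<in> A \<ominus> B. E a w} = {a \<in> A. E a w} \<ominus> {a \<in> B. E a w}"
    by (auto simp: sdiff_def)
  then show ?thesis unfolding row_sum_def using assms by (simp add: odd_card_sdiff)
qed

lemma row_sum_empty [simp]: "\<not> row_sum E {} w"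
  by (simp add: row_sum_def)

lemma row_sum_singleton [simp]: "row_sum E {x} w \<longleftrightarrow> E x w"
proof -
  have "{a \<in> {x}. E a w} = (if E x w then {x} else {})" by auto
  then show ?thesis by (simp add: row_sum_def)
qed

lemma finite_row_kernel: "finite X \<Longrightarrow> finite (row_kernel E X C)"
  by (rule finite_subset[of _ "Pow X"]) (auto simp: row_kernel_def)

lemma empty_in_row_kernel [simp]: "{} \<in> row_kernel E X C"
  by (simp add: row_kernel_def)

lemma card_row_kernel_pos: "finite X \<Longrightarrow> 0 < card (row_kernel E X C)"
  using empty_in_row_kernel[of E X C] by (auto simp: card_gt_0_iff finite_row_kernel simp del: empty_in_row_kernel)

lemma finite_row_space: "finite X \<Longrightarrow> finite (row_space E X C)"
  by (simp add: row_space_def)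

text \<open>Submodularity of rank in terms of kernels. Map a pair \<open>(A, B)\<close> of
  dependencies to \<open>A \<ominus> B\<close>, which is supported in \<open>X \<union> Y\<close>
  and vanishes on \<open>C \<inter> D\<close>. If two pairs have the same image, their first
  components differ by the same vector as their second components; this vector is supported in
  \<open>X \<inter> Y\<close> and vanishes on both \<open>C\<close> and \<open>D\<close>, and it
  determines one pair from the other.\<close>

lemma row_kernel_submodular:
  assumes fin: "finite X" "finite Y"
  shows "card (row_kernel E X C) * card (row_kernel E Y D) \<le>
    card (row_kernel E (X \<union> Y) (C \<inter> D)) * card (row_kernel E (X \<inter> Y) (C \<union> D))"
proof -
  let ?S = "row_kernel E X C \<times> row_kernel E Y D"
  let ?f = "\<lambda>(A, B). A \<ominus> B"
  have fS: "finite ?S" using fin by (simp add: finite_row_kernel)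
  have finA: "finite A" if "A \<in> row_kernel E X' C'" "finite X'" for A X' C'
    using that finite_subset by (auto simp: row_kernel_def)
  have "card ?S \<le> card (?f ` ?S) * card (row_kernel E (X \<inter> Y) (C \<union> D))"
  proof (rule card_le_fibres[OF fS])
    fix y assume "y \<in> ?f ` ?S"
    then obtain A0 B0 where 0: "A0 \<in> row_kernel E X C" "B0 \<in> row_kernel E Y D" "y = A0 \<ominus> B0" by auto
    let ?F = "{p \<in> ?S. ?f p = y}"
    have "inj_on (\<lambda>(A, B). A \<ominus> A0) ?F"
    proof (rule inj_onI)
      fix p q assume p: "p \<in> ?F" and q: "q \<in> ?F" and eq: "(\<lambda>(A, B). A \<ominus> A0) p = (\<lambda>(A, B). A \<ominus> A0) q"
      obtain A B A' B' where pq: "p = (A, B)" "q = (A', B')" by (cases p, cases q)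
      have "A = A'" using eq pq by simp
      moreover have "A \<ominus> B = A' \<ominus> B'" using p q pq by simp
      ultimately show "p = q" using pq by simp
    qed
    moreover have "(\<lambda>(A, B). A \<ominus> A0) ` ?F \<subseteq> row_kernel E (X \<inter> Y) (C \<union> D)"
    proof
      fix z assume "z \<in> (\<lambda>(A, B). A \<ominus> A0) ` ?F"
      then obtain A B where A: "A \<in> row_kernel E X C" and B: "B \<in> row_kernel E Y D" and "A \<ominus> B = y"
        and z: "z = A \<ominus> A0" by auto
      then have eq: "A \<ominus> A0 = B \<ominus> B0" using 0 sdiff_exchange[of A B A0 B0] by simp
      have "\<not> row_sum E (A \<ominus> A0) w" if "w \<in> C" for w
        using A 0 that fin finA by (subst row_sum_sdiff) (auto simp: row_kernel_def)
      moreover have "\<not> row_sum E (A \<ominus> A0) w" if "w \<in> D" for w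
        unfolding eq using B 0 that fin finA by (subst row_sum_sdiff) (auto simp: row_kernel_def)
      moreover have "A \<ominus> A0 \<subseteq> X" using A 0 by (intro sdiff_subset) (auto simp: row_kernel_def)
      moreover have "A \<ominus> A0 \<subseteq> Y" unfolding eq using B 0 by (intro sdiff_subset) (auto simp: row_kernel_def)
      ultimately show "z \<in> row_kernel E (X \<inter> Y) (C \<union> D)"
        unfolding row_kernel_def z by blast
    qed
    ultimately show "card ?F \<le> card (row_kernel E (X \<inter> Y) (C \<union> D))"
      using fin by (intro card_inj_on_le[of "\<lambda>(A, B). A \<ominus> A0"]) (auto simp: finite_row_kernel)
  qed
  also have "card (?f ` ?S) \<le> card (row_kernel E (X \<union> Y) (C \<inter> D))"
  proof (rule card_mono)
    show "?f ` ?S \<subseteq> row_kernel E (X \<union> Y) (C \<inter> D)"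
    proof
      fix z assume "z \<in> ?f ` ?S"
      then obtain A B where A: "A \<in> row_kernel E X C" and B: "B \<in> row_kernel E Y D" and z: "z = A \<ominus> B" by auto
      have "\<not> row_sum E (A \<ominus> B) w" if "w \<in> C \<inter> D" for w
        using A B that fin finA by (subst row_sum_sdiff) (auto simp: row_kernel_def)
      then show "z \<in> row_kernel E (X \<union> Y) (C \<inter> D)" unfolding z
        using A B sdiff_subset[of A "X \<union> Y" B] unfolding row_kernel_def by blast
    qed
  qed (use fin in \<open>simp add: finite_row_kernel\<close>)
  finally show ?thesis by (simp add: card_cartesian_product)
qed

text \<open>Rank plus nullity equals the number of rows, in counted form: the fibres of the map from
  sets of rows to their sums are the cosets of the kernel.\<close>

lemma card_row_space_kernel:
  assumes fin: "finite X"
  shows "card (row_space E X C) * card (row_kernel E X C) = 2 ^ card X"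
proof (rule antisym)
  let ?f = "\<lambda>A. {w \<in> C. row_sum E A w}"
  have finA: "finite A" if "A \<subseteq> X" for A using that fin by (auto intro: finite_subset)
  have "card (Pow X) \<le> card (?f ` Pow X) * card (row_kernel E X C)"
  proof (rule card_le_fibres)
    fix y assume "y \<in> ?f ` Pow X"
    then obtain A0 where 0: "A0 \<subseteq> X" "y = ?f A0" by auto
    have "A \<ominus> A0 \<in> row_kernel E X C" if "A \<subseteq> X" "?f A = y" for A
    proof -
      have "row_sum E A w \<longleftrightarrow> row_sum E A0 w" if "w \<in> C" for w using \<open>?f A = y\<close> 0(2) that by blast
      then show ?thesis using 0(1) that finA sdiff_subset[of A X A0] by (auto simp: row_kernel_def row_sum_sdiff)
    qed
    moreover have "inj_on (\<lambda>A. A \<ominus> A0) {A \<in> Pow X. ?f A = y}" by (rule inj_onI) simp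
    ultimately show "card {A \<in> Pow X. ?f A = y} \<le> card (row_kernel E X C)"
      using fin by (intro card_inj_on_le[of "\<lambda>A. A \<ominus> A0"]) (auto simp: finite_row_kernel)
  qed (use fin in simp)
  then show "2 ^ card X \<le> card (row_space E X C) * card (row_kernel E X C)"
    using fin by (simp add: row_space_def card_Pow)
  have "\<forall>y\<in>row_space E X C. \<exists>A. A \<subseteq> X \<and> ?f A = y" unfolding row_space_def by blast
  from bchoice[OF this] obtain rep where rep: "\<And>y. y \<in> row_space E X C \<Longrightarrow> rep y \<subseteq> X \<and> ?f (rep y) = y"
    by auto
  let ?S = "row_space E X C \<times> row_kernel E X C"
  have 1: "?f (rep y \<ominus> K) = y" if "y \<in> row_space E X C" "K \<in> row_kernel E X C" for y K
  proof -
    have "finite (rep y)" "finite K" using that rep finA by (auto simp: row_kernel_def)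
    then have "?f (rep y \<ominus> K) = ?f (rep y)" using that by (auto simp: row_sum_sdiff row_kernel_def)
    then show ?thesis using rep that by simp
  qed
  have "inj_on (\<lambda>(y, K). rep y \<ominus> K) ?S"
  proof (rule inj_onI)
    fix p q assume p: "p \<in> ?S" and q: "q \<in> ?S" and eq: "(\<lambda>(y, K). rep y \<ominus> K) p = (\<lambda>(y, K). rep y \<ominus> K) q"
    obtain y K y' K' where pq: "p = (y, K)" "q = (y', K')" by (cases p, cases q)
    have eq': "rep y \<ominus> K = rep y' \<ominus> K'" using eq pq by simp
    have "?f (rep y \<ominus> K) = y" "?f (rep y' \<ominus> K') = y'" using 1 p q pq by auto
    then have "y = y'" using eq' by metis
    with eq' pq show "p = q" by simp
  qed
  moreover have "(\<lambda>(y, K). rep y \<ominus> K) ` ?S \<subseteq> Pow X"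
    using rep by (auto simp: row_kernel_def sdiff_def)
  ultimately have "card ?S \<le> card (Pow X)" using fin by (intro card_inj_on_le) auto
  then show "card (row_space E X C) * card (row_kernel E X C) \<le> 2 ^ card X"
    using fin by (simp add: card_cartesian_product card_Pow)
qed

definition rank_le :: "('a \<Rightarrow> 'a \<Rightarrow> bool) \<Rightarrow> 'a set \<Rightarrow> 'a set \<Rightarrow> nat \<Rightarrow> bool" where
  "rank_le E X C r \<longleftrightarrow> card (row_space E X C) \<le> 2 ^ r"

lemma rank_le_kernel:
  assumes "finite X"
  shows "rank_le E X C r \<longleftrightarrow> 2 ^ card X \<le> 2 ^ r * card (row_kernel E X C)"
  using card_row_space_kernel[OF assms, of E C] card_row_kernel_pos[OF assms, of E C]
  unfolding rank_le_def by (metis mult_le_cancel2)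

lemma rank_le_mono: "rank_le E X C r \<Longrightarrow> r \<le> s \<Longrightarrow> rank_le E X C s"
  unfolding rank_le_def by (meson le_trans one_le_numeral power_increasing)

text \<open>The premise \<open>j\<close> says that the cut-rank of \<open>Z \<union> U\<close> is at least \<open>j\<close>.\<close>

lemma rank_le_inter:
  assumes V: "finite V" "Z \<subseteq> V" "U \<subseteq> V"
    and j: "2 ^ j * card (row_kernel E (Z \<union> U) (V - (Z \<union> U))) \<le> 2 ^ card (Z \<union> U)"
    and Z: "rank_le E Z (V - Z) a" and U: "rank_le E U (V - U) b" and ab: "a + b \<le> j + r"
  shows "rank_le E (Z \<inter> U) (V - Z \<inter> U) r"
proof -
  let ?k = "\<lambda>X. card (row_kernel E X (V - X))"
  have fin: "finite Z" "finite U" using V by (auto intro: finite_subset)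
  have "(2::nat) ^ card (Z \<inter> U) * 2 ^ card (Z \<union> U) * 2 ^ j = 2 ^ card Z * 2 ^ card U * 2 ^ j"
    by (metis card_Un_Int[OF fin] add.commute power_add)
  also have "\<dots> \<le> (2 ^ a * ?k Z) * (2 ^ b * ?k U) * 2 ^ j"
    using Z U fin by (intro mult_le_mono) (simp_all add: rank_le_kernel)
  also have "\<dots> = 2 ^ (a + b) * (?k Z * ?k U) * 2 ^ j" by (simp add: power_add)
  also have "\<dots> \<le> 2 ^ (j + r) * (?k (Z \<union> U) * ?k (Z \<inter> U)) * 2 ^ j"
  proof (rule mult_le_mono1, rule mult_le_mono)
    show "?k Z * ?k U \<le> ?k (Z \<union> U) * ?k (Z \<inter> U)"
      using row_kernel_submodular[OF fin, of E "V - Z" "V - U"] by (simp add: Diff_Un Diff_Int)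
  qed (use ab in auto)
  also have "\<dots> = 2 ^ r * ?k (Z \<inter> U) * (2 ^ j * ?k (Z \<union> U)) * 2 ^ j" by (simp add: power_add)
  also have "\<dots> \<le> 2 ^ r * ?k (Z \<inter> U) * 2 ^ card (Z \<union> U) * 2 ^ j"
    using j by (intro mult_le_mono) auto
  finally show ?thesis using fin by (simp add: rank_le_kernel)
qed

lemma independent_rows_inj:
  assumes "finite W" "row_kernel E W C = {{}}"
  shows "inj_on (\<lambda>A. {w \<in> C. row_sum E A w}) (Pow W)"
proof (rule inj_onI)
  fix A B assume A: "A \<in> Pow W" and B: "B \<in> Pow W" and eq: "{w \<in> C. row_sum E A w} = {w \<in> C. row_sum E B w}"
  have "finite A" "finite B" using A B assms(1) by (auto intro: finite_subset)
  then have "A \<ominus> B \<in> row_kernel E W C"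
    using A B eq sdiff_subset[of A W B] by (auto simp: row_kernel_def row_sum_sdiff)
  then show "A = B" using assms(2) by simp
qed

text \<open>Take an independent set \<open>W\<close> of rows of maximum size. A row \<open>x\<close>
  outside it creates a nontrivial dependency, which must involve \<open>x\<close>; solving it for
  \<open>x\<close> expresses this row by \<open>W\<close>.\<close>

lemma row_basis:
  assumes fin: "finite X"
  obtains W where "W \<subseteq> X" "row_kernel E W C = {{}}" "card (row_space E X C) = 2 ^ card W"
    "\<And>x. x \<in> X \<Longrightarrow> \<exists>S\<subseteq>W. \<forall>w\<in>C. E x w \<longleftrightarrow> row_sum E S w"
proof -
  let ?P = "\<lambda>W. W \<subseteq> X \<and> row_kernel E W C = {{}}"
  have "?P {}" by (auto simp: row_kernel_def)
  moreover have "\<forall>W. ?P W \<longrightarrow> card W < Suc (card X)" using fin by (auto simp: less_Suc_eq_le intro: card_mono)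
  ultimately have "\<exists>W. ?P W \<and> (\<forall>W'. ?P W' \<longrightarrow> card W' \<le> card W)" by (rule ex_has_greatest_nat)
  then obtain W where W: "?P W" and max: "\<And>W'. ?P W' \<Longrightarrow> card W' \<le> card W" by blast
  have finW: "finite W" using W fin by (auto intro: finite_subset)
  have span: "\<exists>S\<subseteq>W. \<forall>w\<in>C. E x w \<longleftrightarrow> row_sum E S w" if "x \<in> X" for x
  proof (cases "x \<in> W")
    case True
    then show ?thesis by (intro exI[of _ "{x}"]) auto
  next
    case False
    then have "card (insert x W) > card W" using finW by simp
    then have "row_kernel E (insert x W) C \<noteq> {{}}" using max[of "insert x W"] W that by force
    then obtain A where A: "A \<in> row_kernel E (insert x W) C" "A \<noteq> {}"
      using empty_in_row_kernel[of E "insert x W" C] by blast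
    have "x \<in> A"
    proof (rule ccontr)
      assume "x \<notin> A"
      then have "A \<in> row_kernel E W C" using A by (auto simp: row_kernel_def)
      then show False using W A by auto
    qed
    have finA: "finite A" using A finW finite_subset[of A "insert x W"] by (auto simp: row_kernel_def)
    have "E x w \<longleftrightarrow> row_sum E (A - {x}) w" if "w \<in> C" for w
    proof -
      have "A - {x} = A \<ominus> {x}" using \<open>x \<in> A\<close> by (auto simp: sdiff_def)
      then have "row_sum E (A - {x}) w \<longleftrightarrow> row_sum E A w \<noteq> row_sum E {x} w"
        using finA row_sum_sdiff[of A "{x}"] by simp
      then show ?thesis using A that by (auto simp: row_kernel_def)
    qed
    then show ?thesis using A by (intro exI[of _ "A - {x}"]) (auto simp: row_kernel_def)
  qed
  have sub: "\<exists>S\<subseteq>W. \<forall>w\<in>C. row_sum E A w \<longleftrightarrow> row_sum E S w" if "finite A" "A \<subseteq> X" for A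
    using that
  proof (induction A)
    case empty
    then show ?case by (intro exI[of _ "{}"]) auto
  next
    case (insert x A)
    then obtain S where S: "S \<subseteq> W" "\<forall>w\<in>C. row_sum E A w \<longleftrightarrow> row_sum E S w" by auto
    obtain T where T: "T \<subseteq> W" "\<forall>w\<in>C. E x w \<longleftrightarrow> row_sum E T w" using span[of x] insert by auto
    have "finite S" "finite T" using S(1) T(1) finW by (auto intro: finite_subset)
    moreover have "insert x A = {x} \<ominus> A" using insert by (auto simp: sdiff_def)
    ultimately have "\<forall>w\<in>C. row_sum E (insert x A) w \<longleftrightarrow> row_sum E (T \<ominus> S) w"
      using S T insert.hyps row_sum_sdiff[of "{x}" A E] by (simp add: row_sum_sdiff)
    then show ?case using S T by (intro exI[of _ "T \<ominus> S"]) (simp add: sdiff_subset)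
  qed
  have "row_space E X C = row_space E W C"
  proof
    show "row_space E X C \<subseteq> row_space E W C"
    proof
      fix y assume "y \<in> row_space E X C"
      then obtain A where A: "A \<subseteq> X" "y = {w \<in> C. row_sum E A w}" by (auto simp: row_space_def)
      then obtain S where "S \<subseteq> W" "\<forall>w\<in>C. row_sum E A w \<longleftrightarrow> row_sum E S w"
        using sub[of A] fin by (auto intro: finite_subset)
      then show "y \<in> row_space E W C" using A unfolding row_space_def by (intro image_eqI[of _ _ S]) auto
    qed
    show "row_space E W C \<subseteq> row_space E X C" using W unfolding row_space_def by (intro image_mono) auto
  qed
  moreover have "card (row_space E W C) = 2 ^ card W"
    using independent_rows_inj[of W E C] W finW unfolding row_space_def by (simp add: card_image card_Pow)
  ultimately show ?thesis using W span by (intro that[of W]) simp_all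
qed

text \<open>Equivalently, adding rows does not lower the rank. A dependency is determined by its
  part outside \<open>Y\<close> up to a dependency among the rows of \<open>Y\<close>.\<close>

lemma row_kernel_restrict:
  assumes "finite X" "Y \<subseteq> X"
  shows "card (row_kernel E X C) \<le> 2 ^ card (X - Y) * card (row_kernel E Y C)"
proof -
  let ?S = "row_kernel E X C"
  have finA: "finite A" if "A \<subseteq> X" for A using that assms by (auto intro: finite_subset)
  have "card ?S \<le> card ((\<lambda>A. A - Y) ` ?S) * card (row_kernel E Y C)"
  proof (rule card_le_fibres)
    fix y assume "y \<in> (\<lambda>A. A - Y) ` ?S"
    then obtain A0 where 0: "A0 \<in> ?S" "y = A0 - Y" by auto
    have "A \<ominus> A0 \<in> row_kernel E Y C" if "A \<in> ?S" "A - Y = y" for A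
    proof -
      have "A \<ominus> A0 \<subseteq> Y" using that 0 unfolding sdiff_def by blast
      then show ?thesis using 0(1) that finA by (auto simp: row_kernel_def row_sum_sdiff)
    qed
    moreover have "inj_on (\<lambda>A. A \<ominus> A0) {A \<in> ?S. A - Y = y}" by (rule inj_onI) simp
    ultimately show "card {A \<in> ?S. A - Y = y} \<le> card (row_kernel E Y C)"
      using assms finite_subset by (intro card_inj_on_le[of "\<lambda>A. A \<ominus> A0"]) (auto intro!: finite_row_kernel)
  qed (use assms in \<open>simp add: finite_row_kernel\<close>)
  also have "card ((\<lambda>A. A - Y) ` ?S) \<le> card (Pow (X - Y))"
    using assms by (intro card_mono) (auto simp: row_kernel_def)
  finally show ?thesis using assms by (simp add: card_Pow)
qed

text \<open>The rows of \<open>W - U\<close> are independent on \<open>V - Z\<close>. Passing to the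
  columns outside \<open>Z \<union> U\<close> discards only columns in \<open>U\<close>, and on
  these the rows of \<open>V - U\<close> have rank at most \<open>c\<close>. So at most
  \<open>c\<close> of the \<open>2 * c\<close> guaranteed dimensions are lost.\<close>

lemma rank_ge_union:
  assumes V: "finite V" "Z \<subseteq> V" "U \<subseteq> V"
    and W: "W \<subseteq> Z" "row_kernel E W (V - Z) = {{}}" "2 * c \<le> card (W - U)"
    and U: "rank_le E (V - U) U c"
  shows "2 ^ c * card (row_kernel E (Z \<union> U) (V - (Z \<union> U))) \<le> 2 ^ card (Z \<union> U)"
proof -
  have fin: "finite Z" "finite U" "finite W" using V W by (auto intro: finite_subset)
  define D where "D = V - (Z \<union> U)"
  let ?K = "row_kernel E (W - U) D"
  have "card ?K \<le> card (row_space E (V - U) U)"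
  proof (rule card_inj_on_le[of "\<lambda>A. {w \<in> U. row_sum E A w}"])
    show "inj_on (\<lambda>A. {w \<in> U. row_sum E A w}) ?K"
    proof (rule inj_onI)
      fix A B assume A: "A \<in> ?K" and B: "B \<in> ?K" and eq: "{w \<in> U. row_sum E A w} = {w \<in> U. row_sum E B w}"
      have "{w \<in> V - Z. row_sum E A w} = {w \<in> V - Z. row_sum E B w}"
        using A B eq unfolding row_kernel_def D_def by blast
      then show "A = B"
        using independent_rows_inj[OF fin(3) W(2)] A B unfolding inj_on_def row_kernel_def by blast
    qed
    show "(\<lambda>A. {w \<in> U. row_sum E A w}) ` ?K \<subseteq> row_space E (V - U) U"
      using W V unfolding row_kernel_def row_space_def by blast
  qed (use V in \<open>simp add: finite_row_space\<close>)
  then have K: "card ?K \<le> 2 ^ c" using U unfolding rank_le_def by simp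
  have sub: "W - U \<subseteq> Z \<union> U" using W by auto
  have "2 ^ c * card (row_kernel E (Z \<union> U) D) \<le> 2 ^ c * (2 ^ card (Z \<union> U - (W - U)) * card ?K)"
    using fin sub by (intro mult_le_mono row_kernel_restrict) auto
  also have "\<dots> \<le> 2 ^ c * (2 ^ card (Z \<union> U - (W - U)) * 2 ^ c)" using K by simp
  also have "\<dots> = 2 ^ (2 * c + card (Z \<union> U - (W - U)))" by (simp add: power_add mult_2)
  also have "\<dots> \<le> 2 ^ card (Z \<union> U)"
  proof (rule power_increasing)
    have "card (Z \<union> U - (W - U)) = card (Z \<union> U) - card (W - U)"
      using fin sub by (intro card_Diff_subset) auto
    moreover have "card (W - U) \<le> card (Z \<union> U)" using fin sub by (intro card_mono) auto
    ultimately show "2 * c + card (Z \<union> U - (W - U)) \<le> card (Z \<union> U)" using W(3) by simp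
  qed simp
  finally show ?thesis unfolding D_def .
qed

lemma rank_le_singleton: "rank_le E {v} C 1" "rank_le E X {v} 1"
proof -
  have "card (row_space E {v} C) \<le> card (Pow {v})" unfolding row_space_def by (intro card_image_le) auto
  then show "rank_le E {v} C 1" by (simp add: rank_le_def card_Pow)
  have "card (row_space E X {v}) \<le> card (Pow {v})" unfolding row_space_def by (intro card_mono) auto
  then show "rank_le E X {v} 1" by (simp add: rank_le_def card_Pow)
qed

text \<open>If the cut-rank is exactly \<open>6 * c\<close>, a balanced \<open>U\<close> leaves at
  least \<open>2 * c\<close> basis rows on either side. Then the union of \<open>Z\<close> with
  \<open>U\<close>, or with its complement, has cut-rank at least \<open>c\<close>, and
  submodularity bounds the corresponding part of \<open>Z\<close> by \<open>6 * c + c - c\<close>.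
  If the cut-rank is smaller, there is room for one more dimension, and splitting off a single
  vertex suffices.\<close>

theorem low_rank_split:
  assumes V: "finite V" and c: "1 \<le> c"
    and balanced: "\<And>W. W \<subseteq> V \<Longrightarrow> 2 * c \<le> card W \<Longrightarrow> \<exists>U\<subseteq>V. 2 * c \<le> card (W \<inter> U) \<and> card (W \<inter> U) < 4 * c \<and>
      rank_le E U (V - U) c \<and> rank_le E (V - U) U c"
    and Z: "Z \<subseteq> V" "2 \<le> card Z" "rank_le E Z (V - Z) (6 * c)"
  shows "\<exists>X\<subseteq>Z. X \<noteq> {} \<and> X \<noteq> Z \<and> rank_le E X (V - X) (6 * c) \<and> rank_le E (Z - X) (V - (Z - X)) (6 * c)"
proof -
  have finZ: "finite Z" using V Z by (auto intro: finite_subset)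
  have diff: "Z - U = Z \<inter> (V - U)" "V - (V - U) = U" if "U \<subseteq> V" for U using that Z by auto
  obtain W where W: "W \<subseteq> Z" "row_kernel E W (V - Z) = {{}}" "card (row_space E Z (V - Z)) = 2 ^ card W"
    using row_basis[OF finZ] by metis
  have finW: "finite W" using W finZ by (auto intro: finite_subset)
  have cW: "card W \<le> 6 * c" using Z(3) W(3) unfolding rank_le_def by simp
  have rW: "rank_le E Z (V - Z) (card W)" by (simp add: rank_le_def W(3))
  show ?thesis
  proof (cases "card W = 6 * c")
    case True
    then have "2 * c \<le> card W" by simp
    then obtain U where U: "U \<subseteq> V" "2 * c \<le> card (W \<inter> U)" "card (W \<inter> U) < 4 * c"
      "rank_le E U (V - U) c" "rank_le E (V - U) U c" using balanced[of W] W Z by blast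
    have "card W = card (W \<inter> U) + card (W - U)"
      using card_Un_disjoint[of "W \<inter> U" "W - U"] finW by (simp add: Int_Diff_Un Int_Diff_disjoint)
    then have WU: "2 * c \<le> card (W - U)" using U True by simp
    have WU': "2 * c \<le> card (W - (V - U))"
    proof -
      have "W - (V - U) = W \<inter> U" using W Z U by auto
      then show ?thesis using U by simp
    qed
    have 1: "rank_le E (Z \<inter> U) (V - Z \<inter> U) (6 * c)"
      by (rule rank_le_inter[OF V Z(1) U(1) rank_ge_union[OF V Z(1) U(1) W(1,2) WU U(5)] Z(3) U(4)]) simp
    have "rank_le E (V - (V - U)) (V - U) c" using U diff by simp
    note ge = rank_ge_union[OF V Z(1) _ W(1,2) WU' this]
    have 2: "rank_le E (Z \<inter> (V - U)) (V - Z \<inter> (V - U)) (6 * c)"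
      by (rule rank_le_inter[OF V Z(1) _ ge Z(3)]) (use U diff in auto)
    have "W \<inter> U \<noteq> {}" "W - U \<noteq> {}" using U WU c by force+
    then have "Z \<inter> U \<noteq> {}" "Z \<inter> U \<noteq> Z" using W by auto
    moreover have "Z - Z \<inter> U = Z \<inter> (V - U)" using Z by auto
    ultimately show ?thesis using 1 2 by (intro exI[of _ "Z \<inter> U"]) auto
  next
    case False
    then have cW: "card W + 1 \<le> 6 * c" using cW by simp
    obtain v where v: "v \<in> Z" using Z by fastforce
    have triv: "2 ^ 0 * card (row_kernel E X C) \<le> 2 ^ card X" if "finite X" for X C
      using card_mono[of "Pow X" "row_kernel E X C"] that by (auto simp: card_Pow row_kernel_def)
    have fin: "finite (Z \<union> X)" if "X \<subseteq> V" for X using that V finZ by (auto intro: finite_subset)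
    have vV: "V - (V - {v}) = {v}" using v Z by auto
    \<comment> \<open>Submodularity with the trivial lower bound \<open>j = 0\<close>: intersecting
      with \<open>V - {v}\<close>, a set of cut-rank at most 1, raises the rank by at most
      1.\<close>
    have "rank_le E (Z \<inter> (V - {v})) (V - Z \<inter> (V - {v})) (6 * c)"
      by (rule rank_le_inter[OF V Z(1) _ triv rW]) (use rank_le_singleton(2)[of E _ v] vV cW fin in auto)
    moreover have "Z \<inter> (V - {v}) = Z - {v}" using Z by auto
    moreover have "rank_le E {v} (V - {v}) (6 * c)" using cW by (intro rank_le_mono[OF rank_le_singleton(1)]) simp
    moreover have "Z \<noteq> {v}" using Z by auto
    ultimately show ?thesis using v by (intro exI[of _ "{v}"]) auto
  qed
qed

section \<open>Separations from clique-width\<close>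

lemma cw_constructible_basic:
  assumes "cw_constructible c G lab"
  shows "finite (pverts G) \<and> (\<forall>v\<in>pverts G. lab v < c) \<and> parcs G \<subseteq> pverts G \<times> pverts G"
  using assms by induction auto

text \<open>A vertex set of an intermediate graph of the construction meets the outside only through its
  labels; descending to the heavier part until the weight drops below \<open>2 * s\<close> gives the balance.\<close>

lemma cw_constructible_balanced:
  assumes "cw_constructible c G lab" "1 \<le> s" "s \<le> card (W \<inter> pverts G)"
  shows "\<exists>U l. U \<subseteq> pverts G \<and> s \<le> card (W \<inter> U) \<and> card (W \<inter> U) < 2 * s \<and> (\<forall>u\<in>U. l u < c) \<and>
    (\<forall>x\<in>U. \<forall>y\<in>U. l x = l y \<longrightarrow> lab x = lab y \<and>
       (\<forall>w\<in>pverts G - U. (x, w) \<in> parcs G \<longleftrightarrow> (y, w) \<in> parcs G))"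
  using assms(1,3)
proof induction
  case (create i lab v)
  have "card (W \<inter> {v}) \<le> card {v}" by (intro card_mono) auto
  then show ?case using create assms(2) by (intro exI[of _ "{v}"] exI[of _ lab]) auto
next
  case (disjoint_union G lab H lab')
  note G = cw_constructible_basic[OF disjoint_union.hyps(1)] and H = cw_constructible_basic[OF disjoint_union.hyps(2)]
  have arcs: "\<And>x w. (x, w) \<in> parcs G \<Longrightarrow> x \<in> pverts G \<and> w \<in> pverts G"
    "\<And>x w. (x, w) \<in> parcs H \<Longrightarrow> x \<in> pverts H \<and> w \<in> pverts H" using G H by auto
  have disj: "\<And>x. x \<in> pverts G \<Longrightarrow> x \<notin> pverts H" using disjoint_union.hyps(3) by auto
  show ?case
  proof (cases "s \<le> card (W \<inter> pverts G)")
    case True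
    from disjoint_union.IH(1)[OF this] obtain U l where U: "U \<subseteq> pverts G" "s \<le> card (W \<inter> U)"
      "card (W \<inter> U) < 2 * s" "\<forall>u\<in>U. l u < c"
      and l: "\<And>x y. x \<in> U \<Longrightarrow> y \<in> U \<Longrightarrow> l x = l y \<Longrightarrow> lab x = lab y \<and>
         (\<forall>w\<in>pverts G - U. (x, w) \<in> parcs G \<longleftrightarrow> (y, w) \<in> parcs G)" by blast
    have no: "(x, w) \<notin> parcs H" "w \<in> pverts H \<Longrightarrow> (x, w) \<notin> parcs G" "x \<in> pverts G" if "x \<in> U" for x w
      using that U(1) by (blast dest: arcs disj)+
    show ?thesis
    proof (intro exI[of _ U] exI[of _ l] conjI ballI impI)
      fix x y assume xy: "x \<in> U" "y \<in> U" "l x = l y"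
      show "(if x \<in> pverts G then lab x else lab' x) = (if y \<in> pverts G then lab y else lab' y)"
        using l[OF xy] no(3)[OF xy(1)] no(3)[OF xy(2)] by simp
      fix w assume "w \<in> pverts \<lparr>pverts = pverts G \<union> pverts H, parcs = parcs G \<union> parcs H\<rparr> - U"
      then show "((x, w) \<in> parcs \<lparr>pverts = pverts G \<union> pverts H, parcs = parcs G \<union> parcs H\<rparr>) =
          ((y, w) \<in> parcs \<lparr>pverts = pverts G \<union> pverts H, parcs = parcs G \<union> parcs H\<rparr>)"
        using l[OF xy] no[OF xy(1)] no[OF xy(2)] by auto
    qed (use U in auto)
  next
    case G_light: False
    show ?thesis
    proof (cases "s \<le> card (W \<inter> pverts H)")
      case True
      from disjoint_union.IH(2)[OF this] obtain U l where U: "U \<subseteq> pverts H" "s \<le> card (W \<inter> U)"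
        "card (W \<inter> U) < 2 * s" "\<forall>u\<in>U. l u < c"
        and l: "\<And>x y. x \<in> U \<Longrightarrow> y \<in> U \<Longrightarrow> l x = l y \<Longrightarrow> lab' x = lab' y \<and>
           (\<forall>w\<in>pverts H - U. (x, w) \<in> parcs H \<longleftrightarrow> (y, w) \<in> parcs H)" by blast
      have no: "(x, w) \<notin> parcs G" "w \<in> pverts G \<Longrightarrow> (x, w) \<notin> parcs H" "x \<notin> pverts G" if "x \<in> U" for x w
        using that U(1) by (blast dest: arcs disj)+
      show ?thesis
      proof (intro exI[of _ U] exI[of _ l] conjI ballI impI)
        fix x y assume xy: "x \<in> U" "y \<in> U" "l x = l y"
        show "(if x \<in> pverts G then lab x else lab' x) = (if y \<in> pverts G then lab y else lab' y)"
          using l[OF xy] no(3)[OF xy(1)] no(3)[OF xy(2)] by simp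
        fix w assume "w \<in> pverts \<lparr>pverts = pverts G \<union> pverts H, parcs = parcs G \<union> parcs H\<rparr> - U"
        then show "((x, w) \<in> parcs \<lparr>pverts = pverts G \<union> pverts H, parcs = parcs G \<union> parcs H\<rparr>) =
            ((y, w) \<in> parcs \<lparr>pverts = pverts G \<union> pverts H, parcs = parcs G \<union> parcs H\<rparr>)"
          using l[OF xy] no[OF xy(1)] no[OF xy(2)] by auto
      qed (use U in auto)
    next
      case False
      \<comment> \<open>Both operands weigh less than \<open>s\<close>, hence together less than
        \<open>2 * s\<close>, so the whole union is already balanced.\<close>
      have "card (W \<inter> (pverts G \<union> pverts H)) \<le> card (W \<inter> pverts G) + card (W \<inter> pverts H)"
        unfolding Int_Un_distrib by (rule card_Un_le)
      then show ?thesis using False G_light disjoint_union.prems G H disjoint_union.hyps(3)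
        by (intro exI[of _ "pverts G \<union> pverts H"] exI[of _ "\<lambda>v. if v \<in> pverts G then lab v else lab' v"]) auto
    qed
  qed
next
  case (join G lab i j)
  then have "s \<le> card (W \<inter> pverts G)" by simp
  from join.IH[OF this] obtain U l where U: "U \<subseteq> pverts G" "s \<le> card (W \<inter> U)"
    "card (W \<inter> U) < 2 * s" "\<forall>u\<in>U. l u < c"
    and l: "\<And>x y. x \<in> U \<Longrightarrow> y \<in> U \<Longrightarrow> l x = l y \<Longrightarrow> lab x = lab y \<and>
       (\<forall>w\<in>pverts G - U. (x, w) \<in> parcs G \<longleftrightarrow> (y, w) \<in> parcs G)" by blast
  let ?G = "\<lparr>pverts = pverts G, parcs = parcs G \<union> {(v, w). v \<in> pverts G \<and> w \<in> pverts G \<and>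
      (lab v = i \<and> lab w = j \<or> lab v = j \<and> lab w = i)}\<rparr>"
  show ?case
  proof (intro exI[of _ U] exI[of _ l] conjI ballI impI)
    fix x y assume xy: "x \<in> U" "y \<in> U" "l x = l y"
    then have G: "x \<in> pverts G" "y \<in> pverts G" using U(1) by auto
    \<comment> \<open>Agreement of the current labels is carried through the induction because a
      later join sees \<open>x\<close> and \<open>y\<close> only through them, whatever labels they
      had when \<open>U\<close> was chosen.\<close>
    show "lab x = lab y" using l[OF xy] by simp
    fix w assume "w \<in> pverts ?G - U"
    then show "((x, w) \<in> parcs ?G) = ((y, w) \<in> parcs ?G)" using l[OF xy] G by simp
  qed (use U in auto)
next
  case (rename G lab i j)
  from rename.IH[OF rename.prems] obtain U l where U: "U \<subseteq> pverts G" "s \<le> card (W \<inter> U)"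
    "card (W \<inter> U) < 2 * s" "\<forall>u\<in>U. l u < c"
    and l: "\<And>x y. x \<in> U \<Longrightarrow> y \<in> U \<Longrightarrow> l x = l y \<Longrightarrow> lab x = lab y \<and>
       (\<forall>w\<in>pverts G - U. (x, w) \<in> parcs G \<longleftrightarrow> (y, w) \<in> parcs G)" by blast
  show ?case
  proof (intro exI[of _ U] exI[of _ l] conjI ballI impI)
    fix x y assume xy: "x \<in> U" "y \<in> U" "l x = l y"
    show "(if lab x = i then j else lab x) = (if lab y = i then j else lab y)" using l[OF xy] by simp
    fix w assume "w \<in> pverts G - U"
    then show "((x, w) \<in> parcs G) = ((y, w) \<in> parcs G)" using l[OF xy] by simp
  qed (use U in auto)
qed

text \<open>Two vertices of the same class have equal rows, whose sum vanishes, so a basis contains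
  at most one vertex of each class. In the other orientation the columns of a class are equal, so
  every vector of the row space is a union of classes and there are at most \<open>2 ^ c\<close> of
  them.\<close>

lemma rank_le_classes:
  assumes V: "finite V" "U \<subseteq> V" and sym: "\<And>x y. E x y \<longleftrightarrow> E y x"
    and l: "\<And>u. u \<in> U \<Longrightarrow> l u < (c::nat)"
    and eq: "\<And>x y w. x \<in> U \<Longrightarrow> y \<in> U \<Longrightarrow> l x = l y \<Longrightarrow> w \<in> V - U \<Longrightarrow> E x w \<longleftrightarrow> E y w"
  shows "rank_le E U (V - U) c" "rank_le E (V - U) U c"
proof -
  have finU: "finite U" using V by (auto intro: finite_subset)
  obtain W where W: "W \<subseteq> U" "row_kernel E W (V - U) = {{}}" "card (row_space E U (V - U)) = 2 ^ card W"
    using row_basis[OF finU] by metis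
  have "inj_on l W"
  proof (rule inj_onI, rule ccontr)
    fix x y assume xy: "x \<in> W" "y \<in> W" "l x = l y" "x \<noteq> y"
    then have "{x, y} = {x} \<ominus> {y}" by (auto simp: sdiff_def)
    then have "\<not> row_sum E {x, y} w" if "w \<in> V - U" for w
      using eq[of x y w] xy W(1) that row_sum_sdiff[of "{x}" "{y}" E w] by auto
    then have "{x, y} \<in> row_kernel E W (V - U)" using xy by (auto simp: row_kernel_def)
    then show False using W(2) by simp
  qed
  moreover have "l ` W \<subseteq> {..<c}" using W(1) l by auto
  ultimately have "card W \<le> c" using card_inj_on_le[of l W "{..<c}"] by simp
  then show "rank_le E U (V - U) c" by (simp add: rank_le_def W(3))
  have "inj_on (\<lambda>y. l ` y) (row_space E (V - U) U)"
  proof (rule inj_on_inverseI)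
    fix y assume "y \<in> row_space E (V - U) U"
    then obtain A where A: "A \<subseteq> V - U" "y = {w \<in> U. row_sum E A w}" by (auto simp: row_space_def)
    have "row_sum E A w \<longleftrightarrow> row_sum E A w'" if "w \<in> U" "w' \<in> U" "l w = l w'" for w w'
    proof -
      have "{a \<in> A. E a w} = {a \<in> A. E a w'}" using eq[OF that] A(1) sym by blast
      then show ?thesis by (simp add: row_sum_def)
    qed
    then show "{w \<in> U. l w \<in> l ` y} = y" using A(2) by auto
  qed
  moreover have "(\<lambda>y. l ` y) ` row_space E (V - U) U \<subseteq> Pow {..<c}" using l by (auto simp: row_space_def)
  ultimately have "card (row_space E (V - U) U) \<le> card (Pow {..<c})" by (intro card_inj_on_le) auto
  then show "rank_le E (V - U) U c" by (simp add: rank_le_def card_Pow)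
qed

lemma cw_constructible_edgeless:
  "Suc m \<le> c \<Longrightarrow> cw_constructible c \<lparr>pverts = {..<Suc m}, parcs = {}\<rparr> (\<lambda>v. v)"
proof (induction m)
  case 0
  have "cw_constructible c \<lparr>pverts = {0::nat}, parcs = {}\<rparr> (\<lambda>v. v)"
    using 0 by (intro cw_constructible.create) auto
  then show ?case by (simp add: lessThan_Suc)
next
  case (Suc m)
  have 1: "cw_constructible c \<lparr>pverts = {Suc m}, parcs = {}\<rparr> (\<lambda>v. v)"
    using Suc by (intro cw_constructible.create) auto
  have 2: "cw_constructible c \<lparr>pverts = {..<Suc m}, parcs = {}\<rparr> (\<lambda>v. v)"
    using Suc by simp
  have "{..<Suc m} \<union> {Suc m} = {..<Suc (Suc m)}" by auto
  then show ?case using cw_constructible.disjoint_union[OF 2 1] by simp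
qed

text \<open>This ensures that the \<open>LEAST\<close> in \<open>clique_width\<close> is attained.
  Every vertex keeps a label of its own, and each edge is produced by a separate join, which adds
  both of its arcs.\<close>

lemma cw_constructible_all:
  assumes "input_graph G" "pverts G \<noteq> {}"
  shows "\<exists>c lab. cw_constructible c G lab"
proof -
  obtain n where n: "pverts G = {..<n}" and "pair_graph G" using assms unfolding input_graph_def by auto
  then interpret pair_graph G by simp
  have add: "cw_constructible n \<lparr>pverts = {..<n}, parcs = F \<union> F\<inverse>\<rparr> (\<lambda>v. v)" if "finite F" "F \<subseteq> parcs G" for F
    using that
  proof (induction F)
    case empty
    have "0 < n" using n assms(2) by auto
    then show ?case using cw_constructible_edgeless[of "n - 1" n] by simp
  next
    case (insert e F)
    obtain i j where e: "e = (i, j)" by (cases e)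
    have ij: "i < n" "j < n" "i \<noteq> j"
      using insert.prems n arc_fst_in_verts[of e] arc_snd_in_verts[of e] pair_no_loops[of e] by (auto simp: e)
    have "cw_constructible n \<lparr>pverts = {..<n}, parcs = F \<union> F\<inverse>\<rparr> (\<lambda>v. v)" using insert by simp
    from cw_constructible.join[OF this ij]
    have "cw_constructible n \<lparr>pverts = {..<n}, parcs = (F \<union> F\<inverse>) \<union>
      {(v, w). v < n \<and> w < n \<and> (v = i \<and> w = j \<or> v = j \<and> w = i)}\<rparr> (\<lambda>v. v)" by simp
    moreover have "(F \<union> F\<inverse>) \<union> {(v, w). v < n \<and> w < n \<and> (v = i \<and> w = j \<or> v = j \<and> w = i)} =
      insert e F \<union> (insert e F)\<inverse>" using ij by (auto simp: e)
    ultimately show ?case by simp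
  qed
  have "parcs G \<union> (parcs G)\<inverse> = parcs G"
    using pair_sym_arcs by (auto simp: symmetric_def sym_def)
  with add[OF pair_finite_arcs order_refl] have "cw_constructible n G (\<lambda>v. v)" by (cases G) (simp flip: n)
  then show ?thesis by blast
qed

lemma clique_width_constructible:
  assumes "input_graph G" "pverts G \<noteq> {}" "clique_width G \<le> c"
  shows "\<exists>c'\<le>c. \<exists>lab. cw_constructible c' G lab"
proof -
  have "\<exists>lab. cw_constructible (clique_width G) G lab"
    using cw_constructible_all[OF assms(1,2)] LeastI_ex[of "\<lambda>c. \<exists>lab. cw_constructible c G lab"] assms(2)
    unfolding clique_width_def by simp
  then show ?thesis using assms(3) by blast
qed

lemma input_graph_sym:
  assumes "input_graph G"
  shows "(v, w) \<in> parcs G \<longleftrightarrow> (w, v) \<in> parcs G"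
proof -
  interpret pair_graph G using assms unfolding input_graph_def by simp
  have "sym (parcs G)" using pair_sym_arcs by (simp add: symmetric_def)
  then show ?thesis unfolding sym_def by blast
qed

lemma input_graph_verts:
  assumes "input_graph G"
  shows "pverts G = {..<card (pverts G)}"
proof -
  obtain n where "pverts G = {..<n}" using assms unfolding input_graph_def by blast
  then show ?thesis by simp
qed

theorem clique_width_low_rank_split:
  assumes G: "input_graph G" and cw: "clique_width G \<le> c" and c: "1 \<le> c"
  defines "V \<equiv> pverts G" and "E \<equiv> \<lambda>v w. (v, w) \<in> parcs G"
  assumes Z: "Z \<subseteq> V" "2 \<le> card Z" "rank_le E Z (V - Z) (6 * c)"
  shows "\<exists>X\<subseteq>Z. X \<noteq> {} \<and> X \<noteq> Z \<and> rank_le E X (V - X) (6 * c) \<and> rank_le E (Z - X) (V - (Z - X)) (6 * c)"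
proof (rule low_rank_split[OF _ c _ Z])
  show fin: "finite V" unfolding V_def by (subst input_graph_verts[OF G]) simp
  fix W assume W: "W \<subseteq> V" "2 * c \<le> card W"
  have "V \<noteq> {}" using W c by auto
  then obtain c' lab where c': "c' \<le> c" "cw_constructible c' G lab"
    using clique_width_constructible[OF G _ cw] unfolding V_def by auto
  have "2 * c \<le> card (W \<inter> pverts G)" using W unfolding V_def by (simp add: Int_absorb2)
  moreover have "1 \<le> 2 * c" using c by simp
  ultimately have "\<exists>U l. U \<subseteq> pverts G \<and> 2 * c \<le> card (W \<inter> U) \<and> card (W \<inter> U) < 2 * (2 * c) \<and> (\<forall>u\<in>U. l u < c') \<and>
    (\<forall>x\<in>U. \<forall>y\<in>U. l x = l y \<longrightarrow> lab x = lab y \<and>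
       (\<forall>w\<in>pverts G - U. (x, w) \<in> parcs G \<longleftrightarrow> (y, w) \<in> parcs G))"
    using cw_constructible_balanced[OF c'(2)] by blast
  then obtain U l where U: "U \<subseteq> pverts G" "2 * c \<le> card (W \<inter> U)" "card (W \<inter> U) < 2 * (2 * c)" "\<forall>u\<in>U. l u < c'"
    and l: "\<And>x y w. x \<in> U \<Longrightarrow> y \<in> U \<Longrightarrow> l x = l y \<Longrightarrow> w \<in> pverts G - U \<Longrightarrow>
       (x, w) \<in> parcs G \<longleftrightarrow> (y, w) \<in> parcs G" by blast
  have lc: "l u < c" if "u \<in> U" for u using U(4) c'(1) that by (meson less_le_trans)
  have UV: "U \<subseteq> V" using U(1) by (simp add: V_def)
  have "E x y \<longleftrightarrow> E y x" for x y unfolding E_def by (rule input_graph_sym[OF G])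
  from rank_le_classes[of V U E l c, OF fin UV this lc, unfolded E_def V_def, OF _ l]
  have "rank_le E U (V - U) c" "rank_le E (V - U) U c" unfolding E_def V_def by blast+
  then show "\<exists>U\<subseteq>V. 2 * c \<le> card (W \<inter> U) \<and> card (W \<inter> U) < 4 * c \<and> rank_le E U (V - U) c \<and> rank_le E (V - U) U c"
    using U unfolding V_def by (intro exI[of _ U]) auto
qed

section \<open>The algorithm\<close>

text \<open>Vertex sets and vectors over GF(2) are lists of bits; positions beyond the end count as
  \<^const>\<open>False\<close>. States and the other vectors of numbers are extended by 0 in the same way.\<close>

abbreviation mem :: "bool list \<Rightarrow> nat \<Rightarrow> bool" where
  "mem X v \<equiv> lookup False X v"

abbreviation val :: "nat list \<Rightarrow> nat \<Rightarrow> nat" where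
  "val s v \<equiv> lookup 0 s v"

abbreviation row :: "bool list list \<Rightarrow> nat \<Rightarrow> bool list" where
  "row A v \<equiv> lookup [] A v"

subsection \<open>Searching for a split of low rank\<close>

definition xor_vec :: "nat \<Rightarrow> bool list \<Rightarrow> bool list \<Rightarrow> bool list" where
  "xor_vec n a b = map (\<lambda>i. mem a i \<longleftrightarrow> \<not> mem b i) [0..<n]"

lemma ptime_xor_vec [ptime_intros]: "ptime f \<Longrightarrow> ptime g \<Longrightarrow> ptime h \<Longrightarrow> ptime (\<lambda>x. xor_vec (f x) (g x) (h x))"
  by (rule ptime_comp3) (unfold xor_vec_def, intro ptime_intros)+

text \<open>The row with index \<open>length A\<close> is the zero vector; it fills up families of fewer than \<open>r\<close> rows.\<close>

primrec spans :: "bool list list \<Rightarrow> nat \<Rightarrow> bool list list list" where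
  "spans A 0 = [[[]]]"
| "spans A (Suc r) = concat (map (\<lambda>L. map (\<lambda>v. L @ map (xor_vec (length A) (row A v)) L) [0..<Suc (length A)]) (spans A r))"

lemma ptime_spans [ptime_intros]: "ptime f \<Longrightarrow> ptime (\<lambda>x. spans (f x) r)"
proof (rule ptime_comp[of "\<lambda>A. spans A r"])
  show "ptime (\<lambda>A. spans A r)"
  proof (induction r)
    case (Suc r)
    show ?case unfolding spans.simps by (intro ptime_intros Suc)
  qed (unfold spans.simps, intro ptime_intros)
qed

primrec tuples :: "nat \<Rightarrow> nat \<Rightarrow> nat list list" where
  "tuples n 0 = [[]]"
| "tuples n (Suc q) = concat (map (\<lambda>t. map (\<lambda>v. v # t) [0..<n]) (tuples n q))"

lemma ptime_tuples [ptime_intros]: "ptime f \<Longrightarrow> ptime (\<lambda>x. tuples (f x) q)"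
proof (rule ptime_comp[of "\<lambda>n. tuples n q"])
  show "ptime (\<lambda>n. tuples n q)"
  proof (induction q)
    case (Suc q)
    show ?case unfolding tuples.simps by (intro ptime_intros Suc)
  qed (unfold tuples.simps, intro ptime_intros)
qed

text \<open>The first component lists all vectors of a guessed row space, not just a basis; the
  second lists columns meant to tell these vectors apart.\<close>

type_synonym guess = "bool list list \<times> nat list"

text \<open>The test whether \<open>x\<close> may lie in the part described by the guess while
  \<open>w\<close> lies outside it. For a correct guess, incompatibility forces \<open>w\<close>
  into the part whenever \<open>x\<close> is in it.\<close>

definition compatible :: "bool list list \<Rightarrow> guess \<Rightarrow> nat \<Rightarrow> nat \<Rightarrow> bool" where
  "compatible A g x w \<longleftrightarrow> (\<exists>m\<in>set (fst g). (\<forall>c\<in>set (snd g). mem (row A x) c \<longleftrightarrow> mem m c) \<and> (mem (row A x) w \<longleftrightarrow> mem m w))"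

lemma ptime_compatible [ptime_intros]:
  "ptime f \<Longrightarrow> ptime g \<Longrightarrow> ptime h \<Longrightarrow> ptime i \<Longrightarrow> ptime (\<lambda>x. compatible (f x) (g x) (h x) (i x))"
  by (rule ptime_comp4) (unfold compatible_def, intro ptime_intros)+

text \<open>Two kinds of implications enlarge \<open>X\<close>. A vertex \<open>z\<close> must join
  \<open>X\<close> if some \<open>x\<close> in \<open>X\<close> is incompatible with
  \<open>z\<close> outside. It must also join if it cannot stay in the other part of
  \<open>Z\<close>, being incompatible with some \<open>w\<close> already known to lie outside that
  part.\<close>

definition closure_step :: "bool list list \<Rightarrow> bool list \<Rightarrow> guess \<times> guess \<Rightarrow> bool list \<Rightarrow> bool list" where
  "closure_step A Z g X = map (\<lambda>z. mem X z \<or> mem Z z \<and>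
     ((\<exists>x<length A. mem X x \<and> \<not> compatible A (fst g) x z) \<or>
      (\<exists>w<length A. (mem X w \<or> \<not> mem Z w) \<and> \<not> compatible A (snd g) z w))) [0..<length A]"

lemma ptime_closure_step [ptime_intros]:
  "ptime f \<Longrightarrow> ptime g \<Longrightarrow> ptime h \<Longrightarrow> ptime i \<Longrightarrow> ptime (\<lambda>x. closure_step (f x) (g x) (h x) (i x))"
  by (rule ptime_comp4) (unfold closure_step_def, intro ptime_intros)+

text \<open>Every round that changes the set adds a vertex, so \<open>length A\<close> rounds reach
  the fixpoint.\<close>

definition forced :: "bool list list \<Rightarrow> bool list \<Rightarrow> guess \<times> guess \<Rightarrow> nat \<Rightarrow> bool list" where
  "forced A Z g v = (closure_step A Z g ^^ length A) (map (\<lambda>z. z = v) [0..<length A])"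

lemma sz_bool_list: "sz (xs :: bool list) \<le> 2 * length xs"
  using sz_list_bound[of xs 1, OF sz_bool] by simp

lemma ptime_forced [ptime_intros]:
  "ptime f \<Longrightarrow> ptime g \<Longrightarrow> ptime h \<Longrightarrow> ptime i \<Longrightarrow> ptime (\<lambda>x. forced (f x) (g x) (h x) (i x))"
proof (rule ptime_comp4[of forced])
  let ?A = "\<lambda>p :: bool list list \<times> bool list \<times> (guess \<times> guess) \<times> nat. fst p"
  have "ptime (\<lambda>p. (closure_step (?A p) (fst (snd p)) (fst (snd (snd p))) ^^ length (?A p))
       (map (\<lambda>z. z = snd (snd (snd p))) [0..<length (?A p)]))"
  proof (rule ptime_funpow[where bound = "\<lambda>p. 2 * sz (?A p)"])
    fix p and i :: nat
    let ?X = "(closure_step (?A p) (fst (snd p)) (fst (snd (snd p))) ^^ i) (map (\<lambda>z. z = snd (snd (snd p))) [0..<length (?A p)])"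
    have "length ?X = length (?A p)" by (cases i) (simp_all add: closure_step_def)
    then show "sz ?X \<le> 2 * sz (?A p)" using sz_bool_list[of ?X] length_le_sz[of "?A p"] by simp
  qed (intro ptime_intros pbounded_intros pbounded_pt)+
  then show "ptime (\<lambda>p. forced (?A p) (fst (snd p)) (fst (snd (snd p))) (snd (snd (snd p))))"
    unfolding forced_def .
qed

definition low_rank :: "nat \<Rightarrow> bool list list \<Rightarrow> bool list \<Rightarrow> bool" where
  "low_rank r A X \<longleftrightarrow> (\<exists>L\<in>set (spans A r). \<forall>x<length A. mem X x \<longrightarrow>
     (\<exists>m\<in>set L. \<forall>w<length A. \<not> mem X w \<longrightarrow> (mem (row A x) w \<longleftrightarrow> mem m w)))"

lemma ptime_low_rank [ptime_intros]: "ptime f \<Longrightarrow> ptime g \<Longrightarrow> ptime (\<lambda>x. low_rank r (f x) (g x))"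
  by (rule ptime_comp2) (unfold low_rank_def, intro ptime_intros)+

definition diff_vec :: "nat \<Rightarrow> bool list \<Rightarrow> bool list \<Rightarrow> bool list" where
  "diff_vec n Z X = map (\<lambda>v. mem Z v \<and> \<not> mem X v) [0..<n]"

lemma ptime_diff_vec [ptime_intros]: "ptime f \<Longrightarrow> ptime g \<Longrightarrow> ptime h \<Longrightarrow> ptime (\<lambda>x. diff_vec (f x) (g x) (h x))"
  by (rule ptime_comp3) (unfold diff_vec_def, intro ptime_intros)+

definition is_split :: "nat \<Rightarrow> bool list list \<Rightarrow> bool list \<Rightarrow> bool list \<Rightarrow> bool" where
  "is_split r A Z X \<longleftrightarrow> (\<exists>x<length A. mem X x) \<and> (\<exists>z<length A. mem Z z \<and> \<not> mem X z) \<and>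
     (\<forall>x<length A. mem X x \<longrightarrow> mem Z x) \<and> low_rank r A X \<and> low_rank r A (diff_vec (length A) Z X)"

lemma ptime_is_split [ptime_intros]: "ptime f \<Longrightarrow> ptime g \<Longrightarrow> ptime h \<Longrightarrow> ptime (\<lambda>x. is_split r (f x) (g x) (h x))"
  by (rule ptime_comp3) (unfold is_split_def, intro ptime_intros)+

text \<open>A guessed row space is a list of \<open>2 ^ r\<close> vectors; the \<open>4 ^ r\<close>
  columns allow one for each ordered pair of them. Since \<open>r\<close> is fixed, the number of
  guesses is polynomial.\<close>

definition guesses :: "nat \<Rightarrow> bool list list \<Rightarrow> guess list" where
  "guesses r A = concat (map (\<lambda>L. map (\<lambda>C. (L, C)) (tuples (length A) (4 ^ r))) (spans A r))"

lemma ptime_guesses [ptime_intros]: "ptime f \<Longrightarrow> ptime (\<lambda>x. guesses r (f x))"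
  by (rule ptime_comp) (unfold guesses_def, intro ptime_intros)+

text \<open>Wrong guesses do no harm, because every candidate is checked by
  \<open>is_split\<close>.\<close>

definition split_vec :: "nat \<Rightarrow> bool list list \<Rightarrow> bool list \<Rightarrow> bool list" where
  "split_vec r A Z = lookup [] (filter (is_split r A Z) (concat (map (\<lambda>g. concat (map (\<lambda>g'.
     map (forced A Z (g, g')) [0..<length A]) (guesses r A))) (guesses r A)))) 0"

lemma ptime_split_vec [ptime_intros]: "ptime f \<Longrightarrow> ptime g \<Longrightarrow> ptime (\<lambda>x. split_vec r (f x) (g x))"
  by (rule ptime_comp2) (unfold split_vec_def, intro ptime_intros)+

subsection \<open>Dynamic programming\<close>

text \<open>A fictitious vertex \<open>length A\<close>, adjacent to all others, makes the weight of a partial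
  solution one of the entries of its state.\<close>

definition nbr :: "bool list list \<Rightarrow> nat \<Rightarrow> nat \<Rightarrow> bool" where
  "nbr A v w \<longleftrightarrow> v = length A \<or> mem (row A v) w"

lemma ptime_nbr [ptime_intros]: "ptime f \<Longrightarrow> ptime g \<Longrightarrow> ptime h \<Longrightarrow> ptime (\<lambda>x. nbr (f x) (g x) (h x))"
  unfolding nbr_def by (intro ptime_intros)

definition twins :: "bool list list \<Rightarrow> bool list \<Rightarrow> nat \<Rightarrow> nat \<Rightarrow> bool" where
  "twins A Z p v \<longleftrightarrow> (mem Z p \<longleftrightarrow> mem Z v) \<and>
     (\<forall>w<length A. (mem Z w \<longleftrightarrow> \<not> mem Z p) \<longrightarrow> (nbr A p w \<longleftrightarrow> nbr A v w))"

lemma ptime_twins [ptime_intros]: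
  "ptime f \<Longrightarrow> ptime g \<Longrightarrow> ptime h \<Longrightarrow> ptime i \<Longrightarrow> ptime (\<lambda>x. twins (f x) (g x) (h x) (i x))"
  by (rule ptime_comp4) (unfold twins_def, intro ptime_intros)+

text \<open>Each round overwrites one class of twins by a common value, so \<open>i\<close> rounds
  produce every vector that is constant on at most \<open>i\<close> classes. Values beyond
  \<open>M * length A\<close> exceed the largest possible total weight.\<close>

primrec states :: "nat \<Rightarrow> bool list list \<Rightarrow> bool list \<Rightarrow> nat \<Rightarrow> nat list list" where
  "states M A Z 0 = [[]]"
| "states M A Z (Suc i) = concat (map (\<lambda>s. concat (map (\<lambda>p. map (\<lambda>y.
     map (\<lambda>v. if twins A Z p v then y else val s v) [0..<Suc (length A)])
       [0..<Suc (M * length A)]) [0..<Suc (length A)])) (states M A Z i))"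

lemma ptime_states [ptime_intros]: "ptime f \<Longrightarrow> ptime g \<Longrightarrow> ptime (\<lambda>x. states M (f x) (g x) i)"
proof (rule ptime_comp2[of "\<lambda>A Z. states M A Z i"])
  show "ptime (\<lambda>p. states M (fst p) (snd p) i)"
  proof (induction i)
    case (Suc i)
    show ?case unfolding states.simps by (intro ptime_intros Suc)
  qed (unfold states.simps, intro ptime_intros)
qed

type_synonym inst = "bool list list \<times> nat list \<times> nat list"

text \<open>The flag \<open>cover\<close> distinguishes domination from packing.\<close>

definition admissible :: "bool \<Rightarrow> inst \<Rightarrow> nat \<Rightarrow> nat \<Rightarrow> nat \<Rightarrow> bool" where
  "admissible cover e v x t \<longleftrightarrow> x \<le> val (snd (snd e)) v \<and>
     (if cover then val (fst (snd e)) v \<le> t else t \<le> val (fst (snd e)) v)"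

lemma ptime_admissible [ptime_intros]:
  "ptime f \<Longrightarrow> ptime g \<Longrightarrow> ptime h \<Longrightarrow> ptime i \<Longrightarrow> ptime (\<lambda>x. admissible cover (f x) (g x) (h x) (i x))"
  unfolding admissible_def by (intro ptime_intros)

text \<open>The number of rounds covers \<open>2 ^ r\<close> classes on each side of the cut and one
  for the fictitious vertex. In a cell with one vertex \<open>v\<close>, the value \<open>x\<close>
  at \<open>v\<close> fixes all entries but the one at \<open>v\<close> itself, which predicts the
  weight of the neighbours of \<open>v\<close>.\<close>

definition leaf_table :: "nat \<Rightarrow> nat \<Rightarrow> bool \<Rightarrow> inst \<Rightarrow> bool list \<Rightarrow> nat list list" where
  "leaf_table r M cover e Z = filter (\<lambda>s. \<exists>v<length (fst e). mem Z v \<and> (\<exists>x<Suc M. admissible cover e v x (x + val s v) \<and>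
     (\<forall>w<Suc (length (fst e)). \<not> w = v \<longrightarrow> val s w = (if nbr (fst e) w v then x else 0))))
     (states M (fst e) Z (2 ^ r + 2 ^ r + 1))"

lemma ptime_leaf_table [ptime_intros]: "ptime f \<Longrightarrow> ptime g \<Longrightarrow> ptime (\<lambda>x. leaf_table r M cover (f x) (g x))"
  by (rule ptime_comp2) (unfold leaf_table_def, intro ptime_intros)+

text \<open>The entry of a state at \<open>v\<close> is the weight of the neighbours of \<open>v\<close> on the other side of the cut.
  For a partition of the vertices into three cells, the entry at \<open>v\<close> for the cell of \<open>v\<close>
  is the sum of the entries for the other two cells.\<close>

definition join_table :: "nat \<Rightarrow> nat \<Rightarrow> inst \<Rightarrow> bool list \<Rightarrow> bool list \<Rightarrow> nat list list \<Rightarrow> nat list list \<Rightarrow> nat list list" where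
  "join_table r M e Z X T T' = filter (\<lambda>s. \<exists>t\<in>set T. \<exists>t'\<in>set T'. \<forall>v<Suc (length (fst e)).
     if mem X v then val t v = val t' v + val s v
     else if mem Z v then val t' v = val t v + val s v
     else val s v = val t v + val t' v)
     (states M (fst e) Z (2 ^ r + 2 ^ r + 1))"

lemma ptime_join_table [ptime_intros]:
  assumes "ptime f" "ptime g" "ptime h" "ptime i" "ptime j"
  shows "ptime (\<lambda>x. join_table r M (f x) (g x) (h x) (i x) (j x))"
proof -
  have "ptime (\<lambda>p. join_table r M (fst p) (fst (snd p)) (fst (snd (snd p))) (fst (snd (snd (snd p)))) (snd (snd (snd (snd p)))))"
    unfolding join_table_def by (intro ptime_intros)
  from ptime_comp[OF this, of "\<lambda>x. (f x, g x, h x, i x, j x)"] show ?thesis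
    by (simp add: ptime_Pair assms)
qed

definition is_single :: "nat \<Rightarrow> bool list \<Rightarrow> bool" where
  "is_single n Z \<longleftrightarrow> (\<forall>v<n. \<forall>w<n. mem Z v \<longrightarrow> mem Z w \<longrightarrow> v = w)"

lemma ptime_is_single [ptime_intros]: "ptime f \<Longrightarrow> ptime g \<Longrightarrow> ptime (\<lambda>x. is_single (f x) (g x))"
  by (rule ptime_comp2) (unfold is_single_def, intro ptime_intros)+

text \<open>The recursion is unfolded with a stack of tasks and a stack of tables. The task \<open>True # Z\<close> asks
  for the table of \<open>Z\<close>; the task \<open>False # Z\<close> asks to combine the two topmost tables.\<close>

type_synonym machine = "bool list list \<times> nat list list list"

definition machine_step :: "nat \<Rightarrow> nat \<Rightarrow> bool \<Rightarrow> inst \<Rightarrow> machine \<Rightarrow> machine" where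
  "machine_step r M cover e s =
    (if fst s = [] then s
     else if mem (lookup [] (fst s) 0) 0
     then if is_single (length (fst e)) (tl (lookup [] (fst s) 0))
       then (tl (fst s), leaf_table r M cover e (tl (lookup [] (fst s) 0)) # snd s)
       else ((True # split_vec r (fst e) (tl (lookup [] (fst s) 0))) #
             (True # diff_vec (length (fst e)) (tl (lookup [] (fst s) 0)) (split_vec r (fst e) (tl (lookup [] (fst s) 0)))) #
             (False # tl (lookup [] (fst s) 0)) # tl (fst s), snd s)
     else (tl (fst s), join_table r M e (tl (lookup [] (fst s) 0)) (split_vec r (fst e) (tl (lookup [] (fst s) 0)))
            (lookup [] (snd s) 1) (lookup [] (snd s) 0) # tl (tl (snd s))))"

lemma ptime_machine_step: "ptime (\<lambda>p. machine_step r M cover (fst p) (snd p))"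
  unfolding machine_step_def by (intro ptime_intros)

text \<open>A tree with \<open>m\<close> leaves takes \<open>m\<close> leaf steps,
  \<open>m - 1\<close> splits and \<open>m - 1\<close> joins, fewer than \<open>3 * m\<close> in
  all. Once no task remains, further steps change nothing.\<close>

definition root_table :: "nat \<Rightarrow> nat \<Rightarrow> bool \<Rightarrow> inst \<Rightarrow> nat list list" where
  "root_table r M cover e = lookup [] (snd ((machine_step r M cover e ^^ (3 * length (fst e)))
     ([True # map (\<lambda>_. True) [0..<length (fst e)]], []))) 0"

lemma sz_filter: "sz (filter P xs) \<le> sz xs"
  by (induction xs) auto

lemma split_vec_length: "length (split_vec r A Z) \<le> length A"
proof -
  let ?xs = "filter (is_split r A Z) (concat (map (\<lambda>g. concat (map (\<lambda>g'.
     map (forced A Z (g, g')) [0..<length A]) (guesses r A))) (guesses r A)))"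
  have len: "length (forced A Z g v) = length A" for g v
    unfolding forced_def by (cases "length A") (simp_all add: closure_step_def)
  show ?thesis
  proof (cases "?xs = []")
    case True
    then show ?thesis unfolding split_vec_def by simp
  next
    case False
    then have "split_vec r A Z \<in> set ?xs" unfolding split_vec_def by (rule lookup_0_mem)
    then show ?thesis using len by auto
  qed
qed

lemma ptime_root_table [ptime_intros]: "ptime f \<Longrightarrow> ptime (\<lambda>x. root_table r M cover (f x))"
proof (rule ptime_comp[of "root_table r M cover"])
  obtain k where k: "\<And>A Z. sz (states M A Z (2 ^ r + 2 ^ r + 1)) \<le> (sz (A, Z) + 2) ^ k"
  proof -
    have "ptime (\<lambda>p. states M (fst p) (snd p) (2 ^ r + 2 ^ r + 1))" by (intro ptime_intros)
    from pbounded_pt[OF this] show ?thesis unfolding pbounded_def using that by (metis fst_conv snd_conv)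
  qed
  define K where "K e = (sz (fst e) + 2 * length (fst e) + 3) ^ k" for e :: inst
  have K: "sz (states M (fst e) Z (2 ^ r + 2 ^ r + 1)) \<le> K e" if "length Z \<le> length (fst e)" for e Z
  proof -
    have "sz (states M (fst e) Z (2 ^ r + 2 ^ r + 1)) \<le> (sz (fst e, Z) + 2) ^ k" by (rule k)
    also have "\<dots> \<le> K e" unfolding K_def using that sz_bool_list[of Z] by (intro power_mono) auto
    finally show ?thesis .
  qed
  let ?init = "\<lambda>e :: inst. ([True # map (\<lambda>_. True) [0..<length (fst e)]], []) :: machine"
  \<comment> \<open>A step adds at most two tasks and one table, and every table is filtered from a
    list of states of polynomial size. The argument must cover all inputs of this type, including
    those on which no split is found.\<close>
  define inv where "inv e i s \<longleftrightarrow> length (fst s) \<le> 1 + 2 * i \<and> length (snd s) \<le> i \<and>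
     (\<forall>t\<in>set (fst s). length t \<le> length (fst e) + 1) \<and> (\<forall>T\<in>set (snd s). sz T \<le> K e)"
    for e :: inst and i :: nat and s :: machine
  have tabs: "sz (leaf_table r M cover e Z) \<le> K e" "sz (join_table r M e Z X T T') \<le> K e"
    if "length Z \<le> length (fst e)" for e Z X T T'
    unfolding leaf_table_def join_table_def by (rule order_trans[OF sz_filter K[OF that]])+
  have step: "inv e (Suc i) (machine_step r M cover e s)" if "inv e i s" for e i s
  proof (cases "fst s")
    case Nil
    then show ?thesis using that unfolding inv_def machine_step_def by simp
  next
    case (Cons t ts)
    have t: "length (tl t) \<le> length (fst e)" using that Cons unfolding inv_def by auto
    have "set (tl (tl (snd s))) \<subseteq> set (snd s)" by (cases "snd s"; cases "tl (snd s)") auto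
    then show ?thesis
      using that Cons t tabs[OF t] split_vec_length[of r "fst e" "tl t"] unfolding inv_def machine_step_def
      by (auto simp: diff_vec_def)
  qed
  have inv: "inv e i ((machine_step r M cover e ^^ i) (?init e))" for e i
  proof (induction i)
    case 0
    show ?case by (simp add: inv_def)
  next
    case (Suc i)
    from step[OF this] show ?case by simp
  qed
  define bound where "bound e = 1 + (1 + 2 * (3 * sz (fst e))) * (2 * (sz (fst e) + 1) + 1) + 3 * sz (fst e) * (K e + 1)" for e :: inst
  have "ptime (\<lambda>e. (machine_step r M cover e ^^ (3 * length (fst e))) (?init e))"
  proof (rule ptime_funpow[OF ptime_machine_step, of _ _ bound])
    show "pbounded bound" unfolding bound_def K_def
      by (intro pbounded_intros pbounded_pt ptime_intros pbounded_mono[of "\<lambda>e :: inst. sz (fst e)" "\<lambda>e. length (fst e)"] length_le_sz)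
    fix e :: inst and i assume i: "i \<le> 3 * length (fst e)"
    let ?s = "(machine_step r M cover e ^^ i) (?init e)"
    have len: "length (fst e) \<le> sz (fst e)" by (rule length_le_sz)
    have "sz (fst ?s) \<le> length (fst ?s) * (2 * (length (fst e) + 1) + 1)"
    proof (rule sz_list_bound)
      fix t assume "t \<in> set (fst ?s)"
      then have "length t \<le> length (fst e) + 1" using inv[of e i] unfolding inv_def by blast
      then show "sz t \<le> 2 * (length (fst e) + 1)" using sz_bool_list[of t] by simp
    qed
    also have "\<dots> \<le> (1 + 2 * (3 * sz (fst e))) * (2 * (sz (fst e) + 1) + 1)"
      using inv[of e i] i len unfolding inv_def by (intro mult_le_mono) auto
    finally have 1: "sz (fst ?s) \<le> (1 + 2 * (3 * sz (fst e))) * (2 * (sz (fst e) + 1) + 1)" .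
    have "sz (snd ?s) \<le> length (snd ?s) * (K e + 1)"
      using inv[of e i] unfolding inv_def by (intro sz_list_bound) blast
    also have "\<dots> \<le> 3 * sz (fst e) * (K e + 1)"
      using inv[of e i] i len unfolding inv_def by (intro mult_le_mono) auto
    finally show "sz ?s \<le> bound e" using 1 unfolding bound_def by (simp add: sz_prod)
  qed (intro ptime_intros)+
  from ptime_lookup[OF _ ptime_fst_snd(2)[THEN ptime_comp, OF this] ptime_const[of 0], of "[]"]
  show "ptime (root_table r M cover)" unfolding root_table_def by simp
qed

subsection \<open>Input and output\<close>

fun bits :: "nat \<Rightarrow> bool list" where
  "bits n = (if n = 0 then [] else odd n # bits (n div 2))"

declare bits.simps [simp del]

lemma encode_bits: "encode (bits n) = enc_nat n"
proof (induction n rule: bits.induct)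
  case (1 n)
  then show ?case by (subst bits.simps, subst enc_nat.simps) (simp add: encode_bool_def)
qed

text \<open>Halving is a search because numbers are in unary.\<close>

definition half :: "nat \<Rightarrow> nat" where
  "half n = val (filter (\<lambda>m. n = m + m \<or> n = Suc (m + m)) [0..<Suc n]) 0"

lemma ptime_half [ptime_intros]: "ptime f \<Longrightarrow> ptime (\<lambda>x. half (f x))"
  by (rule ptime_comp) (unfold half_def, intro ptime_intros)+

lemma half_div [simp]: "half n = n div 2"
proof -
  have eq: "filter (\<lambda>m. m = k) [0..<N] = (if k < N then [k] else [])" for k N :: nat
    by (induction N) auto
  have "filter (\<lambda>m. n = m + m \<or> n = Suc (m + m)) [0..<Suc n] = filter (\<lambda>m. m = n div 2) [0..<Suc n]"
    by (rule filter_cong) auto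
  also have "\<dots> = [n div 2]" unfolding eq by auto
  finally show ?thesis by (simp add: half_def)
qed

lemma length_bits_le: "length (bits n) \<le> n"
proof (induction n rule: bits.induct)
  case (1 n)
  show ?case
  proof (cases "n = 0")
    case False
    then have "length (bits (n div 2)) \<le> n div 2" "n div 2 < n" using 1 by auto
    then show ?thesis using False bits.simps[of n] by simp
  qed (simp add: bits.simps)
qed

lemma ptime_bits [ptime_intros]: "ptime f \<Longrightarrow> ptime (\<lambda>x. bits (f x))"
proof (rule ptime_comp[of bits])
  define step :: "nat \<times> bool list \<Rightarrow> nat \<times> bool list" where
    "step p = (if fst p = 0 then p else (half (fst p), snd p @ [\<exists>m<fst p. fst p = Suc (m + m)]))" for p
  have odd: "odd n \<longleftrightarrow> (\<exists>m<n. n = Suc (m + m))" for n :: nat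
    by (metis dvd_triv_left even_Suc less_add_Suc1 mult_2 oddE plus_1_eq_Suc add.commute)
  have inv: "fst ((step ^^ i) (n, [])) \<le> n - i \<and> snd ((step ^^ i) (n, [])) @ bits (fst ((step ^^ i) (n, []))) = bits n"
    for i n
  proof (induction i)
    case (Suc i)
    obtain m bs where s: "(step ^^ i) (n, []) = (m, bs)" by (cases "(step ^^ i) (n, [])")
    have m: "m \<le> n - i" "bs @ bits m = bits n" using Suc s by auto
    have step_eq: "(step ^^ Suc i) (n, []) = step (m, bs)" using s by simp
    show ?case
    proof (cases "m = 0")
      case True
      then show ?thesis unfolding step_eq using m by (simp add: step_def)
    next
      case False
      have "m div 2 \<le> n - Suc i" using False m(1) by linarith
      moreover have "step (m, bs) = (m div 2, bs @ [odd m])" using False by (simp add: odd step_def)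
      moreover have "bits m = odd m # bits (m div 2)" using False by (simp add: bits.simps[of m])
      ultimately show ?thesis unfolding step_eq using m(2) by simp
    qed
  qed simp
  have "ptime (\<lambda>n. (step ^^ n) (n, []))"
  proof (rule ptime_funpow[of "\<lambda>_. step" "\<lambda>n. n" "\<lambda>n. (n, [])" "\<lambda>n. 1 + sz n + 2 * sz n"])
    show "ptime (\<lambda>p :: nat \<times> nat \<times> bool list. step (snd p))" unfolding step_def by (intro ptime_intros)
    fix n i :: nat
    have "length (snd ((step ^^ i) (n, []))) \<le> length (bits n)"
      using inv[where i = i and n = n] by (metis le_add1 length_append)
    then have "sz (snd ((step ^^ i) (n, []))) \<le> 2 * n"
      using sz_bool_list[of "snd ((step ^^ i) (n, []))"] length_bits_le[of n] by linarith
    moreover have "fst ((step ^^ i) (n, [])) \<le> n - i" using inv by blast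
    ultimately show "sz ((step ^^ i) (n, [])) \<le> 1 + sz n + 2 * sz n"
      unfolding sz_prod[of "(step ^^ i) (n, [])"] by simp
  qed (intro ptime_intros pbounded_intros)+
  then have "ptime (\<lambda>n. snd ((step ^^ n) (n, [])))" by (intro ptime_fst_snd(2)[THEN ptime_comp])
  moreover have "snd ((step ^^ n) (n, [])) = bits n" for n
    using inv[where i = n and n = n] by (auto simp: bits.simps[of 0])
  ultimately show "ptime bits" by simp
qed

text \<open>The value of a list of bits can be exponential in its length; cutting off at
  \<open>cap\<close> after each doubling keeps the accumulator small and still yields the exact
  minimum of \<open>cap\<close> and the value.\<close>

definition unary :: "nat \<Rightarrow> bool list \<Rightarrow> nat" where
  "unary cap bs = fold (\<lambda>b a. if cap \<le> a + a + (if b then 1 else 0) then cap else a + a + (if b then 1 else 0)) (rev bs) 0"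

lemma ptime_unary [ptime_intros]: "ptime f \<Longrightarrow> ptime g \<Longrightarrow> ptime (\<lambda>x. unary (f x) (g x))"
proof (rule ptime_comp2[of unary])
  let ?step = "\<lambda>cap b (a::nat). if cap \<le> a + a + (if b then 1 else 0) then cap else a + a + (if b then 1 else 0)"
  have b: "fold (?step cap) bs a \<le> cap" if "a \<le> cap" for cap bs a
    using that by (induction bs arbitrary: a) auto
  have "ptime (\<lambda>p :: nat \<times> bool list. fold (?step (fst p)) (rev (snd p)) 0)"
    by (rule ptime_fold[where bound = "\<lambda>p. sz (fst p)"]; (intro ptime_intros pbounded_pt)?) (use b in simp)
  then show "ptime (\<lambda>p. unary (fst p) (snd p))" unfolding unary_def .
qed

lemma unary_bits: "unary cap (bits n) = min cap n"
proof (induction n rule: bits.induct)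
  case (1 n)
  show ?case
  proof (cases "n = 0")
    case True
    then show ?thesis by (simp add: unary_def bits.simps)
  next
    case False
    have "unary cap (bits n) = (if cap \<le> unary cap (bits (n div 2)) + unary cap (bits (n div 2)) + (if odd n then 1 else 0)
        then cap else unary cap (bits (n div 2)) + unary cap (bits (n div 2)) + (if odd n then 1 else 0))"
      using False by (subst bits.simps) (simp add: unary_def)
    moreover have "n = n div 2 + n div 2 + (if odd n then 1 else 0)" by presburger
    ultimately show ?thesis using 1 False by (auto simp: min_def)
  qed
qed

text \<open>If all values are at most \<open>M\<close>, a closed neighbourhood weighs at most
  \<open>M + M * length (fst d)\<close>. Lowering a larger demand to the next number above this
  changes no comparison, neither for domination nor for packing. Bounds that are at most
  \<open>M\<close> survive the cut at \<open>Suc M\<close>.\<close>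

definition preprocess :: "nat \<Rightarrow> bool list list \<times> bool list list \<times> bool list list \<Rightarrow> inst" where
  "preprocess M d = (fst d, map (unary (Suc (M + M * length (fst d)))) (fst (snd d)), map (unary (Suc M)) (snd (snd d)))"

lemma ptime_preprocess [ptime_intros]: "ptime f \<Longrightarrow> ptime (\<lambda>x. preprocess M (f x))"
  by (rule ptime_comp) (unfold preprocess_def, intro ptime_intros)+

text \<open>At the root there is nothing across the cut, so all ordinary entries must be 0, and the
  entry of the fictitious vertex is the total weight. Filtering an increasing range makes the result
  sorted.\<close>

definition weights :: "nat \<Rightarrow> nat \<Rightarrow> bool \<Rightarrow> inst \<Rightarrow> nat list" where
  "weights r M cover e = filter (\<lambda>x. \<exists>s\<in>set (root_table r M cover e). (\<forall>v<length (fst e). val s v = 0) \<and> val s (length (fst e)) = x)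
     [0..<Suc (M * length (fst e))]"

lemma ptime_weights [ptime_intros]: "ptime f \<Longrightarrow> ptime (\<lambda>x. weights r M cover (f x))"
  by (rule ptime_comp) (unfold weights_def, intro ptime_intros)+

text \<open>The list \<open>[]\<close> has the code of \<open>None\<close>, and
  \<open>False # bits m\<close> that of \<open>Some m\<close>. The empty graph has a solution of
  weight 0 but no vertex for a leaf table, so it is answered separately.\<close>

definition algorithm :: "nat \<Rightarrow> nat \<Rightarrow> bool \<Rightarrow> bool list list \<times> bool list list \<times> bool list list \<Rightarrow> bool list" where
  "algorithm r M cover d =
    (if fst d = [] then [False]
     else if weights r M cover (preprocess M d) = [] then []
     else False # bits (if cover then val (weights r M cover (preprocess M d)) 0
                        else val (rev (weights r M cover (preprocess M d))) 0))"

lemma ptime_algorithm: "ptime (algorithm r M cover)"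
  unfolding algorithm_def[abs_def] by (intro ptime_intros)

section \<open>Correctness\<close>

lemma set_tuples: "set (tuples m q) = {xs. length xs = q \<and> set xs \<subseteq> {..<m}}"
proof (induction q)
  case (Suc q)
  show ?case
  proof (intro set_eqI iffI)
    fix xs assume "xs \<in> {xs. length xs = Suc q \<and> set xs \<subseteq> {..<m}}"
    then show "xs \<in> set (tuples m (Suc q))" using Suc by (cases xs) auto
  qed (use Suc in auto)
qed auto

lemma inflationary_fixpoint:
  assumes V: "finite V" "card V \<le> k" and step: "\<And>X. X \<subseteq> V \<Longrightarrow> X \<subseteq> step X \<and> step X \<subseteq> V" and S: "S \<subseteq> V"
  shows "step ((step ^^ k) S) = (step ^^ k) S"
proof -
  have sub: "(step ^^ i) S \<subseteq> V" for i by (induction i) (use S step in auto)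
  have "i \<le> card ((step ^^ i) S) \<or> step ((step ^^ i) S) = (step ^^ i) S" for i
  proof (induction i)
    case (Suc i)
    show ?case
    proof (cases "step ((step ^^ i) S) = (step ^^ i) S")
      case False
      then have "(step ^^ i) S \<subset> step ((step ^^ i) S)" using step[OF sub[of i]] by blast
      moreover have "finite (step ((step ^^ i) S))" using V(1) step[OF sub[of i]] finite_subset by blast
      ultimately have "card ((step ^^ i) S) < card (step ((step ^^ i) S))" by (intro psubset_card_mono)
      then show ?thesis using Suc False by simp
    qed simp
  qed simp
  then consider "k \<le> card ((step ^^ k) S)" | "step ((step ^^ k) S) = (step ^^ k) S" by blast
  then show ?thesis
  proof cases
    case 1
    then have "(step ^^ k) S = V" using V sub[of k] card_seteq[of V "(step ^^ k) S"] by simp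
    then show ?thesis using step[OF order_refl] sub[of "Suc k"] by auto
  qed
qed

locale adj_matrix =
  fixes A :: "bool list list" and E :: "nat \<Rightarrow> nat \<Rightarrow> bool"
  assumes mem_row [simp]: "mem (row A v) w \<longleftrightarrow> E v w"
    and E_less: "E v w \<Longrightarrow> v < length A \<and> w < length A"
    and E_sym: "E v w \<longleftrightarrow> E w v"
    and E_irrefl [simp]: "\<not> E v v"
begin

abbreviation n :: nat where "n \<equiv> length A"

abbreviation V :: "nat set" where "V \<equiv> {..<n}"

definition vs :: "bool list \<Rightarrow> nat set" where
  "vs X = {v. v < n \<and> mem X v}"

lemma vs_subset: "vs X \<subseteq> V"
  by (auto simp: vs_def)

lemma finite_vs [simp]: "finite (vs X)"
  by (simp add: vs_def)

lemma mem_vs: "v < n \<Longrightarrow> mem X v \<longleftrightarrow> v \<in> vs X"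
  by (simp add: vs_def)

lemma mem_map: "mem (map P [0..<n]) v \<longleftrightarrow> v < n \<and> P v"
  by (simp add: lookup_def)

lemma vs_xor_vec: "vs (xor_vec n a b) = vs a \<ominus> vs b"
  by (auto simp: vs_def xor_vec_def mem_map sdiff_def)

lemma vs_row: "vs (row A v) = {w. E v w}"
  using E_less by (auto simp: vs_def)

lemma vs_diff_vec: "vs (diff_vec n Z X) = vs Z - vs X"
  by (auto simp: vs_def diff_vec_def mem_map)

section \<open>Guessed row spaces, the rank test and the correctness of the split search\<close>

lemma spans_sound:
  "L \<in> set (spans A r) \<Longrightarrow> length L = 2 ^ r \<and> {} \<in> vs ` set L \<and>
     (\<forall>a\<in>vs ` set L. \<forall>b\<in>vs ` set L. a \<ominus> b \<in> vs ` set L)"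
proof (induction r arbitrary: L)
  case 0
  then show ?case by (simp add: vs_def sdiff_def)
next
  case (Suc r)
  then obtain L' v where L': "L' \<in> set (spans A r)" and L: "L = L' @ map (xor_vec n (row A v)) L'" by auto
  note IH = Suc.IH[OF L']
  define N where "N = vs (row A v)"
  define S where "S = vs ` set L'"
  have vsL: "vs ` set L = S \<union> (\<lambda>a. N \<ominus> a) ` S"
    unfolding L S_def N_def by (auto simp: image_Un image_image vs_xor_vec)
  have cl: "a \<ominus> b \<in> S" if "a \<in> S" "b \<in> S" for a b using IH that unfolding S_def by blast
  have "a \<ominus> b \<in> S \<union> (\<lambda>a. N \<ominus> a) ` S" if ab: "a \<in> S \<union> (\<lambda>a. N \<ominus> a) ` S" "b \<in> S \<union> (\<lambda>a. N \<ominus> a) ` S" for a b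
  proof -
    obtain a' where a': "a' \<in> S" "a = a' \<or> a = N \<ominus> a'" using ab(1) by auto
    obtain b' where b': "b' \<in> S" "b = b' \<or> b = N \<ominus> b'" using ab(2) by auto
    have "a \<ominus> b = a' \<ominus> b' \<or> a \<ominus> b = N \<ominus> (a' \<ominus> b')"
      using a'(2) b'(2) unfolding sdiff_def by blast
    then show ?thesis using cl[OF a'(1) b'(1)] by auto
  qed
  then show ?case using IH unfolding vsL by (auto simp: L S_def)
qed

lemma spans_complete:
  "W \<subseteq> V \<Longrightarrow> card W \<le> r \<Longrightarrow>
   \<exists>L\<in>set (spans A r). vs ` set L = (\<lambda>S. {w \<in> V. row_sum E S w}) ` Pow W"
proof (induction r arbitrary: W)
  case 0
  then have "W = {}" using finite_subset[of W V] by simp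
  then show ?case by (simp add: vs_def)
next
  case (Suc r)
  let ?R = "\<lambda>S. {w \<in> V. row_sum E S w}"
  have finW: "finite W" using Suc.prems finite_subset by blast
  obtain v W' where v: "v \<le> n" "W' \<subseteq> V" "card W' \<le> r" "W = W' \<and> v = n \<or> W = insert v W' \<and> v \<notin> W' \<and> v < n"
  proof (cases "W = {}")
    case True
    then show ?thesis using that[of n "{}"] by simp
  next
    case False
    then obtain v where "v \<in> W" by blast
    show ?thesis
    proof (rule that[of v "W - {v}"])
      show "card (W - {v}) \<le> r" using \<open>v \<in> W\<close> Suc.prems(2) finW by simp
      show "W = W - {v} \<and> v = n \<or> W = insert v (W - {v}) \<and> v \<notin> W - {v} \<and> v < n"
        using \<open>v \<in> W\<close> Suc.prems(1) by auto
    qed (use \<open>v \<in> W\<close> Suc.prems(1) in auto)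
  qed
  obtain L where L: "L \<in> set (spans A r)" "vs ` set L = ?R ` Pow W'" using Suc.IH[OF v(2,3)] by blast
  define L' where "L' = L @ map (xor_vec n (row A v)) L"
  have "v \<in> set [0..<Suc n]" using v(1) by auto
  then have "\<exists>L\<in>set (spans A r). L' \<in> (\<lambda>v. L @ map (xor_vec n (row A v)) L) ` set [0..<Suc n]"
    using L(1) unfolding L'_def by (intro bexI[of _ L] image_eqI[of _ _ v]) simp_all
  then have "L' \<in> set (spans A (Suc r))" by (simp del: upt_Suc set_upt)
  moreover have "vs ` set L' = ?R ` Pow W"
  proof -
    have "vs ` set L' = vs ` set L \<union> (\<lambda>a. {w. E v w} \<ominus> a) ` vs ` set L"
      unfolding L'_def by (simp add: image_Un image_image vs_xor_vec vs_row)
    also have "\<dots> = ?R ` Pow W' \<union> (\<lambda>a. {w. E v w} \<ominus> a) ` ?R ` Pow W'" unfolding L(2) ..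
    also have "\<dots> = ?R ` Pow W"
    proof (cases "v = n")
      case True
      then have "{w. E v w} = {}" using E_less by blast
      moreover have "W = W'" using v(4) True by auto
      ultimately show ?thesis by (simp add: sdiff_def)
    next
      case False
      then have W: "W = insert v W'" "v \<notin> W'" using v by auto
      have eq: "{w. E v w} \<ominus> ?R S = ?R (insert v S)" if "S \<subseteq> W'" for S
      proof -
        have "finite S" using that finW W by (auto intro: finite_subset)
        moreover have "insert v S = {v} \<ominus> S" using that W by (auto simp: sdiff_def)
        ultimately have "row_sum E (insert v S) w \<longleftrightarrow> E v w \<noteq> row_sum E S w" for w
          using row_sum_sdiff[of "{v}" S E w] by simp
        then show ?thesis using E_less[of v] by (auto simp: sdiff_def)
      qed
      have "(\<lambda>a. {w. E v w} \<ominus> a) ` ?R ` Pow W' = ?R ` insert v ` Pow W'"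
        unfolding image_image by (rule image_cong) (use eq in auto)
      then show ?thesis unfolding W Pow_insert image_Un by simp
    qed
    finally show ?thesis .
  qed
  ultimately show ?case by blast
qed

text \<open>Whatever rows were chosen, a list in \<open>spans A r\<close> represents a linear space
  of at most \<open>2 ^ r\<close> vectors. If it matches each row of \<open>X\<close> on the columns
  outside \<open>X\<close>, it therefore matches all sums of these rows. Conversely, a row basis has
  at most \<open>r\<close> elements and its span is among the lists.\<close>

lemma low_rank_iff: "low_rank r A X \<longleftrightarrow> rank_le E (vs X) (V - vs X) r"
proof
  assume "low_rank r A X"
  then obtain L where L: "L \<in> set (spans A r)"
    and cov: "\<And>x. x < n \<Longrightarrow> mem X x \<Longrightarrow> \<exists>m\<in>set L. \<forall>w<n. \<not> mem X w \<longrightarrow> (mem (row A x) w \<longleftrightarrow> mem m w)"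
    unfolding low_rank_def by blast
  define D where "D = V - vs X"
  define S where "S = vs ` set L"
  note sound = spans_sound[OF L, folded S_def]
  have cov': "\<exists>m\<in>S. \<forall>w\<in>D. E x w \<longleftrightarrow> w \<in> m" if "x \<in> vs X" for x
  proof -
    obtain m where "m \<in> set L" "\<forall>w<n. \<not> mem X w \<longrightarrow> (mem (row A x) w \<longleftrightarrow> mem m w)"
      using cov[of x] \<open>x \<in> vs X\<close> by (auto simp: vs_def)
    then show ?thesis unfolding S_def D_def by (intro bexI[of _ "vs m"]) (auto simp: vs_def)
  qed
  have sub: "\<exists>m\<in>S. \<forall>w\<in>D. row_sum E B w \<longleftrightarrow> w \<in> m" if "finite B" "B \<subseteq> vs X" for B
    using that
  proof (induction B)
    case empty
    show ?case using sound by (intro bexI[of _ "{}"]) auto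
  next
    case (insert x B)
    obtain a where a: "a \<in> S" "\<forall>w\<in>D. E x w \<longleftrightarrow> w \<in> a" using cov'[of x] insert.prems by auto
    obtain b where b: "b \<in> S" "\<forall>w\<in>D. row_sum E B w \<longleftrightarrow> w \<in> b" using insert by auto
    have "insert x B = {x} \<ominus> B" using insert.hyps by (auto simp: sdiff_def)
    then have "row_sum E (insert x B) w \<longleftrightarrow> E x w \<noteq> row_sum E B w" for w
      using row_sum_sdiff[of "{x}" B E w] insert.hyps by simp
    then have "\<forall>w\<in>D. row_sum E (insert x B) w \<longleftrightarrow> w \<in> a \<ominus> b" using a(2) b(2) by (auto simp: sdiff_def)
    moreover have "a \<ominus> b \<in> S" using sound a(1) b(1) by blast
    ultimately show ?case by blast
  qed
  have "row_space E (vs X) D \<subseteq> (\<lambda>m. D \<inter> m) ` S"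
  proof
    fix y assume "y \<in> row_space E (vs X) D"
    then obtain B where B: "B \<subseteq> vs X" "y = {w \<in> D. row_sum E B w}" by (auto simp: row_space_def)
    then obtain m where "m \<in> S" "\<forall>w\<in>D. row_sum E B w \<longleftrightarrow> w \<in> m"
      using sub[of B] finite_subset[OF B(1)] by auto
    then show "y \<in> (\<lambda>m. D \<inter> m) ` S" using B(2) by (intro image_eqI[of _ _ m]) auto
  qed
  then have "card (row_space E (vs X) D) \<le> card ((\<lambda>m. D \<inter> m) ` S)" by (intro card_mono) (auto simp: S_def)
  also have "\<dots> \<le> card S" by (intro card_image_le) (simp add: S_def)
  also have "\<dots> \<le> card (set L)" unfolding S_def by (intro card_image_le) simp
  also have "\<dots> \<le> 2 ^ r" using card_length[of L] sound by simp
  finally show "rank_le E (vs X) (V - vs X) r" unfolding rank_le_def D_def .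
next
  assume r: "rank_le E (vs X) (V - vs X) r"
  obtain W where W: "W \<subseteq> vs X" "card (row_space E (vs X) (V - vs X)) = 2 ^ card W"
    "\<And>x. x \<in> vs X \<Longrightarrow> \<exists>S\<subseteq>W. \<forall>w\<in>V - vs X. E x w \<longleftrightarrow> row_sum E S w"
    using row_basis[OF finite_vs, of X E "V - vs X"] by metis
  have "card W \<le> r" using r W(2) by (simp add: rank_le_def)
  then obtain L where L: "L \<in> set (spans A r)" "vs ` set L = (\<lambda>S. {w \<in> V. row_sum E S w}) ` Pow W"
    using spans_complete[OF order_trans[OF W(1) vs_subset]] by blast
  have "\<exists>m\<in>set L. \<forall>w<n. \<not> mem X w \<longrightarrow> (mem (row A x) w \<longleftrightarrow> mem m w)" if x: "x < n" "mem X x" for x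
  proof -
    obtain S where S: "S \<subseteq> W" "\<forall>w\<in>V - vs X. E x w \<longleftrightarrow> row_sum E S w" using W(3)[of x] x by (auto simp: vs_def)
    then have "{w \<in> V. row_sum E S w} \<in> vs ` set L" unfolding L(2) by blast
    then obtain m where m: "m \<in> set L" "{w \<in> V. row_sum E S w} = vs m" by blast
    then have "mem m w \<longleftrightarrow> row_sum E S w" if "w < n" for w using that by (auto simp: mem_vs)
    then show ?thesis using m(1) S(2) by (intro bexI[of _ m]) (auto simp: vs_def)
  qed
  then show "low_rank r A X" unfolding low_rank_def using L(1) by blast
qed

text \<open>Independence of the guessed rows on the columns outside \<open>X\<close>, witnessed by the guessed
  columns, makes the vector \<open>m\<close> in the definition of \<^const>\<open>compatible\<close> independent of \<open>w\<close>.\<close>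

lemma guess_exists:
  assumes X: "X \<subseteq> V" "X \<noteq> V" "rank_le E X (V - X) r"
  shows "\<exists>g\<in>set (guesses r A). fst g \<in> set (spans A r) \<and> (\<forall>x\<in>X. \<forall>w\<in>V - X. compatible A g x w) \<and>
    (\<forall>x D. D \<noteq> {} \<longrightarrow> D \<subseteq> V \<longrightarrow> (\<forall>w\<in>D. compatible A g x w) \<longrightarrow> (\<exists>m\<in>set (fst g). \<forall>w\<in>D. E x w \<longleftrightarrow> mem m w))"
proof -
  have finX: "finite X" using X finite_subset by blast
  obtain W where W: "W \<subseteq> X" "row_kernel E W (V - X) = {{}}" "card (row_space E X (V - X)) = 2 ^ card W"
    "\<And>x. x \<in> X \<Longrightarrow> \<exists>S\<subseteq>W. \<forall>w\<in>V - X. E x w \<longleftrightarrow> row_sum E S w"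
    using row_basis[OF finX, of E "V - X"] by metis
  have finW: "finite W" using finite_subset[OF W(1) finX] .
  have "card W \<le> r" using X(3) W(3) by (simp add: rank_le_def)
  then obtain L where L: "L \<in> set (spans A r)" "vs ` set L = (\<lambda>S. {w \<in> V. row_sum E S w}) ` Pow W"
    using spans_complete[OF order_trans[OF W(1) X(1)]] by blast
  have sep: "\<exists>w\<in>V - X. mem m w \<noteq> mem m' w" if m: "m \<in> set L" "m' \<in> set L" "vs m \<noteq> vs m'" for m m'
  proof -
    have "vs m \<in> (\<lambda>S. {w \<in> V. row_sum E S w}) ` Pow W" "vs m' \<in> (\<lambda>S. {w \<in> V. row_sum E S w}) ` Pow W"
      using m L(2) by blast+
    then obtain S S' where S: "S \<subseteq> W" "S' \<subseteq> W" "vs m = {w \<in> V. row_sum E S w}" "vs m' = {w \<in> V. row_sum E S' w}"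
      by blast
    then have "S \<noteq> S'" using m(3) by auto
    then have "{w \<in> V - X. row_sum E S w} \<noteq> {w \<in> V - X. row_sum E S' w}"
      using independent_rows_inj[OF finW W(2)] S(1,2) unfolding inj_on_def by blast
    then obtain w where "w \<in> V - X" "row_sum E S w \<noteq> row_sum E S' w" by auto
    moreover have "mem m w \<longleftrightarrow> row_sum E S w" "mem m' w \<longleftrightarrow> row_sum E S' w" if "w \<in> V" for w
      using that S(3,4) mem_vs by auto
    ultimately show ?thesis by auto
  qed
  \<comment> \<open>A fallback for pairs of lists that represent the same vector. Even then the
    chosen column must lie outside \<open>X\<close>, since inside \<open>X\<close> the row of
    \<open>x\<close> need not agree with any guessed vector.\<close>
  obtain w0 where w0: "w0 \<in> V - X" using X by auto
  define d where "d p = (SOME w. w \<in> V - X \<and> (vs (fst p) \<noteq> vs (snd p) \<longrightarrow> mem (fst p) w \<noteq> mem (snd p) w))" for p :: "bool list \<times> bool list"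
  have d: "d (m, m') \<in> V - X \<and> (vs m \<noteq> vs m' \<longrightarrow> mem m (d (m, m')) \<noteq> mem m' (d (m, m')))"
    if "m \<in> set L" "m' \<in> set L" for m m'
  proof -
    have "\<exists>w. w \<in> V - X \<and> (vs (fst (m, m')) \<noteq> vs (snd (m, m')) \<longrightarrow> mem (fst (m, m')) w \<noteq> mem (snd (m, m')) w)"
      using sep[OF that] w0 by auto
    from someI_ex[OF this] show ?thesis unfolding d_def by simp
  qed
  define C where "C = map d (List.product L L)"
  have "length L = 2 ^ r" using spans_sound[OF L(1)] by simp
  then have lenC: "length C = 4 ^ r" by (simp add: C_def flip: power_mult_distrib)
  have CX: "set C \<subseteq> V - X" using d by (auto simp: C_def)
  have "C \<in> set (tuples n (4 ^ r))" unfolding set_tuples using lenC CX by auto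
  then have "(L, C) \<in> set (guesses r A)" using L(1) unfolding guesses_def by force
  moreover have "compatible A (L, C) x w" if "x \<in> X" "w \<in> V - X" for x w
  proof -
    obtain S where S: "S \<subseteq> W" "\<forall>w\<in>V - X. E x w \<longleftrightarrow> row_sum E S w" using W(4) \<open>x \<in> X\<close> by blast
    then have "{w \<in> V. row_sum E S w} \<in> vs ` set L" unfolding L(2) by blast
    then obtain m where m: "m \<in> set L" "{w \<in> V. row_sum E S w} = vs m" by blast
    have "E x w \<longleftrightarrow> mem m w" if "w \<in> V - X" for w
      using that S(2) m(2) mem_vs[of w m] by auto
    then show ?thesis unfolding compatible_def using m(1) CX that by auto
  qed
  moreover have "\<exists>m\<in>set L. \<forall>w\<in>D. E x w \<longleftrightarrow> mem m w"
    if D: "D \<noteq> {}" "D \<subseteq> V" "\<forall>w\<in>D. compatible A (L, C) x w" for x D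
  proof -
    have comp: "\<exists>m\<in>set L. (\<forall>c\<in>set C. E x c \<longleftrightarrow> mem m c) \<and> (E x w \<longleftrightarrow> mem m w)" if "w \<in> D" for w
      using D(3) that unfolding compatible_def by simp
    obtain w1 where "w1 \<in> D" using D(1) by blast
    then obtain m1 where m1: "m1 \<in> set L" "\<forall>c\<in>set C. E x c \<longleftrightarrow> mem m1 c" using comp by blast
    have "E x w \<longleftrightarrow> mem m1 w" if w: "w \<in> D" for w
    proof -
      obtain m where m: "m \<in> set L" "\<forall>c\<in>set C. E x c \<longleftrightarrow> mem m c" "E x w \<longleftrightarrow> mem m w" using comp[OF w] by blast
      have "d (m, m1) \<in> set C" using m(1) m1(1) by (auto simp: C_def)
      then have "vs m = vs m1" using d[OF m(1) m1(1)] m(2) m1(2) by auto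
      moreover have "w < n" using w D(2) by auto
      ultimately show ?thesis using m(3) mem_vs by metis
    qed
    then show ?thesis using m1(1) by blast
  qed
  ultimately show ?thesis using L(1) by (intro bexI[of _ "(L, C)"]) auto
qed

text \<open>Take guesses that are correct for a split into \<open>X\<close> and \<open>Y\<close>,
  and start the closure in \<open>X\<close>. All implications hold for \<open>X\<close>, so the
  closure \<open>F\<close> stays inside \<open>X\<close> and is a proper part of
  \<open>vs Z\<close>. It has low rank because every \<open>x\<close> in \<open>F\<close> is
  compatible with every \<open>w\<close> outside \<open>F\<close>: for \<open>w\<close> in
  \<open>X\<close> by closure, otherwise by the choice of the guess. A single guessed vector then
  describes the row of \<open>x\<close> outside \<open>F\<close>. For \<open>vs Z - F\<close> the
  second kind of implication gives compatibility directly.\<close>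

lemma split_vec_correct:
  assumes "\<exists>X\<subseteq>vs Z. X \<noteq> {} \<and> X \<noteq> vs Z \<and> rank_le E X (V - X) r \<and> rank_le E (vs Z - X) (V - (vs Z - X)) r"
  shows "is_split r A Z (split_vec r A Z)"
proof -
  obtain X where X: "X \<subseteq> vs Z" "X \<noteq> {}" "X \<noteq> vs Z" "rank_le E X (V - X) r"
    "rank_le E (vs Z - X) (V - (vs Z - X)) r" using assms by blast
  define Y where "Y = vs Z - X"
  have XV: "X \<subseteq> V" "X \<noteq> V" "Y \<subseteq> V" "Y \<noteq> V" using X(1-3) vs_subset[of Z] unfolding Y_def by auto
  obtain g where g: "g \<in> set (guesses r A)" "fst g \<in> set (spans A r)"
    and gX: "\<forall>x\<in>X. \<forall>w\<in>V - X. compatible A g x w"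
    and gu: "\<forall>x D. D \<noteq> {} \<longrightarrow> D \<subseteq> V \<longrightarrow> (\<forall>w\<in>D. compatible A g x w) \<longrightarrow> (\<exists>m\<in>set (fst g). \<forall>w\<in>D. E x w \<longleftrightarrow> mem m w)"
    using guess_exists[OF XV(1,2) X(4)] by blast
  obtain h where h: "h \<in> set (guesses r A)" "fst h \<in> set (spans A r)"
    and hY: "\<forall>x\<in>Y. \<forall>w\<in>V - Y. compatible A h x w"
    and hu: "\<forall>x D. D \<noteq> {} \<longrightarrow> D \<subseteq> V \<longrightarrow> (\<forall>w\<in>D. compatible A h x w) \<longrightarrow> (\<exists>m\<in>set (fst h). \<forall>w\<in>D. E x w \<longleftrightarrow> mem m w)"
    using guess_exists[OF XV(3,4) X(5)[folded Y_def]] by blast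
  obtain v where v: "v \<in> X" using X(2) by blast
  have vn: "v < n" using v XV by auto
  define step where "step S = S \<union> {z \<in> vs Z. (\<exists>x\<in>S. \<not> compatible A g x z) \<or>
     (\<exists>w\<in>V. (w \<in> S \<or> w \<notin> vs Z) \<and> \<not> compatible A h z w)}" for S
  have vstep: "vs (closure_step A Z (g, h) U) = step (vs U)" for U
    unfolding closure_step_def step_def vs_def by (auto simp: mem_map)
  have "vs ((closure_step A Z (g, h) ^^ i) U) = (step ^^ i) (vs U)" for i U
    by (induction i) (simp_all add: vstep)
  moreover have "vs (map (\<lambda>z. z = v) [0..<n]) = {v}" using vn by (auto simp: vs_def mem_map)
  ultimately have F: "vs (forced A Z (g, h) v) = (step ^^ n) {v}" unfolding forced_def by simp
  define F where "F = (step ^^ n) {v}"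
  have fixF: "step F = F" unfolding F_def
  proof (rule inflationary_fixpoint[of V])
    show "S \<subseteq> step S \<and> step S \<subseteq> V" if "S \<subseteq> V" for S using that vs_subset[of Z] unfolding step_def by auto
  qed (use vn in auto)
  have stepX: "step S \<subseteq> X" if S: "S \<subseteq> X" for S
  proof
    fix z assume "z \<in> step S"
    then consider "z \<in> S" | x where "z \<in> vs Z" "x \<in> S" "\<not> compatible A g x z"
      | w where "z \<in> vs Z" "w \<in> V" "w \<in> S \<or> w \<notin> vs Z" "\<not> compatible A h z w"
      unfolding step_def by blast
    then show "z \<in> X"
    proof cases
      case 1
      then show ?thesis using S by blast
    next
      case 2
      then show ?thesis using gX S vs_subset[of Z] by blast
    next
      case 3
      then have "w \<in> V - Y" using S unfolding Y_def by blast
      then show ?thesis using hY 3 unfolding Y_def by blast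
    qed
  qed
  have "(step ^^ i) {v} \<subseteq> X" for i by (induction i) (use v stepX in auto)
  then have FX: "F \<subseteq> X" unfolding F_def .
  have "{v} \<subseteq> (step ^^ i) {v}" for i by (induction i) (auto simp: step_def)
  then have vF: "v \<in> F" unfolding F_def by blast
  have 1: "\<exists>m\<in>set (fst g). \<forall>w\<in>V - F. E x w \<longleftrightarrow> mem m w" if x: "x \<in> F" for x
  proof (rule gu[rule_format])
    show "V - F \<noteq> {}" using FX XV by auto
    fix w assume w: "w \<in> V - F"
    show "compatible A g x w"
    proof (cases "w \<in> X")
      case True
      then have "w \<in> vs Z" "w \<notin> step F" using X(1) w fixF by auto
      then show ?thesis using x unfolding step_def by blast
    next
      case False
      then show ?thesis using gX x FX w by blast
    qed
  qed auto
  have 2: "\<exists>m\<in>set (fst h). \<forall>w\<in>V - (vs Z - F). E y w \<longleftrightarrow> mem m w" if y: "y \<in> vs Z - F" for y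
  proof (rule hu[rule_format])
    show "V - (vs Z - F) \<noteq> {}" using vF vn by auto
    fix w assume w: "w \<in> V - (vs Z - F)"
    have "y \<notin> step F" using y fixF by auto
    then show "compatible A h y w" using y w unfolding step_def by blast
  qed auto
  let ?U = "forced A Z (g, h) v"
  have U: "vs ?U = F" using F F_def by simp
  have memU: "mem ?U x \<longleftrightarrow> x \<in> F" if "x < n" for x using that U mem_vs by simp
  have memZ: "mem Z x \<longleftrightarrow> x \<in> vs Z" if "x < n" for x using that mem_vs by simp
  have memD: "mem (diff_vec n Z ?U) x \<longleftrightarrow> x \<in> vs Z - F" if "x < n" for x
    using that mem_vs[of x "diff_vec n Z ?U"] vs_diff_vec U by simp
  have "low_rank r A ?U" unfolding low_rank_def
  proof (intro bexI[of _ "fst g"] allI impI)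
    fix x assume "x < n" "mem ?U x"
    then obtain m where m: "m \<in> set (fst g)" "\<forall>w\<in>V - F. E x w \<longleftrightarrow> mem m w" using 1[of x] memU by auto
    then show "\<exists>m\<in>set (fst g). \<forall>w<n. \<not> mem ?U w \<longrightarrow> (mem (row A x) w \<longleftrightarrow> mem m w)"
      using memU by (intro bexI[of _ m]) auto
  qed (use g in simp)
  moreover have "low_rank r A (diff_vec n Z ?U)" unfolding low_rank_def
  proof (intro bexI[of _ "fst h"] allI impI)
    fix x assume "x < n" "mem (diff_vec n Z ?U) x"
    then obtain m where m: "m \<in> set (fst h)" "\<forall>w\<in>V - (vs Z - F). E x w \<longleftrightarrow> mem m w" using 2[of x] memD by auto
    then show "\<exists>m\<in>set (fst h). \<forall>w<n. \<not> mem (diff_vec n Z ?U) w \<longrightarrow> (mem (row A x) w \<longleftrightarrow> mem m w)"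
      using memD by (intro bexI[of _ m]) auto
  qed (use h in simp)
  moreover have "\<exists>x<n. mem ?U x" using vn vF memU by blast
  moreover have "\<exists>z<n. mem Z z \<and> \<not> mem ?U z"
  proof -
    obtain z where "z \<in> vs Z" "z \<notin> X" using X by blast
    then have "z < n" "z \<in> vs Z" "z \<notin> F" using FX vs_subset by auto
    then show ?thesis using memU memZ by blast
  qed
  moreover have "\<forall>x<n. mem ?U x \<longrightarrow> mem Z x" using memU memZ FX X(1) by blast
  ultimately have split: "is_split r A Z ?U" unfolding is_split_def by blast
  let ?xs = "filter (is_split r A Z) (concat (map (\<lambda>g. concat (map (\<lambda>g'.
     map (forced A Z (g, g')) [0..<n]) (guesses r A))) (guesses r A)))"
  have "?U \<in> set ?xs" using split vn by simp (rule bexI[OF _ g(1)], rule bexI[OF _ h(1)], simp)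
  then have "?xs \<noteq> []" by (metis empty_iff list.set(1))
  then have "split_vec r A Z \<in> set ?xs" unfolding split_vec_def by (rule lookup_0_mem)
  then show ?thesis by (simp only: set_filter mem_Collect_eq)
qed

end

section \<open>Signatures, cut weights and the number of states\<close>

context adj_matrix
begin

definition nb :: "nat \<Rightarrow> nat set" where
  "nb v = {w. w < n \<and> nbr A v w}"

lemma finite_nb [simp]: "finite (nb v)"
  by (simp add: nb_def)

lemma nb_vertex: "v < n \<Longrightarrow> nb v = {w. E v w}"
  using E_less by (auto simp: nb_def nbr_def)

lemma nb_top: "nb n = V"
  by (auto simp: nb_def nbr_def)

lemma mem_iff: "length Z \<le> n \<Longrightarrow> mem Z v \<longleftrightarrow> v \<in> vs Z"
  by (auto simp: vs_def lookup_def)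

definition signature :: "nat set \<Rightarrow> nat \<Rightarrow> bool \<times> nat set" where
  "signature S v = (if v \<in> S then (True, nb v - S) else (False, nb v \<inter> S))"

text \<open>The state of a solution \<open>f\<close> on a cell \<open>S\<close>; by its form it
  depends on \<open>v\<close> only through the signature. The fictitious vertex \<open>n\<close> has
  all vertices as neighbours, so its entry is the weight of the cell.\<close>

definition cut_weight :: "(nat \<Rightarrow> nat) \<Rightarrow> nat set \<Rightarrow> nat \<Rightarrow> nat" where
  "cut_weight f S v = sum f (snd (signature S v))"

lemma twins_signature:
  assumes "length Z \<le> n"
  shows "twins A Z p v \<longleftrightarrow> signature (vs Z) p = signature (vs Z) v"
proof -
  have "(\<forall>w<n. (w \<in> vs Z \<longleftrightarrow> \<not> b) \<longrightarrow> (nbr A p w \<longleftrightarrow> nbr A v w)) \<longleftrightarrow>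
      (if b then nb p - vs Z = nb v - vs Z else nb p \<inter> vs Z = nb v \<inter> vs Z)" for b
    using vs_subset[of Z] by (auto simp: nb_def)
  from this[of "p \<in> vs Z"] show ?thesis
    unfolding twins_def mem_iff[OF assms] signature_def by auto
qed

lemma states_complete:
  assumes Z: "length Z \<le> n" and f: "\<And>v. v \<le> n \<Longrightarrow> cut_weight f (vs Z) v \<le> M * n"
    and Q: "Q \<subseteq> signature (vs Z) ` {..n}" "card Q \<le> i"
  shows "\<exists>s\<in>set (states M A Z i). \<forall>v\<le>n. val s v = (if signature (vs Z) v \<in> Q then cut_weight f (vs Z) v else 0)"
  using Q
proof (induction i arbitrary: Q)
  case 0
  have "finite Q" using finite_subset[OF 0(1)] by simp
  then have "Q = {}" using 0 by simp
  then show ?case by simp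
next
  case (Suc i)
  have fin: "finite Q" using finite_subset[OF Suc.prems(1)] by simp
  obtain p Q' y where p: "p \<le> n" "Q' \<subseteq> signature (vs Z) ` {..n}" "card Q' \<le> i" "y \<le> M * n"
    and Q: "\<And>v. v \<le> n \<Longrightarrow> (if signature (vs Z) p = signature (vs Z) v then y
        else if signature (vs Z) v \<in> Q' then cut_weight f (vs Z) v else 0)
      = (if signature (vs Z) v \<in> Q then cut_weight f (vs Z) v else 0)"
  proof (cases "Q = {}")
    case True
    \<comment> \<open>No class is left in \<open>Q\<close>. The round is spent on writing 0 to the
      class of the fictitious vertex, where 0 is required anyway.\<close>
    then show ?thesis using that[of n "{}" 0] by simp
  next
    case False
    then obtain q where q: "q \<in> Q" by blast
    then obtain p where p: "p \<le> n" "q = signature (vs Z) p" using Suc.prems by auto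
    show ?thesis
    proof (rule that[of p "Q - {q}" "cut_weight f (vs Z) p"])
      show "card (Q - {q}) \<le> i" using q fin Suc.prems(2) by simp
      fix v assume "v \<le> n"
      show "(if signature (vs Z) p = signature (vs Z) v then cut_weight f (vs Z) p
        else if signature (vs Z) v \<in> Q - {q} then cut_weight f (vs Z) v else 0)
        = (if signature (vs Z) v \<in> Q then cut_weight f (vs Z) v else 0)"
        using p q by (auto simp: cut_weight_def)
    qed (use p q Suc.prems f in auto)
  qed
  obtain s where s: "s \<in> set (states M A Z i)"
    "\<forall>v\<le>n. val s v = (if signature (vs Z) v \<in> Q' then cut_weight f (vs Z) v else 0)"
    using Suc.IH[OF p(2,3)] by blast
  define t where "t = map (\<lambda>v. if twins A Z p v then y else val s v) [0..<Suc n]"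
  have val_t: "val t v = (if twins A Z p v then y else val s v)" if "v \<le> n" for v
    using that by (simp add: t_def lookup_def nth_append del: upt_Suc)
  have "t \<in> (\<lambda>y. map (\<lambda>v. if twins A Z p v then y else val s v) [0..<Suc n]) ` set [0..<Suc (M * n)]"
    unfolding t_def using p(4) by (intro image_eqI[of _ _ y]) auto
  then have "\<exists>p\<in>set [0..<Suc n]. t \<in> (\<lambda>y. map (\<lambda>v. if twins A Z p v then y else val s v) [0..<Suc n]) ` set [0..<Suc (M * n)]"
    using p(1) by (intro bexI[of _ p]) auto
  then have "t \<in> set (states M A Z (Suc i))" using s(1)
    by (simp del: upt_Suc set_upt) (rule bexI[of _ s], simp_all del: upt_Suc set_upt)
  moreover have "\<forall>v\<le>n. val t v = (if signature (vs Z) v \<in> Q then cut_weight f (vs Z) v else 0)"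
  proof (intro allI impI)
    fix v assume v: "v \<le> n"
    show "val t v = (if signature (vs Z) v \<in> Q then cut_weight f (vs Z) v else 0)"
      unfolding val_t[OF v] twins_signature[OF Z] s(2)[rule_format, OF v] by (rule Q[OF v])
  qed
  ultimately show ?case by blast
qed

declare states.simps(2) [simp del]

text \<open>For vertices in \<open>S\<close> the neighbours across the cut form a vector of the row
  space, which has at most \<open>2 ^ r\<close> elements. For a vertex outside \<open>S\<close>, its
  adjacency to a row basis \<open>W\<close> determines its adjacency to all of \<open>S\<close>,
  because every row is a sum of basis rows; there are at most \<open>2 ^ r\<close> subsets of
  \<open>W\<close>. The fictitious vertex adds one.\<close>

lemma card_signatures:
  assumes S: "S \<subseteq> V" "rank_le E S (V - S) r"
  shows "card (signature S ` {..n}) \<le> 2 ^ r + 2 ^ r + 1"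
proof -
  have finS: "finite S" using S finite_subset by blast
  obtain W where W: "W \<subseteq> S" "card (row_space E S (V - S)) = 2 ^ card W"
    "\<And>x. x \<in> S \<Longrightarrow> \<exists>B\<subseteq>W. \<forall>w\<in>V - S. E x w \<longleftrightarrow> row_sum E B w"
    using row_basis[OF finS, of E "V - S"] by metis
  have finW: "finite W" using finite_subset[OF W(1) finS] .
  have cW: "card W \<le> r" using S(2) W(2) by (simp add: rank_le_def)
  have "\<forall>x\<in>S. \<exists>B. B \<subseteq> W \<and> (\<forall>w\<in>V - S. E x w \<longleftrightarrow> row_sum E B w)" using W(3) by blast
  from bchoice[OF this] obtain B where B: "\<forall>x\<in>S. B x \<subseteq> W \<and> (\<forall>w\<in>V - S. E x w \<longleftrightarrow> row_sum E (B x) w)" by blast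
  let ?in = "Pair True ` row_space E S (V - S)"
  let ?out = "(\<lambda>N. (False, {x \<in> S. odd (card (B x \<inter> N))})) ` Pow W"
  have "signature S ` {..n} \<subseteq> ?in \<union> ?out \<union> {signature S n}"
  proof
    fix y assume "y \<in> signature S ` {..n}"
    then obtain v where v: "v \<le> n" "y = signature S v" by auto
    then consider "v = n" | "v < n" "v \<in> S" | "v < n" "v \<notin> S" by linarith
    then show "y \<in> ?in \<union> ?out \<union> {signature S n}"
    proof cases
      case 2
      then have "nb v - S = {w \<in> V - S. row_sum E {v} w}" using E_less by (auto simp: nb_vertex)
      then have "nb v - S \<in> row_space E S (V - S)" using 2 unfolding row_space_def by (intro image_eqI[of _ _ "{v}"]) auto
      then show ?thesis using v 2 by (simp add: signature_def)
    next
      case 3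
      let ?N = "{a \<in> W. E a v}"
      have "E v x \<longleftrightarrow> odd (card (B x \<inter> ?N))" if "x \<in> S" for x
      proof -
        have "B x \<inter> ?N = {a \<in> B x. E a v}" using B that by auto
        moreover have "E x v \<longleftrightarrow> row_sum E (B x) v" using B that 3 by simp
        ultimately show ?thesis using E_sym[of v x] by (simp add: row_sum_def)
      qed
      then have "nb v \<inter> S = {x \<in> S. odd (card (B x \<inter> ?N))}" using 3 by (auto simp: nb_vertex)
      then have "y = (False, {x \<in> S. odd (card (B x \<inter> ?N))})" using v 3 by (simp add: signature_def)
      then show ?thesis by blast
    qed (use v in auto)
  qed
  then have "card (signature S ` {..n}) \<le> card (?in \<union> ?out \<union> {signature S n})"
    using finS finW by (intro card_mono) (auto simp: finite_row_space)
  also have "\<dots> \<le> card ?in + card ?out + 1"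
    using card_Un_le[of "?in \<union> ?out" "{signature S n}"] card_Un_le[of ?in ?out] by simp
  also have "\<dots> \<le> 2 ^ r + 2 ^ r + 1"
  proof -
    have "card ?in \<le> card (row_space E S (V - S))" using finS by (intro card_image_le finite_row_space)
    then have "card ?in \<le> 2 ^ r" using S(2) by (simp add: rank_le_def)
    moreover have "card ?out \<le> card (Pow W)" using finW by (intro card_image_le) simp
    moreover have "card (Pow W) \<le> 2 ^ r" using finW cW by (simp add: card_Pow)
    ultimately show ?thesis by linarith
  qed
  finally show ?thesis .
qed

lemma cut_weight_le:
  assumes "\<And>v. v < n \<Longrightarrow> f v \<le> M"
  shows "cut_weight f S v \<le> M * n"
proof -
  have sub: "snd (signature S v) \<subseteq> V" by (auto simp: signature_def nb_def)
  have "cut_weight f S v \<le> of_nat (card (snd (signature S v))) * M"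
    unfolding cut_weight_def by (rule sum_bounded_above) (use sub assms in auto)
  also have "\<dots> \<le> n * M" using card_mono[OF _ sub] by (intro mult_le_mono1) simp
  finally show ?thesis by (simp add: mult.commute)
qed

lemma cut_weight_in_states:
  assumes Z: "length Z \<le> n" "low_rank r A Z" and f: "\<And>v. v < n \<Longrightarrow> f v \<le> M"
  shows "\<exists>s\<in>set (states M A Z (2 ^ r + 2 ^ r + 1)). \<forall>v\<le>n. val s v = cut_weight f (vs Z) v"
proof -
  have "card (signature (vs Z) ` {..n}) \<le> 2 ^ r + 2 ^ r + 1"
    using card_signatures[OF vs_subset] Z(2) unfolding low_rank_iff by blast
  from states_complete[OF Z(1) cut_weight_le[OF f] order_refl this] show ?thesis by auto
qed

end

section \<open>Soundness and completeness of the tables\<close>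

locale dp = adj_matrix +
  fixes ks us :: "nat list" and r M :: nat and cover :: bool
  assumes splits: "\<And>Z. 2 \<le> card (vs Z) \<Longrightarrow> low_rank r A Z \<Longrightarrow> is_split r A Z (split_vec r A Z)"
    and us_le: "\<And>v. v < n \<Longrightarrow> val us v \<le> M"
begin

abbreviation e :: inst where "e \<equiv> (A, ks, us)"

definition feasible :: "(nat \<Rightarrow> nat) \<Rightarrow> bool" where
  "feasible f \<longleftrightarrow> (\<forall>v<n. admissible cover e v (f v) (f v + sum f (nb v)))"

lemma feasible_le: "feasible f \<Longrightarrow> v < n \<Longrightarrow> f v \<le> M"
  using us_le[of v] by (auto simp: feasible_def admissible_def)

text \<open>Inside \<open>S\<close> a state is a promise about the weight that will come from across
  the cut, and it need not be realizable; outside \<open>S\<close> its entries are the true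
  contribution of \<open>S\<close>. Completeness is demanded only for solutions of the whole
  instance. At the root nothing lies across the cut, and the two notions together describe exactly
  the feasible weights.\<close>

definition sound :: "nat set \<Rightarrow> nat list list \<Rightarrow> bool" where
  "sound S T \<longleftrightarrow> (\<forall>s\<in>set T. \<exists>f. (\<forall>v\<in>S. admissible cover e v (f v) (f v + sum f (nb v \<inter> S) + val s v)) \<and>
     (\<forall>v\<le>n. v \<notin> S \<longrightarrow> val s v = sum f (nb v \<inter> S)))"

definition complete :: "nat set \<Rightarrow> nat list list \<Rightarrow> bool" where
  "complete S T \<longleftrightarrow> (\<forall>f. feasible f \<longrightarrow> (\<exists>s\<in>set T. \<forall>v\<le>n. val s v = cut_weight f S v))"

lemma leaf_table_correct:
  assumes Z: "length Z \<le> n" "low_rank r A Z" "vs Z = {v}"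
  shows "sound {v} (leaf_table r M cover e Z) \<and> complete {v} (leaf_table r M cover e Z)"
proof
  have v: "v < n" using Z(3) vs_subset[of Z] by auto
  have mem: "mem Z w \<longleftrightarrow> w = v" for w using mem_iff[OF Z(1)] Z(3) by simp
  have nbv: "nb v \<inter> {v} = {}" "nb v - {v} = nb v" using v by (auto simp: nb_vertex)
  have nbw: "sum f (nb w \<inter> {v}) = (if nbr A w v then f v else 0)" for f :: "nat \<Rightarrow> nat" and w
    using v by (auto simp: nb_def)
  show "sound {v} (leaf_table r M cover e Z)"
    unfolding sound_def
  proof
    fix s assume "s \<in> set (leaf_table r M cover e Z)"
    then obtain x where x: "admissible cover e v x (x + val s v)"
      "\<forall>w<Suc n. \<not> w = v \<longrightarrow> val s w = (if nbr A w v then x else 0)"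
      unfolding leaf_table_def by (auto simp: mem)
    then show "\<exists>f. (\<forall>u\<in>{v}. admissible cover e u (f u) (f u + sum f (nb u \<inter> {v}) + val s u)) \<and>
        (\<forall>w\<le>n. w \<notin> {v} \<longrightarrow> val s w = sum f (nb w \<inter> {v}))"
      by (intro exI[of _ "\<lambda>_. x"]) (simp add: nbv nbw less_Suc_eq_le del: sum_constant)
  qed
  show "complete {v} (leaf_table r M cover e Z)"
    unfolding complete_def
  proof (intro allI impI)
    fix f assume f: "feasible f"
    obtain s where s: "s \<in> set (states M A Z (2 ^ r + 2 ^ r + 1))" "\<forall>v\<le>n. val s v = cut_weight f (vs Z) v"
      using cut_weight_in_states[where f = f, OF Z(1,2) feasible_le[OF f]] by blast
    have sv: "val s v = sum f (nb v)" using s(2) v by (simp add: cut_weight_def signature_def Z(3) nbv)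
    have sw: "val s w = (if nbr A w v then f v else 0)" if "w \<le> n" "w \<noteq> v" for w
      using s(2) that nbw[of f w] by (simp add: cut_weight_def signature_def Z(3))
    have "f v < Suc M" using feasible_le[OF f v] by simp
    moreover have "admissible cover e v (f v) (f v + val s v)" using f v sv by (simp add: feasible_def)
    ultimately have "s \<in> set (leaf_table r M cover e Z)"
      using s(1) v sw by (auto simp: leaf_table_def mem less_Suc_eq_le intro!: exI[of _ v] exI[of _ "f v"])
    then show "\<exists>s\<in>set (leaf_table r M cover e Z). \<forall>w\<le>n. val s w = cut_weight f {v} w"
      using s(2) Z(3) by auto
  qed
qed

text \<open>For soundness, glue the two partial solutions. The equation at \<open>v\<close> in
  \<open>X\<close> says that the promise made to \<open>X\<close> is kept partly by the actual
  contribution of the other part and partly by the promise made to \<open>Z\<close>, so the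
  constraint at \<open>v\<close> reads the same before and after gluing. For completeness, the
  states of one global solution on the three cells satisfy these equations.\<close>

lemma join_table_correct:
  assumes Z: "length Z \<le> n" "low_rank r A Z" and X: "length X \<le> n" "vs X \<subseteq> vs Z"
    and T: "sound (vs X) T" "complete (vs X) T" and T': "sound (vs Z - vs X) T'" "complete (vs Z - vs X) T'"
  shows "sound (vs Z) (join_table r M e Z X T T') \<and> complete (vs Z) (join_table r M e Z X T T')"
proof
  define Y where "Y = vs Z - vs X"
  have ZXY: "vs Z = vs X \<union> Y" "vs X \<inter> Y = {}" using X(2) unfolding Y_def by auto
  have finY [simp]: "finite Y" by (simp add: Y_def)
  have sumZ: "sum f (N \<inter> vs Z) = sum f (N \<inter> vs X) + sum f (N \<inter> Y)" for f :: "nat \<Rightarrow> nat" and N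
    using ZXY by (simp add: Int_Un_distrib) (subst sum.union_disjoint, auto)
  have memX: "mem X v \<longleftrightarrow> v \<in> vs X" and memZ: "mem Z v \<longleftrightarrow> v \<in> vs Z" for v using mem_iff X Z by auto
  show "sound (vs Z) (join_table r M e Z X T T')"
    unfolding sound_def
  proof
    fix s assume "s \<in> set (join_table r M e Z X T T')"
    then obtain t t' where t: "t \<in> set T" "t' \<in> set T'"
      and rel: "\<forall>v<Suc n. if mem X v then val t v = val t' v + val s v
         else if mem Z v then val t' v = val t v + val s v else val s v = val t v + val t' v"
      unfolding join_table_def by auto
    obtain f where f: "\<forall>v\<in>vs X. admissible cover e v (f v) (f v + sum f (nb v \<inter> vs X) + val t v)"
      "\<forall>v\<le>n. v \<notin> vs X \<longrightarrow> val t v = sum f (nb v \<inter> vs X)" using T(1) t(1) unfolding sound_def by blast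
    obtain g where g: "\<forall>v\<in>Y. admissible cover e v (g v) (g v + sum g (nb v \<inter> Y) + val t' v)"
      "\<forall>v\<le>n. v \<notin> Y \<longrightarrow> val t' v = sum g (nb v \<inter> Y)" using T'(1) t(2) unfolding sound_def Y_def by blast
    define h where "h v = (if v \<in> vs X then f v else g v)" for v
    have hX: "sum h (N \<inter> vs X) = sum f (N \<inter> vs X)" for N by (rule sum.cong) (auto simp: h_def)
    have hY: "sum h (N \<inter> Y) = sum g (N \<inter> Y)" for N by (rule sum.cong) (auto simp: h_def Y_def)
    have "admissible cover e v (h v) (h v + sum h (nb v \<inter> vs Z) + val s v)" if v: "v \<in> vs Z" for v
    proof (cases "v \<in> vs X")
      case True
      have vn: "v < n" using True vs_subset[of X] by auto
      have "val t v = val t' v + val s v" using rel vn True memX by simp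
      moreover have "val t' v = sum g (nb v \<inter> Y)" using g(2) vn True unfolding Y_def by simp
      moreover have "h v = f v" using True by (simp add: h_def)
      ultimately have "h v + sum h (nb v \<inter> vs Z) + val s v = f v + sum f (nb v \<inter> vs X) + val t v"
        unfolding sumZ hX hY by simp
      then show ?thesis using f(1) True \<open>h v = f v\<close> by metis
    next
      case False
      have vn: "v < n" and vY: "v \<in> Y" using v False vs_subset[of Z] unfolding Y_def by auto
      have "val t' v = val t v + val s v" using rel vn False v memX memZ by simp
      moreover have "val t v = sum f (nb v \<inter> vs X)" using f(2) vn False by simp
      moreover have "h v = g v" using False by (simp add: h_def)
      ultimately have "h v + sum h (nb v \<inter> vs Z) + val s v = g v + sum g (nb v \<inter> Y) + val t' v"
        unfolding sumZ hX hY by simp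
      then show ?thesis using g(1) vY \<open>h v = g v\<close> by metis
    qed
    moreover have "val s v = sum h (nb v \<inter> vs Z)" if v: "v \<le> n" "v \<notin> vs Z" for v
    proof -
      have "v \<notin> vs X" "v \<notin> Y" using v ZXY by auto
      then show ?thesis using rel v f(2) g(2) unfolding sumZ hX hY memX memZ by (simp add: less_Suc_eq_le)
    qed
    ultimately show "\<exists>f. (\<forall>v\<in>vs Z. admissible cover e v (f v) (f v + sum f (nb v \<inter> vs Z) + val s v)) \<and>
        (\<forall>v\<le>n. v \<notin> vs Z \<longrightarrow> val s v = sum f (nb v \<inter> vs Z))" by blast
  qed
  show "complete (vs Z) (join_table r M e Z X T T')"
    unfolding complete_def
  proof (intro allI impI)
    fix f assume f: "feasible f"
    obtain s where s: "s \<in> set (states M A Z (2 ^ r + 2 ^ r + 1))" "\<forall>v\<le>n. val s v = cut_weight f (vs Z) v"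
      using cut_weight_in_states[where f = f, OF Z feasible_le[OF f]] by blast
    obtain t where t: "t \<in> set T" "\<forall>v\<le>n. val t v = cut_weight f (vs X) v" using T(2) f unfolding complete_def by blast
    obtain t' where t': "t' \<in> set T'" "\<forall>v\<le>n. val t' v = cut_weight f Y v"
      using T'(2) f unfolding complete_def Y_def by blast
    have "if mem X v then val t v = val t' v + val s v
         else if mem Z v then val t' v = val t v + val s v else val s v = val t v + val t' v" if v: "v < Suc n" for v
    proof -
      have X: "sum f (nb v - vs X) = sum f (nb v \<inter> Y) + sum f (nb v - vs Z)"
      proof -
        have "nb v - vs X = (nb v \<inter> Y) \<union> (nb v - vs Z)" using ZXY by auto
        then show ?thesis using ZXY by (simp add: sum.union_disjoint Int_commute) (subst sum.union_disjoint, auto)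
      qed
      have Y: "sum f (nb v - Y) = sum f (nb v \<inter> vs X) + sum f (nb v - vs Z)"
      proof -
        have "nb v - Y = (nb v \<inter> vs X) \<union> (nb v - vs Z)" using ZXY by auto
        then show ?thesis using ZXY by simp (subst sum.union_disjoint, auto)
      qed
      have vals: "val s v = cut_weight f (vs Z) v" "val t v = cut_weight f (vs X) v" "val t' v = cut_weight f Y v"
        using s(2) t(2) t'(2) v by auto
      consider "v \<in> vs X" "v \<in> vs Z" "v \<notin> Y" | "v \<notin> vs X" "v \<in> vs Z" "v \<in> Y" | "v \<notin> vs X" "v \<notin> vs Z" "v \<notin> Y"
        using ZXY by blast
      then show ?thesis
        by cases (simp_all add: memX memZ vals cut_weight_def signature_def X Y sumZ)
    qed
    then have "s \<in> set (join_table r M e Z X T T')" using s(1) t(1) t'(1)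
      unfolding join_table_def set_filter mem_Collect_eq fst_conv by blast
    then show "\<exists>s\<in>set (join_table r M e Z X T T'). \<forall>v\<le>n. val s v = cut_weight f (vs Z) v" using s(2) by blast
  qed
qed

text \<open>The slack of 2 makes the step count additive: one split step, one join step and two
  subcomputations give \<open>(3 * a - 2) + (3 * b - 2) + 2\<close>, which is
  \<open>3 * (a + b) - 2\<close>. Quantifying over the rest of both stacks allows the
  subcomputations to run on top of pending work.\<close>

lemma machine_computes_table:
  assumes "vs Z \<noteq> {}" "length Z \<le> n" "low_rank r A Z"
  shows "\<exists>T k. k + 2 \<le> 3 * card (vs Z) \<and> sound (vs Z) T \<and> complete (vs Z) T \<and>
    (\<forall>ts Ts. (machine_step r M cover e ^^ k) ((True # Z) # ts, Ts) = (ts, T # Ts))"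
  using assms
proof (induction "card (vs Z)" arbitrary: Z rule: less_induct)
  case less
  let ?step = "machine_step r M cover e"
  have card: "card (vs Z) \<ge> 1" using less.prems(1) by (simp add: Suc_le_eq card_gt_0_iff)
  show ?case
  proof (cases "card (vs Z) = 1")
    case True
    then obtain v where v: "vs Z = {v}" by (rule card_1_singletonE)
    have "is_single n Z" unfolding is_single_def using v mem_vs by auto
    then have "?step ((True # Z) # ts, Ts) = (ts, leaf_table r M cover e Z # Ts)" for ts Ts
      by (simp add: machine_step_def)
    then show ?thesis using leaf_table_correct[OF less.prems(2,3) v] True v
      by (intro exI[of _ "leaf_table r M cover e Z"] exI[of _ 1]) simp
  next
    case False
    then have card2: "2 \<le> card (vs Z)" using card by simp
    define X where "X = split_vec r A Z"
    define Y where "Y = diff_vec n Z X"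
    have split: "is_split r A Z X" unfolding X_def using splits[OF card2 less.prems(3)] .
    have lenX: "length X \<le> n" unfolding X_def by (rule split_vec_length)
    have lenY: "length Y \<le> n" unfolding Y_def diff_vec_def by simp
    have vsY: "vs Y = vs Z - vs X" unfolding Y_def by (rule vs_diff_vec)
    have low: "low_rank r A X" "low_rank r A Y" using split unfolding is_split_def Y_def by auto
    have X: "vs X \<noteq> {}" "vs X \<subseteq> vs Z" "vs Y \<noteq> {}"
      unfolding vsY using split by (auto simp: is_split_def vs_def)
    have cards: "card (vs X) + card (vs Y) = card (vs Z)"
      unfolding vsY using X(2) card_mono[OF finite_vs X(2)] by (simp add: card_Diff_subset)
    have pos: "0 < card (vs X)" "0 < card (vs Y)" using X by (simp_all add: card_gt_0_iff)
    have "card (vs X) < card (vs Z)" "card (vs Y) < card (vs Z)" using cards pos by linarith+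
    note IH = less.hyps[OF this(1) X(1) lenX low(1)] less.hyps[OF this(2) X(3) lenY low(2)]
    obtain T k where T: "k + 2 \<le> 3 * card (vs X)" "sound (vs X) T" "complete (vs X) T"
      "\<forall>ts Ts. (?step ^^ k) ((True # X) # ts, Ts) = (ts, T # Ts)" using IH(1) by blast
    obtain T' k' where T': "k' + 2 \<le> 3 * card (vs Y)" "sound (vs Y) T'" "complete (vs Y) T'"
      "\<forall>ts Ts. (?step ^^ k') ((True # Y) # ts, Ts) = (ts, T' # Ts)" using IH(2) by blast
    have "\<not> is_single n Z"
    proof
      assume single: "is_single n Z"
      obtain v where v: "v \<in> vs Z" using less.prems(1) by blast
      have "vs Z \<subseteq> {v}" using single v unfolding is_single_def vs_def by auto
      then show False using card2 card_mono[of "{v}" "vs Z"] by simp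
    qed
    then have 1: "?step ((True # Z) # ts, Ts) = ((True # X) # (True # Y) # (False # Z) # ts, Ts)" for ts Ts
      by (simp add: machine_step_def X_def Y_def)
    let ?J = "join_table r M e Z X T T'"
    \<comment> \<open>The cell \<open>X\<close> is finished first, so its table lies below that of
      \<open>Y\<close>. The task records only \<open>Z\<close>, and evaluating
      \<open>split_vec\<close> again gives the same \<open>X\<close>.\<close>
    have 2: "?step ((False # Z) # ts, T' # T # Ts) = (ts, ?J # Ts)" for ts Ts
      by (simp add: machine_step_def X_def) (simp add: lookup_def)
    have "(?step ^^ Suc (k' + Suc (k + 0))) ((True # Z) # ts, Ts) = (ts, ?J # Ts)" for ts Ts
    proof -
      have "(?step ^^ Suc (k' + Suc (k + 0))) ((True # Z) # ts, Ts) =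
         ?step ((?step ^^ k') ((?step ^^ k) (?step ((True # Z) # ts, Ts))))"
        by (simp add: funpow_add funpow_swap1)
      then show ?thesis using 1 2 T(4) T'(4) by simp
    qed
    moreover have "sound (vs Z) ?J \<and> complete (vs Z) ?J"
      using join_table_correct[OF less.prems(2,3) lenX X(2) T(2,3)] T'(2,3) vsY by simp
    moreover have "Suc (k' + Suc (k + 0)) + 2 \<le> 3 * card (vs Z)" using T(1) T'(1) cards by linarith
    ultimately show ?thesis by blast
  qed
qed

lemma set_weights:
  assumes "0 < n"
  shows "set (weights r M cover e) = {sum f V | f. feasible f}"
proof -
  let ?Z = "map (\<lambda>_. True) [0..<n]"
  let ?step = "machine_step r M cover e"
  have vsZ: "vs ?Z = V" by (auto simp: vs_def mem_map)
  have "row_space E V (V - V) \<subseteq> {{}}" by (auto simp: row_space_def)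
  then have "card (row_space E V (V - V)) \<le> 2 ^ r"
    using card_mono[of "{{}}" "row_space E V (V - V)"] by (simp add: order_trans[of _ 1])
  then have "low_rank r A ?Z" unfolding low_rank_iff vsZ rank_le_def .
  then obtain T k where T: "k + 2 \<le> 3 * n" "sound V T" "complete V T"
    "\<forall>ts Ts. (?step ^^ k) ((True # ?Z) # ts, Ts) = (ts, T # Ts)"
    using machine_computes_table[of ?Z] assms unfolding vsZ by auto
  have idle: "(?step ^^ i) ([], Ts) = ([], Ts)" for i Ts by (induction i) (simp_all add: machine_step_def)
  have "(?step ^^ (3 * n)) ([True # ?Z], []) = (?step ^^ (3 * n - k)) ((?step ^^ k) ([True # ?Z], []))"
    using T(1) by (metis (no_types, lifting) add_leD1 comp_apply funpow_add le_add_diff_inverse2)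
  then have root: "root_table r M cover e = T"
    using T(4) idle unfolding root_table_def by simp
  show ?thesis
  proof (intro set_eqI iffI)
    fix x assume "x \<in> set (weights r M cover e)"
    then obtain s where s: "s \<in> set T" "\<forall>v<n. val s v = 0" "val s n = x" unfolding weights_def root by (auto simp del: upt_Suc)
    then obtain f where f: "\<forall>v\<in>V. admissible cover e v (f v) (f v + sum f (nb v \<inter> V) + val s v)"
      "\<forall>v\<le>n. v \<notin> V \<longrightarrow> val s v = sum f (nb v \<inter> V)" using T(2) unfolding sound_def by blast
    have nbV: "nb v \<inter> V = nb v" for v by (auto simp: nb_def)
    have "feasible f" using f(1) s(2) unfolding feasible_def nbV by simp
    moreover have "x = sum f V" using f(2) s(3) by (simp add: nbV nb_top)
    ultimately show "x \<in> {sum f V | f. feasible f}" by blast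
  next
    fix x assume "x \<in> {sum f V | f. feasible f}"
    then obtain f where f: "feasible f" "x = sum f V" by blast
    obtain s where s: "s \<in> set T" "\<forall>v\<le>n. val s v = cut_weight f V v" using T(3) f unfolding complete_def by blast
    have "val s v = 0" if "v < n" for v
    proof -
      have "cut_weight f V v = sum f (nb v - V)" using that by (simp add: cut_weight_def signature_def)
      also have "nb v - V = {}" by (auto simp: nb_def)
      finally show ?thesis using s(2) that by simp
    qed
    moreover have sn: "val s n = x" using s(2) f(2) by (simp add: cut_weight_def signature_def nb_top)
    moreover have "x \<le> M * n" using cut_weight_le[of f M V n] feasible_le[OF f(1)] sn s(2) by simp
    ultimately show "x \<in> set (weights r M cover e)"
      unfolding weights_def root using s(1) by (auto simp del: upt_Suc)
  qed
qed

end

section \<open>Instances and running time\<close>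

definition adj_mat :: "graph \<Rightarrow> bool list list" where
  "adj_mat G = map (\<lambda>v. map (\<lambda>w. (v, w) \<in> parcs G) [0..<card (pverts G)]) [0..<card (pverts G)]"

lemma length_adj_mat [simp]: "length (adj_mat G) = card (pverts G)"
  by (simp add: adj_mat_def)

lemma adj_matrix_adj_mat:
  assumes "input_graph G"
  shows "adj_matrix (adj_mat G) (\<lambda>v w. (v, w) \<in> parcs G)"
proof -
  interpret pair_graph G using assms unfolding input_graph_def by simp
  have less: "v < card (pverts G) \<and> w < card (pverts G)" if "(v, w) \<in> parcs G" for v w
    using arc_fst_in_verts[OF that] arc_snd_in_verts[OF that] input_graph_verts[OF assms] by (metis fst_conv snd_conv lessThan_iff)
  show ?thesis
  proof
    show "mem (row (adj_mat G) v) w \<longleftrightarrow> (v, w) \<in> parcs G" for v w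
      using less[of v w] by (auto simp: adj_mat_def lookup_def)
    show "(v, w) \<in> parcs G \<Longrightarrow> v < length (adj_mat G) \<and> w < length (adj_mat G)" for v w using less by simp
    show "(v, w) \<in> parcs G \<longleftrightarrow> (w, v) \<in> parcs G" for v w by (rule input_graph_sym[OF assms])
    show "(v, v) \<notin> parcs G" for v using pair_no_loops[of "(v, v)"] by auto
  qed
qed

definition encode_inst :: "bounded_inst \<Rightarrow> bool list list \<times> bool list list \<times> bool list list" where
  "encode_inst x = (case x of (G, k, u) \<Rightarrow> (adj_mat G, map (\<lambda>v. bits (k v)) [0..<card (pverts G)],
     map (\<lambda>v. bits (u v)) [0..<card (pverts G)]))"

lemma encode_map: "encode (map f xs) = enc_list (map (\<lambda>x. encode (f x)) xs)"
  by (simp add: encode_list_def o_def)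

lemma encode_adj_mat: "encode (adj_mat G) = enc_graph G"
  by (simp add: adj_mat_def enc_graph_def enc_vector_def encode_map encode_bool_def)

lemma encode_encode_inst: "encode (encode_inst (G, k, u)) = enc_bounded_inst (G, k, u)"
  by (simp add: encode_inst_def encode_adj_mat encode_map encode_bits enc_vector_def)

lemma Min_Max_sorted:
  fixes xs :: "nat list"
  assumes "sorted xs" "xs \<noteq> []"
  shows "Min (set xs) = val xs 0" "Max (set xs) = val (rev xs) 0"
proof -
  obtain x ys where "xs = x # ys" using assms(2) by (cases xs) auto
  then show "Min (set xs) = val xs 0" using assms(1) by (auto intro!: Min_eqI)
  obtain y zs where "xs = zs @ [y]" using assms(2) by (cases xs rule: rev_cases) auto
  then show "Max (set xs) = val (rev xs) 0" using assms(1) by (auto intro!: Max_eqI simp: sorted_append)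
qed

text \<open>The rank bound uses \<open>Suc c\<close> because the splitting theorem needs a positive
  bound on the clique-width, while \<open>c\<close> may be 0.\<close>

lemma algorithm_correct:
  assumes G: "input_graph G" and cw: "clique_width G \<le> c" and u: "\<And>v. v \<in> pverts G \<Longrightarrow> u v \<le> M"
  shows "encode (algorithm (6 * Suc c) M cover (encode_inst (G, k, u))) =
    enc_option (if cover then GDF (G, k, u) else GPF (G, k, u))"
proof (cases "pverts G = {}")
  case True
  then have "algorithm (6 * Suc c) M cover (encode_inst (G, k, u)) = [False]"
    by (simp add: algorithm_def encode_inst_def adj_mat_def)
  moreover have "GDF (G, k, u) = Some 0" "GPF (G, k, u) = Some 0"
    using True by (simp_all add: min_value_def max_value_def)
  ultimately show ?thesis by (simp add: enc_nat.simps[of 0])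
next
  case False
  define N where "N = card (pverts G)"
  have verts: "pverts G = {..<N}" unfolding N_def by (rule input_graph_verts[OF G])
  have N: "0 < N" using False verts by auto
  define r where "r = 6 * Suc c"
  define A where "A = adj_mat G"
  define E where "E = (\<lambda>v w. (v, w) \<in> parcs G)"
  define cap where "cap = Suc (M + M * N)"
  define ks where "ks = map (\<lambda>v. min cap (k v)) [0..<N]"
  define us where "us = map (\<lambda>v. min (Suc M) (u v)) [0..<N]"
  have lenA: "length A = N" by (simp add: A_def N_def)
  have pre: "preprocess M (encode_inst (G, k, u)) = (A, ks, us)"
    by (simp add: preprocess_def encode_inst_def A_def ks_def us_def cap_def N_def unary_bits o_def)
  interpret adj_matrix A E unfolding A_def E_def by (rule adj_matrix_adj_mat[OF G])
  have ksv: "val ks v = min cap (k v)" and usv: "val us v = u v" if "v < N" for v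
    using that u[of v] verts by (simp_all add: ks_def us_def lookup_def)
  interpret dp A E ks us r M cover
  proof
    show "is_split r A Z (split_vec r A Z)" if Z: "2 \<le> card (vs Z)" "low_rank r A Z" for Z
    proof (rule split_vec_correct)
      have "rank_le E (vs Z) (V - vs Z) (6 * Suc c)" using Z(2) unfolding low_rank_iff r_def .
      moreover have "clique_width G \<le> Suc c" using cw by simp
      moreover have "pverts G = V" using verts lenA by simp
      ultimately show "\<exists>X\<subseteq>vs Z. X \<noteq> {} \<and> X \<noteq> vs Z \<and> rank_le E X (V - X) r \<and> rank_le E (vs Z - X) (V - (vs Z - X)) r"
        using clique_width_low_rank_split[OF G, of "Suc c" "vs Z"] Z(1) vs_subset[of Z] unfolding E_def r_def by simp
    qed
    show "val us v \<le> M" if "v < length A" for v using that usv u verts lenA by simp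
  qed
  have feas: "feasible f \<longleftrightarrow> (\<forall>v\<in>pverts G. f v \<le> u v \<and>
      (if cover then k v \<le> (\<Sum>w\<in>closed_nbhd G v. f w) else (\<Sum>w\<in>closed_nbhd G v. f w) \<le> k v))" for f
  proof -
    have sum: "(\<Sum>w\<in>closed_nbhd G v. f w) = f v + sum f (nb v)" if "v < N" for v
    proof -
      have "closed_nbhd G v = insert v (nb v)" using that lenA by (simp add: closed_nbhd_def nb_vertex E_def)
      moreover have "v \<notin> nb v" using that lenA by (simp add: nb_vertex)
      ultimately show ?thesis by simp
    qed
    \<comment> \<open>The inequality is strict: a demand cut down to \<open>cap\<close> stays
      unsatisfiable for domination and ineffective for packing.\<close>
    have bound: "f v + sum f (nb v) < cap" if f: "\<forall>v<N. f v \<le> u v" and v: "v < N" for v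
    proof -
      have fM: "f w \<le> M" if "w < N" for w using f[rule_format, OF that] u[of w] verts that by simp
      have "nb v \<subseteq> V" by (auto simp: nb_def)
      have "sum f (nb v) \<le> of_nat (card (nb v)) * M"
        by (rule sum_bounded_above) (use fM \<open>nb v \<subseteq> V\<close> lenA in auto)
      also have "\<dots> \<le> N * M" using card_mono[OF _ \<open>nb v \<subseteq> V\<close>] lenA by (intro mult_le_mono1) simp
      finally show ?thesis using fM[OF v] by (simp add: cap_def mult.commute)
    qed
    have "feasible f \<longleftrightarrow> (\<forall>v<N. f v \<le> u v \<and>
       (if cover then min cap (k v) \<le> f v + sum f (nb v) else f v + sum f (nb v) \<le> min cap (k v)))"
      unfolding feasible_def admissible_def lenA using ksv usv by simp
    also have "\<dots> \<longleftrightarrow> (\<forall>v<N. f v \<le> u v \<and>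
       (if cover then k v \<le> f v + sum f (nb v) else f v + sum f (nb v) \<le> k v))"
    proof (cases "\<forall>v<N. f v \<le> u v")
      case True
      then have "min cap (k v) \<le> f v + sum f (nb v) \<longleftrightarrow> k v \<le> f v + sum f (nb v)"
        "f v + sum f (nb v) \<le> min cap (k v) \<longleftrightarrow> f v + sum f (nb v) \<le> k v" if "v < N" for v
        using bound[OF True that] by auto
      then show ?thesis by auto
    qed auto
    finally show ?thesis unfolding verts using sum by (auto split: if_splits)
  qed
  define ws where "ws = weights r M cover (A, ks, us)"
  have set_ws: "set ws = {sum f (pverts G) | f. feasible f}"
    unfolding ws_def using set_weights lenA N verts by simp
  have sorted: "sorted ws" unfolding ws_def weights_def by (intro sorted_wrt_filter sorted_upt)
  have GDF: "GDF (G, k, u) = min_value (set ws)" if cover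
    unfolding set_ws using feas that by simp
  have GPF: "GPF (G, k, u) = max_value (set ws)" if "\<not> cover"
    unfolding set_ws using feas that by simp
  have "fst (encode_inst (G, k, u)) \<noteq> []" using N by (simp add: encode_inst_def adj_mat_def N_def)
  then have alg: "algorithm r M cover (encode_inst (G, k, u)) =
      (if ws = [] then [] else False # bits (if cover then val ws 0 else val (rev ws) 0))"
    unfolding algorithm_def pre ws_def[symmetric] by simp
  show ?thesis unfolding r_def[symmetric] alg
    using GDF GPF Min_Max_sorted[OF sorted] by (auto simp: min_value_def max_value_def encode_bits simp del: GDF.simps GPF.simps)
qed

text \<open>The map \<open>h\<close> is only a change of view: it reads an instance as a typed value
  with the very same code, so it costs no time. The polynomial \<open>[:2, 1:] ^ k\<close> takes the
  value \<open>(2 + y) ^ k\<close> at \<open>y\<close>, which is the form of bound used by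
  \<open>pbounded\<close>.\<close>

lemma poly_time_solvableI:
  assumes "ptime F" and h: "\<And>x. x \<in> I \<Longrightarrow> encode (h x) = enc x"
    and F: "\<And>x. x \<in> I \<Longrightarrow> encode (F (h x)) = enc_option (P x)"
  shows "poly_time_solvable enc I P"
proof -
  obtain p B T where T: "pbounded T" and p: "ptime_prog p B T F" using assms(1) unfolding ptime_def by blast
  obtain k where k: "\<And>x. T x \<le> (sz x + 2) ^ k" using T unfolding pbounded_def by blast
  have "\<exists>m\<le>poly ([:2, 1:] ^ k) (size (enc x)). computes_in_time p (enc x) m (enc_option (P x))" if x: "x \<in> I" for x
  proof -
    have "((\<lambda>_. Leaf)(0 := enc x)) 0 = encode (h x)" using h[OF x] by simp
    then obtain s where s: "runs p ((\<lambda>_. Leaf)(0 := enc x)) (T (h x)) s" "s 0 = enc_option (P x)"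
      using ptime_progD[OF p, of "(\<lambda>_. Leaf)(0 := enc x)" "h x"] F[OF x] by auto
    then obtain m where m: "m \<le> T (h x)" "exec p ((\<lambda>_. Leaf)(0 := enc x)) m s" unfolding runs_def by blast
    have "T (h x) \<le> poly ([:2, 1:] ^ k) (size (enc x))"
      using k[of "h x"] h[OF x] by (simp add: add.commute)
    then show ?thesis using m s(2) unfolding computes_in_time_def by (meson order_trans)
  qed
  then show ?thesis unfolding poly_time_solvable_def by blast
qed

lemma bounded_poly_time:
  "poly_time_solvable enc_bounded_inst {(G, k, u). input_graph G \<and> (\<forall>v\<in>pverts G. u v \<le> M) \<and> clique_width G \<le> c}
     (if cover then GDF else GPF)"
proof (rule poly_time_solvableI[OF ptime_algorithm[of "6 * Suc c" M cover], of _ encode_inst])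
  fix x :: bounded_inst
  assume x: "x \<in> {(G, k, u). input_graph G \<and> (\<forall>v\<in>pverts G. u v \<le> M) \<and> clique_width G \<le> c}"
  obtain G k u where [simp]: "x = (G, k, u)" by (cases x)
  show "encode (encode_inst x) = enc_bounded_inst x" by (simp only: \<open>x = (G, k, u)\<close> encode_encode_inst)
  show "encode (algorithm (6 * Suc c) M cover (encode_inst x)) = enc_option ((if cover then GDF else GPF) x)"
    using algorithm_correct[of G c u M cover k] x by (auto split: if_splits)
qed

definition unmark :: "nat \<Rightarrow> marked_inst \<Rightarrow> bounded_inst" where
  "unmark l x = (case x of (G, k, t) \<Rightarrow> (G, k, \<lambda>v. if t v = Zero then 0 else l))"

lemma marked_problems: "LDF l x = GDF (unmark l x)" "LPF l x = GPF (unmark l x)"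
proof -
  obtain G k t where x: "x = (G, k, t)" by (cases x)
  have "f v \<in> {0..l} \<and> P \<and> (t v = Zero \<longrightarrow> f v = 0) \<longleftrightarrow> f v \<le> (if t v = Zero then 0 else l) \<and> P" for f v P
    by auto
  then show "LDF l x = GDF (unmark l x)" "LPF l x = GPF (unmark l x)" by (simp_all add: x unmark_def)
qed

text \<open>A mark has the code of a bit, not of a number, so here the translation into the bounds 0
  and \<open>l\<close> is part of the program.\<close>

lemma marked_poly_time:
  "poly_time_solvable enc_marked_inst {(G, k, t). input_graph G \<and> clique_width G \<le> c}
     (if cover then LDF l else LPF l)"
proof -
  let ?F = "\<lambda>d :: bool list list \<times> bool list list \<times> bool list.
     algorithm (6 * Suc c) l cover (fst d, fst (snd d), map (\<lambda>b. if b then bits l else []) (snd (snd d)))"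
  let ?h = "\<lambda>(G, k, t). (adj_mat G, map (\<lambda>v. bits (k v)) [0..<card (pverts G)],
     map (\<lambda>v. t v = Free) [0..<card (pverts G)])"
  have "ptime ?F" by (rule ptime_comp[OF ptime_algorithm]) (intro ptime_intros)
  then show ?thesis
  proof (rule poly_time_solvableI[of _ _ ?h])
    fix x :: marked_inst
    assume x: "x \<in> {(G, k, t). input_graph G \<and> clique_width G \<le> c}"
    obtain G k t where x': "x = (G, k, t)" by (cases x)
    have mark: "enc_bool (m = Free) = enc_mark m" for m by (cases m) auto
    show "encode (?h x) = enc_marked_inst x"
      by (simp add: x' encode_adj_mat encode_map encode_bits enc_vector_def encode_bool_def mark)
    have "(if t v = Free then bits l else []) = bits (if t v = Zero then 0 else l)" for v
      by (cases "t v") (simp_all add: bits.simps[of 0])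
    then have "?F (?h x) = algorithm (6 * Suc c) l cover (encode_inst (unmark l x))"
      by (simp add: x' encode_inst_def unmark_def o_def)
    then show "encode (?F (?h x)) = enc_option ((if cover then LDF l else LPF l) x)"
      using algorithm_correct[of G c "\<lambda>v. if t v = Zero then 0 else l" l cover k] x
      by (simp add: marked_problems x' unmark_def del: GDF.simps GPF.simps LDF.simps LPF.simps)
  qed
qed

lemma poly_time_solvable_mono: "poly_time_solvable enc I P \<Longrightarrow> J \<subseteq> I \<Longrightarrow> poly_time_solvable enc J P"
  unfolding poly_time_solvable_def by blast

theorem theorem6:
  shows "(\<forall>M c :: nat.
            poly_time_solvable enc_bounded_inst
              {(G, k, u). input_graph G \<and> (\<forall>v\<in>pverts G. u v \<le> M) \<and> clique_width G \<le> c} GDF \<and>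
            poly_time_solvable enc_bounded_inst
              {(G, k, u). input_graph G \<and> (\<forall>v\<in>pverts G. u v \<le> M) \<and> clique_width G \<le> c} GPF) \<and>
         (\<forall>l c :: nat.
            poly_time_solvable enc_marked_inst
              {(G, k, t). input_graph G \<and> (\<forall>v\<in>pverts G. t v = Free) \<and> clique_width G \<le> c} (LDF l) \<and>
            poly_time_solvable enc_marked_inst
              {(G, k, t). input_graph G \<and> (\<forall>v\<in>pverts G. t v = Free) \<and> clique_width G \<le> c} (LPF l) \<and>
            poly_time_solvable enc_marked_inst
              {(G, k, t). input_graph G \<and> clique_width G \<le> c} (LDF l))"
proof (intro conjI allI)
  fix M c :: nat
  show "poly_time_solvable enc_bounded_inst
      {(G, k, u). input_graph G \<and> (\<forall>v\<in>pverts G. u v \<le> M) \<and> clique_width G \<le> c} GDF"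
    "poly_time_solvable enc_bounded_inst
      {(G, k, u). input_graph G \<and> (\<forall>v\<in>pverts G. u v \<le> M) \<and> clique_width G \<le> c} GPF"
    using bounded_poly_time[of M c True] bounded_poly_time[of M c False] by simp_all
next
  fix l c :: nat
  have ldf: "poly_time_solvable enc_marked_inst {(G, k, t). input_graph G \<and> clique_width G \<le> c} (LDF l)"
    and lpf: "poly_time_solvable enc_marked_inst {(G, k, t). input_graph G \<and> clique_width G \<le> c} (LPF l)"
    using marked_poly_time[of c True l] marked_poly_time[of c False l] by simp_all
  show "poly_time_solvable enc_marked_inst {(G, k, t). input_graph G \<and> clique_width G \<le> c} (LDF l)" by (rule ldf)
  show "poly_time_solvable enc_marked_inst
      {(G, k, t). input_graph G \<and> (\<forall>v\<in>pverts G. t v = Free) \<and> clique_width G \<le> c} (LDF l)"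
    by (rule poly_time_solvable_mono[OF ldf]) auto
  show "poly_time_solvable enc_marked_inst
      {(G, k, t). input_graph G \<and> (\<forall>v\<in>pverts G. t v = Free) \<and> clique_width G \<le> c} (LPF l)"
    by (rule poly_time_solvable_mono[OF lpf]) auto
qed

end
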